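(* Let $G_1,G_2,H_1,H_2,\Gamma,\Delta,W$ be as in the context (with properties (L1)–(L3)), let $X=\Gamma\backslash(G_1\times G_2)$ with its unique $(G_1\times G_2)$-invariant probability measure $\mu$, and let $Y=\Gamma\backslash(H_1\times W)=\{\Gamma(h,w)\mid h\in H_1,w\in W\}\subset X$. Let $\sigma$ be the $H_1$-transverse measure of the $(G_1,H_1)$-transverse system $(X,Y,\mu)$, and let $\eta$ be the finite $H_1$-invariant Borel measure on $X$ given by $$\eta(f)=\frac1{c(H_1,H_2,\Delta)}\int_{\pi_2(W)}\big((e,g_2)^{-1}_*\sigma_o\big)(f)\,dm_{H_2\backslash G_2}(H_2g_2),\qquad f\in C_c(X).$$ Then: (i) $\eta(X\setminus Y)=0$. (ii) $\sigma=\eta|_Y$; hence in particular the Siegel constant is given by $\sigma(Y)=\dfrac{m_{H_2\backslash G_2}(\pi_2(W))}{c(H_1,H_2,\Delta)}$.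
   Context: $G_1,G_2$ are unimodular lcsc (locally compact second countable) groups, $H_j<G_j$ closed unimodular subgroups ($j=1,2$), $\pi_j:G_j\to H_j\backslash G_j$ the projections, with compatible Haar measures $m_{G_j},m_{H_j}$ and invariant measures $m_{H_j\backslash G_j}$, i.e. $\int_{G_j}f\,dm_{G_j}=\int_{H_j\backslash G_j}\int_{H_j}f(hg)\,dm_{H_j}(h)\,dm_{H_j\backslash G_j}(H_jg)$. $\Gamma<G_1\times G_2$ is a lattice such that: (L1) $\Delta:=\Gamma\cap(H_1\times H_2)$ is a cocompact lattice in $H_1\times H_2$; (L2) $\mathrm{pr}_{G_2}(\Gamma)$ is dense in $G_2$ and $\mathrm{pr}_{H_2}(\Delta)$ is dense in $H_2$; (L3) if $(\gamma_1,\gamma_2)\in\Gamma$ and $\gamma_1\in H_1$, then $\gamma_2\in H_2$; moreover $\Gamma\cap(\{e\}\times G_2)=\{(e,e)\}$. $W\subset G_2$ is a bounded Jordan-measurable set (its boundary is $m_{G_2}$-null) with non-empty interior. $G_1\times G_2$ acts on $X$ by $(g_1,g_2).\Gamma(x_1,x_2)=\Gamma(x_1g_1^{-1},x_2g_2^{-1})$, and $G_1$ acts via the first factor. $Y$ is an $H_1$-invariant Borel set with $G_1.Y=X$, and with $Y_x=\{H_1g\in H_1\backslash G_1\mid g.x\in Y\}$ the system $(X,Y,\mu)$ is integrable: $\int_X|Y_x\cap L|\,d\mu(x)<\infty$ for all compact $L\subset H_1\backslash G_1$. Its $H_1$-transverse measure $\sigma$ is the unique finite $H_1$-invariant Borel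 measure on $Y$ with $\int_X\sum_{H_1g\in Y_x}\int_{H_1}F((hg)^{-1},hg.x)\,dm_{H_1}(h)\,d\mu(x)=\int_{G_1}\int_YF(g,y)\,d\sigma(y)\,dm_{G_1}(g)$ for all bounded Borel $F$ on $G_1\times Y$ vanishing outside $L\times Y$ for some compact $L\subset G_1$. The number $\sigma(Y)$ is called the Siegel constant. $Y_o\subset X$ is the closed $(H_1\times H_2)$-orbit of the base point $\Gamma$, identified with $\Delta\backslash(H_1\times H_2)$, and $\sigma_o$ is its unique $(H_1\times H_2)$-invariant probability measure (regarded also as a measure on $X$). The constant $c(H_1,H_2,\Delta)>0$ is determined by requiring, for all bounded Borel functions $F$ of bounded support on $H_1\times H_2$, $$(m_{H_1}\otimes m_{H_2})(F)=c(H_1,H_2,\Delta)^{-1}\int_{Y_o}\sum_{(\delta_1,\delta_2)\in\Delta}F(\delta_1h_1,\delta_2h_2)\,d\sigma_o(\Delta(h_1,h_2)).$$ By $H_2$-invariance of $\sigma_o$, $(e,g_2)^{-1}_*\sigma_o$ depends only on the coset $H_2g_2$.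
   Formalization: Two assumptions are added, without which the claim fails: the Haar measures are normalised so that Γ has covolume one for m_{G_1}⊗m_{G_2}, and m_{H_2\G_2}-almost every coset in π_2(W) meets the interior of W. *)

theory Defs
  imports "HOL-Analysis.Analysis" "HOL-Probability.Probability_Measure"
begin

text \<open>
  Groups are types of class \<^class>\<open>topological_group_add\<close>, the library's (not necessarily
  commutative) topological groups. They are written additively: \<open>g + h\<close> is the product \<open>gh\<close>,
  \<open>- g\<close> is the inverse of \<open>g\<close> and \<open>0\<close> is the identity. The order of summands matters throughout.
\<close>

definition add_subgroup :: "'g::group_add set \<Rightarrow> bool" where
  "add_subgroup H \<longleftrightarrow> 0 \<in> H \<and> (\<forall>x\<in>H. \<forall>y\<in>H. x + y \<in> H) \<and> (\<forall>x\<in>H. - x \<in> H)"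


subsection \<open>Haar measures on closed subgroups\<close>

text \<open>
  The measure lives on \<open>H\<close> itself, with the Borel sets of \<open>H\<close>. In the second countable locally
  compact setting, finiteness on compact sets already makes a Borel measure Radon.
\<close>

definition left_haar_measure_on :: "'g::{group_add,topological_space} set \<Rightarrow> 'g measure \<Rightarrow> bool" where
  "left_haar_measure_on H m \<longleftrightarrow>
     sets m = sets (restrict_space borel H) \<and>
     (\<forall>C. compact C \<and> C \<subseteq> H \<longrightarrow> emeasure m C < \<infinity>) \<and>
     emeasure m H \<noteq> 0 \<and>
     (\<forall>h\<in>H. distr m m (\<lambda>x. h + x) = m)"

definition unimodular_on :: "'g::{group_add,topological_space} set \<Rightarrow> bool" where
  "unimodular_on H \<longleftrightarrow>
     (\<forall>m. left_haar_measure_on H m \<longrightarrow> (\<forall>h\<in>H. distr m m (\<lambda>x. x + h) = m))"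


subsection \<open>Coset spaces\<close>

text \<open>
  For a subgroup \<open>L\<close> of \<open>K\<close>, the coset space consists of the sets \<open>L + k\<close> with \<open>k \<in> K\<close>;
  it carries the quotient topology of the subspace topology of \<open>K\<close>.
\<close>

definition right_coset :: "'g::plus set \<Rightarrow> 'g \<Rightarrow> 'g set" where
  "right_coset L g = (\<lambda>l. l + g) ` L"

definition coset_space :: "'g::plus set \<Rightarrow> 'g set \<Rightarrow> 'g set set" where
  "coset_space K L = right_coset L ` K"

definition coset_topology :: "'g::{plus,topological_space} set \<Rightarrow> 'g set \<Rightarrow> 'g set topology" where
  "coset_topology K L =
     topology (\<lambda>U. U \<subseteq> coset_space K L \<and> openin (top_of_set K) {k\<in>K. right_coset L k \<in> U})"

lemma openin_coset_topology:
  "openin (coset_topology K L) U \<longleftrightarrow>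
     U \<subseteq> coset_space K L \<and> openin (top_of_set K) {k\<in>K. right_coset L k \<in> U}"
proof -
  have int: "{k\<in>K. right_coset L k \<in> S \<inter> T} =
      {k\<in>K. right_coset L k \<in> S} \<inter> {k\<in>K. right_coset L k \<in> T}" for S T
    by auto
  have un: "{k\<in>K. right_coset L k \<in> \<Union>\<U>} = (\<Union>S\<in>\<U>. {k\<in>K. right_coset L k \<in> S})" for \<U>
    by auto
  have "istopology (\<lambda>U. U \<subseteq> coset_space K L \<and> openin (top_of_set K) {k\<in>K. right_coset L k \<in> U})"
    unfolding istopology_def int un by (auto intro!: openin_Int openin_Union)
  then show ?thesis
    by (simp add: coset_topology_def)
qed

lemma topspace_coset_topology: "topspace (coset_topology K L) = coset_space K L"
proof -
  have "{k\<in>K. right_coset L k \<in> coset_space K L} = K"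
    by (auto simp: coset_space_def)
  then have "openin (coset_topology K L) (coset_space K L)"
    unfolding openin_coset_topology by (metis openin_topspace order_refl topspace_euclidean_subtopology)
  then show ?thesis
    by (metis openin_coset_topology openin_subset openin_topspace subset_antisym)
qed

definition borel_of :: "'x topology \<Rightarrow> 'x measure" where
  "borel_of T = sigma (topspace T) {U. openin T U}"

text \<open>The action \<open>g.(Lx) = L(x g\<^sup>-\<^sup>1)\<close>.\<close>

definition coset_act :: "'g::group_add \<Rightarrow> 'g set \<Rightarrow> 'g set" where
  "coset_act g c = (\<lambda>x. x - g) ` c"

text \<open>
  A representative of a coset. It is only used in expressions whose value does not depend on the
  representative, to write functions of a coset \<open>Lg\<close> that are given by a formula in \<open>g\<close>.
\<close>

definition coset_rep :: "'g set \<Rightarrow> 'g" where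
  "coset_rep c = (SOME g. g \<in> c)"

definition invariant_borel_measure ::
    "'g::{group_add,topological_space} set \<Rightarrow> 'g set \<Rightarrow> 'g set measure \<Rightarrow> bool" where
  "invariant_borel_measure K L \<nu> \<longleftrightarrow>
     sets \<nu> = sets (borel_of (coset_topology K L)) \<and>
     (\<forall>g\<in>K. distr \<nu> \<nu> (coset_act g) = \<nu>)"

definition invariant_prob_measure ::
    "'g::{group_add,topological_space} set \<Rightarrow> 'g set \<Rightarrow> 'g set measure \<Rightarrow> bool" where
  "invariant_prob_measure K L \<nu> \<longleftrightarrow> invariant_borel_measure K L \<nu> \<and> prob_space \<nu>"

text \<open>
  Compatibility of Haar measures on \<open>G\<close> and \<open>H\<close> with an invariant Radon measure on
  the space of cosets \<open>Hg\<close>. The inner integral depends only on the coset \<open>c\<close> by right invariance of \<open>mH\<close>.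
\<close>

definition compatible_measures ::
    "'g::{group_add,topological_space} set \<Rightarrow> 'g measure \<Rightarrow> 'g measure \<Rightarrow> 'g set measure \<Rightarrow> bool" where
  "compatible_measures H mG mH mQ \<longleftrightarrow>
     invariant_borel_measure UNIV H mQ \<and>
     (\<forall>C. compactin (coset_topology UNIV H) C \<longrightarrow> emeasure mQ C < \<infinity>) \<and>
     (\<forall>f :: 'g \<Rightarrow> ennreal. f \<in> borel_measurable borel \<longrightarrow>
        (\<integral>\<^sup>+ g. f g \<partial>mG) = (\<integral>\<^sup>+ c. (\<integral>\<^sup>+ h. f (h + coset_rep c) \<partial>mH) \<partial>mQ))"


subsection \<open>Lattices\<close>

definition lattice_in :: "'g::{group_add,topological_space} set \<Rightarrow> 'g set \<Rightarrow> bool" where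
  "lattice_in K \<Lambda> \<longleftrightarrow>
     add_subgroup \<Lambda> \<and> \<Lambda> \<subseteq> K \<and> discrete \<Lambda> \<and>
     (\<exists>\<nu>. invariant_borel_measure K \<Lambda> \<nu> \<and> finite_measure \<nu> \<and> emeasure \<nu> (space \<nu>) \<noteq> 0)"

definition cocompact_lattice_in :: "'g::{group_add,topological_space} set \<Rightarrow> 'g set \<Rightarrow> bool" where
  "cocompact_lattice_in K \<Lambda> \<longleftrightarrow> lattice_in K \<Lambda> \<and> compact_space (coset_topology K \<Lambda>)"

text \<open>
  \<open>lattice_constant K \<Lambda> m \<nu> c\<close>: the Haar measure \<open>m\<close> of \<open>K\<close> and the invariant probability measure
  \<open>\<nu>\<close> on the space of cosets \<open>\<Lambda>k\<close> are related by \<open>m(F) = c\<^sup>-\<^sup>1 \<integral> (\<Sum>\<lambda>. F(\<lambda>k)) d\<nu>(\<Lambda>k)\<close>. This is the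
  condition determining \<open>c(H\<^sub>1, H\<^sub>2, \<Delta>)\<close>; in general \<open>c\<^sup>-\<^sup>1\<close> is the covolume of \<open>\<Lambda>\<close>
  with respect to \<open>m\<close>, so that \<open>c = 1\<close> says that \<open>m\<close> is normalised to give \<open>\<Lambda>\<close> covolume one. The
  sum over \<open>\<Lambda>\<close> has finitely many non-zero terms.
\<close>

definition lattice_constant ::
    "'g::{group_add,topological_space} set \<Rightarrow> 'g set \<Rightarrow> 'g measure \<Rightarrow> 'g set measure \<Rightarrow> real \<Rightarrow> bool" where
  "lattice_constant K \<Lambda> m \<nu> c \<longleftrightarrow>
     c > 0 \<and>
     (\<forall>F :: 'g \<Rightarrow> real.
        F \<in> borel_measurable (restrict_space borel K) \<and> bounded (F ` K) \<and>
        (\<exists>C. compact C \<and> C \<subseteq> K \<and> (\<forall>x\<in>K - C. F x = 0)) \<longrightarrow>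
        (\<integral>x. F x \<partial>m) = inverse c * (\<integral>y. (\<Sum>\<^sub>\<infinity>l\<in>\<Lambda>. F (l + coset_rep y)) \<partial>\<nu>))"

text \<open>The map \<open>\<Delta>x \<mapsto> \<Gamma>x\<close> for \<open>\<Delta> \<subseteq> \<Gamma>\<close>, identifying an orbit of the base point \<open>\<Gamma>\<close>.\<close>

definition coset_incl :: "'g::plus set \<Rightarrow> 'g set \<Rightarrow> 'g set" where
  "coset_incl \<Gamma> c = (\<Union>x\<in>c. right_coset \<Gamma> x)"


subsection \<open>Transverse systems and transverse measures\<close>

text \<open>
  Here \<open>X\<close> is the space of cosets of \<open>\<Gamma>\<close> in \<open>G\<^sub>1 \<times> G\<^sub>2\<close>, on which \<open>G\<^sub>1\<close> acts through the first factor. The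
  return set \<open>Y\<^sub>x\<close> is a set of cosets of \<open>H\<^sub>1\<close>.
\<close>

definition return_set ::
    "'a::group_add set \<Rightarrow> ('a \<times> 'b::group_add) set set \<Rightarrow> ('a \<times> 'b) set \<Rightarrow> 'a set set" where
  "return_set H Y x = right_coset H ` {g. coset_act (g, 0) x \<in> Y}"

definition integrable_transverse_system ::
    "('a::{group_add,topological_space} \<times> 'b::{group_add,topological_space}) set \<Rightarrow> 'a set \<Rightarrow>
     ('a \<times> 'b) set measure \<Rightarrow> ('a \<times> 'b) set set \<Rightarrow> bool" where
  "integrable_transverse_system \<Gamma> H \<mu> Y \<longleftrightarrow>
     Y \<in> sets (borel_of (coset_topology UNIV \<Gamma>)) \<and>
     (\<forall>h\<in>H. coset_act (h, 0) ` Y = Y) \<and>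
     (\<Union>g. coset_act (g, 0) ` Y) = coset_space UNIV \<Gamma> \<and>
     (\<forall>L. compactin (coset_topology UNIV H) L \<longrightarrow>
        (\<integral>\<^sup>+ x. emeasure (count_space UNIV) (return_set H Y x \<inter> L) \<partial>\<mu>) < \<infinity>)"

definition transverse_measure ::
    "('a::{group_add,topological_space} \<times> 'b::{group_add,topological_space}) set \<Rightarrow> 'a set \<Rightarrow>
     'a measure \<Rightarrow> 'a measure \<Rightarrow> ('a \<times> 'b) set measure \<Rightarrow> ('a \<times> 'b) set set \<Rightarrow>
     ('a \<times> 'b) set measure \<Rightarrow> bool" where
  "transverse_measure \<Gamma> H mG mH \<mu> Y \<sigma> \<longleftrightarrow>
     sets \<sigma> = sets (restrict_space (borel_of (coset_topology UNIV \<Gamma>)) Y) \<and>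
     finite_measure \<sigma> \<and>
     (\<forall>h\<in>H. distr \<sigma> \<sigma> (coset_act (h, 0)) = \<sigma>) \<and>
     (\<forall>F :: 'a \<times> ('a \<times> 'b) set \<Rightarrow> real.
        F \<in> borel_measurable (borel \<Otimes>\<^sub>M restrict_space (borel_of (coset_topology UNIV \<Gamma>)) Y) \<and>
        bounded (F ` (UNIV \<times> Y)) \<and>
        (\<exists>L. compact L \<and> (\<forall>g y. g \<notin> L \<and> y \<in> Y \<longrightarrow> F (g, y) = 0)) \<longrightarrow>
        (\<integral>x. (\<Sum>\<^sub>\<infinity>c\<in>return_set H Y x.
            (\<integral>h. F (- (h + coset_rep c), coset_act (h + coset_rep c, 0) x) \<partial>mH)) \<partial>\<mu>)
        = (\<integral>g. (\<integral>y. F (g, y) \<partial>\<sigma>) \<partial>mG))"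

definition compactly_supported_continuous :: "'x topology \<Rightarrow> ('x \<Rightarrow> real) \<Rightarrow> bool" where
  "compactly_supported_continuous T f \<longleftrightarrow>
     continuous_map T euclideanreal f \<and>
     (\<exists>C. compactin T C \<and> (\<forall>x\<in>topspace T - C. f x = 0))"


subsection \<open>Windows\<close>

text \<open>
  Up to a null set of cosets, a coset of \<open>H\<close> that meets \<open>W\<close> also meets the interior of \<open>W\<close>. Every
  open \<open>W\<close> satisfies this. For a Jordan-measurable \<open>W\<close> (boundary null in the group) it is equivalent,
  by Fubini, to saying that almost every coset meeting \<open>W\<close> meets it in a set of positive
  Haar measure. It does not follow from Jordan measurability: in the plane with \<open>H\<close> the horizontal
  axis, the union of the unit disc and the vertical segment from \<open>(0, 2)\<close> to \<open>(0, 3)\<close> has null boundary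
  and non-empty interior, but the cosets over the segment meet \<open>W\<close> in single points.
\<close>

definition essentially_open_projection ::
    "'g::{plus,topological_space} set \<Rightarrow> 'g set measure \<Rightarrow> 'g set \<Rightarrow> bool" where
  "essentially_open_projection H mQ W \<longleftrightarrow>
     right_coset H ` W - right_coset H ` interior W \<in> null_sets (completion mQ)"

end

theory Submission
  imports Defs
begin

text \<open>
  Unfolding the coset integrals reduces the defining formula of the transverse measure to an integral
  over the ambient group. Test the formula on \<open>F(g, y) = 1\<^sub>L(g) 1\<^sub>B(y)\<close> with \<open>L\<close> compact and symmetric. By (L3) the
  hitting set of a point \<open>\<Gamma>x\<close> is parametrised by \<open>\<Delta>\<close>-classes in \<open>\<Gamma>\<close>, so the left-hand side is the
  integral over \<open>\<Gamma>\<close>-cosets of a sum over \<open>\<Delta>\<close>-classes in \<open>\<Gamma>\<close> of a \<open>\<Delta>\<close>-invariant function, that is, an integral over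
  a fundamental domain of \<open>\<Delta>\<close> in \<open>G\<^sub>1 \<times> G\<^sub>2\<close>. Disintegrating Haar measure along \<open>H\<^sub>1 \<times> H\<^sub>2\<close> turns it into
  \<open>m(L) c\<^sup>-\<^sup>1\<close> times the integral of \<open>(e, g\<^sub>2)\<^sup>-\<^sup>1\<^sub>*\<sigma>\<^sub>o(B)\<close> over the cosets \<open>H\<^sub>2 g\<^sub>2\<close>. Only cosets meeting \<open>W\<close> contribute
  when \<open>B \<subseteq> Y\<close>; conversely, as \<open>\<Delta>\<close> projects densely to \<open>H\<^sub>2\<close>, the translates over cosets meeting the
  interior of \<open>W\<close> are carried by \<open>Y\<close>.
\<close>

text \<open>The transverse formula is stated with Bochner integrals and infinite sums, both of which
  return 0 when they diverge, so it determines \<open>emeasure \<sigma> B\<close> only if the other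
  side is known to be finite. Hence \<eta> is treated before \<sigma>: it is identified with an
  explicit measure through functions of compact support, and its finiteness gives the bound for
  every Borel set below \<open>Y\<close>. The computations in between take place in
  [0, \<infinity>].

  Classes of \<Gamma> modulo \<Delta> are not formed as objects. The Borel domain \<open>O.D\<close>
  is built in the whole product group rather than in \<open>H1 \<times> H2\<close>, so weighting a
  sum over \<Gamma> with its indicator selects one element of each class.

  The projection of \<open>W\<close> is not assumed Borel. The explicit measure therefore integrates
  over the cosets meeting \<open>interior W\<close>, which form an open set; by
  \<open>W_proj\<close> the difference is null. The factor \<open>inverse c\<close> comes from
  folding integrals over \<open>H1 \<times> H2\<close> along \<Delta>, while \<mu> contributes no
  factor because \<open>covol\<close> gives \<Gamma> covolume one.\<close>

instance prod :: (topological_monoid_add, topological_monoid_add) topological_monoid_add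
proof
  fix a b :: "'a \<times> 'b"
  have "((\<lambda>x. fst (fst x) + fst (snd x)) \<longlongrightarrow> fst a + fst b) (nhds a \<times>\<^sub>F nhds b)"
       "((\<lambda>x. snd (fst x) + snd (snd x)) \<longlongrightarrow> snd a + snd b) (nhds a \<times>\<^sub>F nhds b)"
    by (intro tendsto_intros filterlim_fst filterlim_snd)+
  from tendsto_Pair[OF this] show "((\<lambda>x. fst x + snd x) \<longlongrightarrow> a + b) (nhds a \<times>\<^sub>F nhds b)"
    by (simp add: plus_prod_def)
qed

instance prod :: (topological_group_add, topological_group_add) topological_group_add
proof
  fix a :: "'a \<times> 'b"
  have "((\<lambda>x. - fst x) \<longlongrightarrow> - fst a) (nhds a)" "((\<lambda>x. - snd x) \<longlongrightarrow> - snd a) (nhds a)"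
    by (intro tendsto_intros filterlim_ident)+
  from tendsto_Pair[OF this] show "(uminus \<longlongrightarrow> - a) (nhds a)"
    by (simp add: uminus_prod_def[abs_def])
qed

section \<open>Group operations, translates, infinite sums and countable covers\<close>

lemma borel_measurable_group_uminus [measurable (raw)]:
  fixes f :: "'x \<Rightarrow> 'g::{topological_group_add,second_countable_topology}"
  assumes "f \<in> borel_measurable M"
  shows "(\<lambda>x. - f x) \<in> borel_measurable M"
  by (rule measurable_compose[OF assms]) (intro borel_measurable_continuous_onI continuous_intros)

lemma borel_measurable_group_diff [measurable (raw)]:
  fixes f g :: "'x \<Rightarrow> 'g::{topological_group_add,second_countable_topology}"
  assumes "f \<in> borel_measurable M" "g \<in> borel_measurable M"
  shows "(\<lambda>x. f x - g x) \<in> borel_measurable M"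
  using borel_measurable_add[OF assms(1) borel_measurable_group_uminus[OF assms(2)]] by simp

lemma open_add_left_image:
  fixes U :: "'g::topological_group_add set"
  assumes "open U" shows "open ((+) a ` U)"
proof -
  have "(+) a ` U = (\<lambda>x. - a + x) -` U"
    by (auto simp: image_iff add.assoc[symmetric] intro!: bexI[of _ "- a + _"])
  moreover have "open ((\<lambda>x. - a + x) -` U)"
    by (intro open_vimage assms continuous_intros)
  ultimately show ?thesis by simp
qed

lemma open_Union_translates:
  fixes U :: "'g::topological_group_add set"
  assumes "open U" shows "open (\<Union>l\<in>L. (+) l ` U)"
  using assms open_add_left_image by blast

text \<open>Both sides are \<open>0\<close> when the sum diverges.\<close>

lemma infsum_eq_enn2real_nn_integral:
  fixes f :: "'x \<Rightarrow> real"
  assumes "\<And>x. x \<in> A \<Longrightarrow> 0 \<le> f x"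
  shows "infsum f A = enn2real (\<integral>\<^sup>+x. ennreal (f x) \<partial>count_space A)"
proof -
  have "infsetsum f A = enn2real (\<integral>\<^sup>+x. ennreal (f x) \<partial>count_space A)"
    unfolding infsetsum_def using assms by (intro integral_eq_nn_integral) (auto simp: AE_count_space)
  moreover have "infsum f A = infsetsum f A"
  proof (cases "Infinite_Set_Sum.abs_summable_on f A")
    case True then show ?thesis by (simp add: infsetsum_infsum)
  next
    case False
    then have "\<not> (\<lambda>x. norm (f x)) summable_on A" using abs_summable_equivalent[of f A] by blast
    moreover have "(\<lambda>x. norm (f x)) summable_on A \<longleftrightarrow> f summable_on A"
      using assms by (intro summable_on_cong) simp
    ultimately have "\<not> f summable_on A" by blast
    with False show ?thesis
      by (simp add: infsum_not_exists infsetsum_def abs_summable_on_def not_integrable_integral_eq)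
  qed
  ultimately show ?thesis by simp
qed

text \<open>Lindelof's theorem, arranged as a sequence. The empty set is adjoined because an
  enumeration by natural numbers needs a nonempty range, and \<open>P {}\<close> keeps this
  harmless. The choices of \<open>P\<close> below are small sets, relatively compact sets,
  translates of one open set, and sets inside compact subsets of an open set.\<close>

lemma lc_countable_cover:
  fixes P :: "'g::second_countable_topology set \<Rightarrow> bool"
  assumes "\<And>x. x \<in> S \<Longrightarrow> \<exists>U. open U \<and> x \<in> U \<and> P U" and "P {}"
  shows "\<exists>U :: nat \<Rightarrow> 'g set. (\<forall>n. open (U n)) \<and> (\<forall>n. P (U n)) \<and> S \<subseteq> (\<Union>n. U n)"
proof -
  define F where "F = {U. open U \<and> P U}"
  obtain F' where F': "F' \<subseteq> F" "countable F'" "\<Union>F' = \<Union>F"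
    using Lindelof[of F] by (auto simp: F_def)
  have ne: "insert {} F' \<noteq> {}" by simp
  have c: "countable (insert {} F')" using F' by simp
  have r: "range (from_nat_into (insert {} F')) = insert {} F'"
    using range_from_nat_into[OF ne c] .
  have in_F: "from_nat_into (insert {} F') n \<in> F" for n
    using from_nat_into[OF ne, of n] F'(1) assms(2) by (auto simp: F_def)
  show ?thesis
  proof (intro exI[of _ "from_nat_into (insert {} F')"] conjI allI)
    show "open (from_nat_into (insert {} F') n)" "P (from_nat_into (insert {} F') n)" for n
      using in_F[of n] by (auto simp: F_def)
    have "S \<subseteq> \<Union>F" using assms(1) by (auto simp: F_def)
    then show "S \<subseteq> (\<Union>n. from_nat_into (insert {} F') n)"
      unfolding r using F'(3) by auto
  qed
qed

lemma lc_compact_nhd: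
  assumes "locally_compact_space (euclidean :: 'g::topological_space topology)" "open (T :: 'g set)" "x \<in> T"
  shows "\<exists>U C. open U \<and> x \<in> U \<and> U \<subseteq> C \<and> compact C \<and> U \<subseteq> T"
proof -
  have "\<forall>x :: 'g. \<exists>U. open U \<and> (\<exists>K. compact K \<and> x \<in> U \<and> U \<subseteq> K)"
    using assms(1) by (simp add: locally_compact_space_def)
  then obtain U K where "open U" "compact K" "x \<in> U" "U \<subseteq> K"
    by meson
  then show ?thesis using assms(2,3) by (intro exI[of _ "U \<inter> T"] exI[of _ K]) auto
qed

section \<open>Cosets\<close>

lemma add_subgroupD:
  assumes "add_subgroup L"
  shows "0 \<in> L" "x \<in> L \<Longrightarrow> y \<in> L \<Longrightarrow> x + y \<in> L" "x \<in> L \<Longrightarrow> - x \<in> L"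
    "x \<in> L \<Longrightarrow> y \<in> L \<Longrightarrow> x - y \<in> L"
  using assms unfolding add_subgroup_def diff_conv_add_uminus by blast+

lemma in_right_coset_iff: "x \<in> right_coset L g \<longleftrightarrow> x - g \<in> (L :: 'g::group_add set)"
  by (force simp: right_coset_def image_iff)

lemma right_coset_eq_iff:
  fixes L :: "'g::group_add set"
  assumes L: "add_subgroup L"
  shows "right_coset L g = right_coset L g' \<longleftrightarrow> g - g' \<in> L"
proof
  assume "right_coset L g = right_coset L g'"
  moreover have "g \<in> right_coset L g" using L by (simp add: in_right_coset_iff add_subgroupD)
  ultimately show "g - g' \<in> L" by (simp add: in_right_coset_iff)
next
  assume d: "g - g' \<in> L"
  have "x - g \<in> L \<longleftrightarrow> x - g' \<in> L" for x
  proof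
    assume "x - g \<in> L"
    from add_subgroupD(2)[OF L this d] show "x - g' \<in> L" by (simp add: algebra_simps)
  next
    assume "x - g' \<in> L"
    from add_subgroupD(4)[OF L this d] show "x - g \<in> L" by (simp add: algebra_simps)
  qed
  then show "right_coset L g = right_coset L g'"
    by (simp add: set_eq_iff in_right_coset_iff)
qed

lemma right_coset_add_left:
  fixes L :: "'g::group_add set"
  assumes "add_subgroup L" "l \<in> L"
  shows "right_coset L (l + g) = right_coset L g"
  using assms by (simp add: right_coset_eq_iff)

lemma coset_rep_diff:
  fixes L :: "'g::group_add set"
  assumes "add_subgroup L"
  shows "coset_rep (right_coset L g) - g \<in> L"
proof -
  have "g \<in> right_coset L g" using assms by (simp add: in_right_coset_iff add_subgroupD)
  then have "coset_rep (right_coset L g) \<in> right_coset L g"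
    unfolding coset_rep_def by (rule someI)
  then show ?thesis by (simp add: in_right_coset_iff)
qed

lemma coset_rep_obtain:
  fixes L :: "'g::group_add set"
  assumes "add_subgroup L"
  obtains l where "l \<in> L" "coset_rep (right_coset L g) = l + g"
  using coset_rep_diff[OF assms, of g] by (metis diff_add_cancel)

lemma coset_act_right_coset: "coset_act k (right_coset L g) = right_coset L (g - k)"
  for g k :: "'g::group_add"
  by (auto simp: coset_act_def right_coset_def image_image add_diff_eq)

lemma coset_incl_right_coset:
  fixes \<Gamma> \<Delta> :: "'g::group_add set"
  assumes "add_subgroup \<Gamma>" "add_subgroup \<Delta>" "\<Delta> \<subseteq> \<Gamma>"
  shows "coset_incl \<Gamma> (right_coset \<Delta> x) = right_coset \<Gamma> x"
proof -
  have "coset_incl \<Gamma> (right_coset \<Delta> x) = (\<Union>d\<in>\<Delta>. right_coset \<Gamma> (d + x))"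
    by (auto simp: coset_incl_def right_coset_def)
  also have "\<dots> = (\<Union>d\<in>\<Delta>. right_coset \<Gamma> x)"
    using assms by (intro SUP_cong refl right_coset_add_left) auto
  finally show ?thesis using add_subgroupD(1)[OF assms(2)] by auto
qed

lemma right_coset_in_coset_space: "g \<in> K \<Longrightarrow> right_coset L g \<in> coset_space K L"
  by (simp add: coset_space_def)

section \<open>Borel structure on coset spaces\<close>

lemma space_borel_of: "space (borel_of T) = topspace T"
  and sets_borel_of: "sets (borel_of T) = sigma_sets (topspace T) {U. openin T U}"
  unfolding borel_of_def using openin_subset
  by (auto intro!: space_measure_of sets_measure_of)

lemma openin_in_borel_of: "openin T U \<Longrightarrow> U \<in> sets (borel_of T)"
  by (auto simp: sets_borel_of)

abbreviation quot :: "'g::{plus,topological_space} set \<Rightarrow> 'g set \<Rightarrow> 'g set measure" where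
  "quot K L \<equiv> borel_of (coset_topology K L)"

lemma space_quot [simp]: "space (quot K L) = coset_space K L"
  by (simp add: space_borel_of topspace_coset_topology)

lemma measurable_borel_of:
  assumes "f \<in> space M \<rightarrow> topspace T" "\<And>U. openin T U \<Longrightarrow> f -` U \<inter> space M \<in> sets M"
  shows "f \<in> measurable M (borel_of T)"
  unfolding borel_of_def using assms by (intro measurable_measure_of) (auto dest: openin_subset)

lemma measurable_right_coset: "right_coset L \<in> measurable (restrict_space borel K) (quot K L)"
proof (rule measurable_borel_of)
  fix U assume "openin (coset_topology K L) U"
  then have "openin (top_of_set K) {k\<in>K. right_coset L k \<in> U}"
    by (simp add: openin_coset_topology)
  then obtain T where T: "open T" "{k\<in>K. right_coset L k \<in> U} = K \<inter> T"
    by (auto simp: openin_open)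
  have "right_coset L -` U \<inter> space (restrict_space borel K) = K \<inter> T"
    using T(2) by (auto simp: space_restrict_space)
  also have "\<dots> \<in> sets (restrict_space borel K)"
    using T(1) by (auto simp: sets_restrict_space)
  finally show "right_coset L -` U \<inter> space (restrict_space borel K) \<in> sets (restrict_space borel K)" .
qed (auto simp: space_restrict_space topspace_coset_topology coset_space_def)

lemma sets_restrict_UNIV: "sets (restrict_space borel UNIV) = sets borel"
  by (simp add: sets_restrict_space)

lemma measurable_right_coset_UNIV [measurable]: "right_coset L \<in> measurable borel (quot UNIV L)"
  using measurable_right_coset[of L UNIV] by (simp cong: measurable_cong_sets add: sets_restrict_UNIV)

text \<open>The saturation of \<open>E\<close> is the union of its left translates by
  \<open>L\<close>. Since \<open>L \<subseteq> K\<close>, a point of \<open>E\<close> in the same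
  class as a point of \<open>K\<close> lies in \<open>K\<close> itself, so cutting with
  \<open>K\<close> before projecting loses nothing.\<close>

lemma openin_right_coset_image:
  fixes K :: "'g::topological_group_add set"
  assumes K: "add_subgroup K" and L: "add_subgroup L" "L \<subseteq> K" and "open E"
  shows "openin (coset_topology K L) (right_coset L ` (E \<inter> K))"
proof -
  have "{k\<in>K. right_coset L k \<in> right_coset L ` (E \<inter> K)} = K \<inter> (\<Union>l\<in>L. (+) l ` E)" (is "?A = ?B")
  proof (intro equalityI subsetI)
    fix k assume "k \<in> ?A"
    then obtain e where "k \<in> K" "e \<in> E" "k - e \<in> L" by (auto simp: right_coset_eq_iff[OF L(1)])
    moreover have "k = (k - e) + e" by simp
    ultimately show "k \<in> ?B" by blast
  next
    fix k assume "k \<in> ?B"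
    then obtain l e where le: "k \<in> K" "l \<in> L" "e \<in> E" "k = l + e" by auto
    then have "e = - l + k" by (simp add: add.assoc[symmetric])
    moreover have "- l + k \<in> K" using le L K by (intro add_subgroupD(2)[OF K] add_subgroupD(3)[OF K]) auto
    ultimately have "e \<in> K" by simp
    then show "k \<in> ?A" using le right_coset_add_left[OF L(1)] by auto
  qed
  then show ?thesis
    unfolding openin_coset_topology using open_Union_translates[OF \<open>open E\<close>, of L]
    by (auto simp: coset_space_def openin_open_Int)
qed

section \<open>Discrete subgroups\<close>

text \<open>Serves both \<Gamma> in the whole product group and \<Delta> in
  \<open>H1 \<times> H2\<close>. The ambient group remains the full type: the domain
  \<open>D\<close> built below then represents the orbits of points outside \<open>K\<close> as
  well, as sums over \<Gamma> require.\<close>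

locale discrete_subgroup =
  fixes K \<Lambda> :: "'g::{topological_group_add,second_countable_topology,t2_space} set"
  assumes lc: "locally_compact_space (euclidean :: 'g topology)"
    and K: "add_subgroup K" "closed K"
    and \<Lambda>: "add_subgroup \<Lambda>" "\<Lambda> \<subseteq> K" "discrete \<Lambda>"
begin

text \<open>Indicators of subsets of such sets are the test functions for the lattice formula: the
  first clause gives them bounded support, the second bounds their orbit sums by 1 and makes the
  projection injective there.\<close>

definition small :: "'g set \<Rightarrow> bool" where
  "small U \<longleftrightarrow> (\<exists>C. compact C \<and> U \<subseteq> C) \<and> (\<forall>l\<in>\<Lambda>. \<forall>x\<in>U. l + x \<in> U \<longrightarrow> l = 0)"

text \<open>Subtraction is continuous at \<open>(x, x)\<close>, so a neighbourhood of
  \<open>x\<close> has all its differences in \<open>N\<close>. If it contains \<open>y\<close> and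
  \<open>l + y\<close>, then \<open>l = (l + y) - y\<close> lies in
  \<open>N \<inter> \<Lambda> = {0}\<close>.\<close>

lemma small_nhd: "\<exists>U. open U \<and> x \<in> U \<and> small U"
proof -
  obtain N where N: "open N" "N \<inter> \<Lambda> = {0}"
    using discreteD[OF \<Lambda>(3) add_subgroupD(1)[OF \<Lambda>(1)]] by (auto simp: isolated_in_def)
  have "open ((\<lambda>(y, z). y - z) -` N :: ('g \<times> 'g) set)"
    using N by (intro open_vimage) (auto simp: case_prod_unfold intro!: continuous_intros)
  moreover have "(x, x) \<in> (\<lambda>(y, z). y - z) -` N" using N by auto
  ultimately obtain A B where AB: "open A" "open B" "(x, x) \<in> A \<times> B" "A \<times> B \<subseteq> (\<lambda>(y, z). y - z) -` N"
    by (rule open_prod_elim)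
  have "open (A \<inter> B)" "x \<in> A \<inter> B" using AB by auto
  then obtain U C where U: "open U" "x \<in> U" "U \<subseteq> C" "compact C" "U \<subseteq> A \<inter> B"
    using lc_compact_nhd[OF lc \<open>open (A \<inter> B)\<close> \<open>x \<in> A \<inter> B\<close>] by auto
  have "l = 0" if "l \<in> \<Lambda>" "y \<in> U" "l + y \<in> U" for l y
  proof -
    have "(l + y, y) \<in> A \<times> B" using that U by auto
    from subsetD[OF AB(4) this] have "l \<in> N" by simp
    with that(1) N(2) have "l \<in> {0}" by (metis IntI)
    then show ?thesis by simp
  qed
  then have "small U" unfolding small_def using U(3,4) by auto
  then show ?thesis using U(1,2) by auto
qed

definition U :: "nat \<Rightarrow> 'g set" where
  "U = (SOME U. (\<forall>n. open (U n)) \<and> (\<forall>n. small (U n)) \<and> UNIV \<subseteq> (\<Union>n. U n))"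

lemma open_U: "open (U n)" and small_U: "small (U n)" and UN_U: "(\<Union>n. U n) = UNIV"
proof -
  have "small {}" by (auto simp: small_def)
  from lc_countable_cover[of UNIV small, OF small_nhd this]
  have "\<exists>U :: nat \<Rightarrow> 'g set. (\<forall>n. open (U n)) \<and> (\<forall>n. small (U n)) \<and> UNIV \<subseteq> (\<Union>n. U n)" .
  from someI_ex[OF this] show "open (U n)" "small (U n)" "(\<Union>n. U n) = UNIV"
    unfolding U_def[symmetric] by auto
qed

text \<open>Each \<open>U n\<close> contains at most one point of the orbit of \<open>x0\<close>,
  and the \<open>U n\<close> cover that orbit.\<close>

lemma countable_\<Lambda>: "countable \<Lambda>"
proof -
  obtain x0 n0 where x: "x0 \<in> U n0" using UN_U by blast
  have "\<exists>n. l + x0 \<in> U n" for l using UN_U by blast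
  then obtain i where i: "\<And>l. l + x0 \<in> U (i l)" by metis
  have "countable {l \<in> \<Lambda>. l + x0 \<in> U n}" for n
  proof -
    have "l = l'" if "l \<in> \<Lambda>" "l' \<in> \<Lambda>" "l + x0 \<in> U n" "l' + x0 \<in> U n" for l l'
    proof -
      have "(l' - l) + (l + x0) = l' + x0" by (simp add: add.assoc[symmetric])
      then have "l' - l = 0"
        using that small_U[of n] add_subgroupD(4)[OF \<Lambda>(1)] unfolding small_def by metis
      then show ?thesis by simp
    qed
    then have "\<exists>a. {l \<in> \<Lambda>. l + x0 \<in> U n} \<subseteq> {a}"
      by (cases "{l \<in> \<Lambda>. l + x0 \<in> U n} = {}") auto
    then show ?thesis by (metis countable_empty countable_insert countable_subset)
  qed
  then have "countable (\<Union>n. {l \<in> \<Lambda>. l + x0 \<in> U n})" by simp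
  moreover have "\<Lambda> \<subseteq> (\<Union>n. {l \<in> \<Lambda>. l + x0 \<in> U n})" using i by auto
  ultimately show ?thesis by (rule countable_subset[rotated])
qed

text \<open>Each orbit is represented by its point in the first \<open>U n\<close> that it meets;
  smallness makes that point unique. All translates of the earlier sets are subtracted so that the
  removed part is a union of orbits. It is also open, hence \<open>D\<close> is Borel.\<close>

definition D :: "'g set" where
  "D = (\<Union>n. U n - (\<Union>m<n. \<Union>l\<in>\<Lambda>. (+) l ` U m))"

lemma D_borel [measurable]: "D \<in> sets borel"
  unfolding D_def
  by (intro sets.countable_UN sets.Diff sets.finite_UN image_subsetI borel_open
      open_U open_Union_translates finite_lessThan)

lemma D_ex: "\<exists>l\<in>\<Lambda>. l + x \<in> D"
proof -
  define n where "n = (LEAST n. \<exists>l\<in>\<Lambda>. l + x \<in> U n)"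
  have "\<exists>n. \<exists>l\<in>\<Lambda>. l + x \<in> U n"
    using UN_U add_subgroupD(1)[OF \<Lambda>(1)] by (metis UN_E UNIV_I add_0)
  then have "\<exists>l\<in>\<Lambda>. l + x \<in> U n" unfolding n_def by (rule LeastI_ex)
  then obtain l where l: "l \<in> \<Lambda>" "l + x \<in> U n" by blast
  have "l + x \<notin> (+) l' ` U m" if "m < n" "l' \<in> \<Lambda>" for m l'
  proof
    assume "l + x \<in> (+) l' ` U m"
    then obtain u where "u \<in> U m" "l + x = l' + u" by auto
    then have "(- l' + l) + x \<in> U m" by (simp add: add.assoc)
    moreover have "- l' + l \<in> \<Lambda>" using that l \<Lambda>(1) by (auto intro!: add_subgroupD)
    ultimately have "n \<le> m" unfolding n_def by (intro Least_le) auto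
    with that show False by simp
  qed
  then show ?thesis using l unfolding D_def by blast
qed

lemma D_unique:
  assumes "x \<in> D" "l \<in> \<Lambda>" "l + x \<in> D"
  shows "l = 0"
proof -
  obtain n where n: "x \<in> U n" "\<And>m l. m < n \<Longrightarrow> l \<in> \<Lambda> \<Longrightarrow> x \<notin> (+) l ` U m"
    using assms(1) by (auto simp: D_def)
  obtain n' where n': "l + x \<in> U n'" "\<And>m k. m < n' \<Longrightarrow> k \<in> \<Lambda> \<Longrightarrow> l + x \<notin> (+) k ` U m"
    using assms(3) by (auto simp: D_def)
  \<comment> \<open>If the two indices differed, the point with the larger index would lie in one of
    the translates removed for the smaller.\<close>
  have "x \<in> (+) (- l) ` U n'"
    using n'(1) by (intro image_eqI[of _ _ "l + x"]) (simp_all add: add.assoc[symmetric])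
  then have "\<not> n' < n" using n(2)[of n' "- l"] assms(2) \<Lambda>(1) by (auto simp: add_subgroupD)
  moreover have "\<not> n < n'" using n'(2)[of n l] assms(2) n(1) by auto
  ultimately have "n = n'" by simp
  then show ?thesis using small_U[of n] n n' assms(2) unfolding small_def by blast
qed

definition s :: "'g set \<Rightarrow> 'g" where "s y = (THE z. z \<in> y \<and> z \<in> D)"

lemma s_props:
  assumes "y \<in> coset_space K \<Lambda>"
  shows "s y \<in> D" "s y \<in> K" "right_coset \<Lambda> (s y) = y"
proof -
  obtain x where x: "x \<in> K" "y = right_coset \<Lambda> x" using assms by (auto simp: coset_space_def)
  obtain l where l: "l \<in> \<Lambda>" "l + x \<in> D" using D_ex by blast
  have ex: "l + x \<in> y" using l x by (simp add: in_right_coset_iff)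
  have "z = l + x" if "z \<in> y" "z \<in> D" for z
  proof -
    have "z - x \<in> \<Lambda>" using that x by (simp add: in_right_coset_iff)
    then have "z - x - l \<in> \<Lambda>" using l add_subgroupD[OF \<Lambda>(1)] by auto
    moreover have "(z - x - l) + (l + x) = z" by (simp add: add.assoc[symmetric])
    ultimately have "z - x - l = 0" using D_unique[of "l + x" "z - x - l"] that l by auto
    then show ?thesis by (simp add: eq_diff_eq diff_eq_eq)
  qed
  then have "s y = l + x" unfolding s_def using ex l by (intro the_equality) blast+
  then show "s y \<in> D" "s y \<in> K" "right_coset \<Lambda> (s y) = y"
    using l x \<Lambda> K right_coset_add_left[OF \<Lambda>(1)] by (auto intro!: add_subgroupD)
qed

lemma s_right_coset:
  assumes "x \<in> K" obtains l where "l \<in> \<Lambda>" "s (right_coset \<Lambda> x) = l + x"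
proof -
  have "right_coset \<Lambda> (s (right_coset \<Lambda> x)) = right_coset \<Lambda> x"
    using assms by (intro s_props right_coset_in_coset_space)
  then have "s (right_coset \<Lambda> x) - x \<in> \<Lambda>" by (simp add: right_coset_eq_iff[OF \<Lambda>(1)])
  then show thesis by (intro that[of "s (right_coset \<Lambda> x) - x"]) auto
qed

text \<open>Images of Borel sets do not commute with complements in general. Here the projection is
  injective on \<open>U n\<close>, so they do, and the induction over \<open>sigma_sets\<close> can
  start from openness of the projection.\<close>

lemma right_coset_image_sets:
  assumes "E \<in> sets borel"
  shows "right_coset \<Lambda> ` (E \<inter> U n \<inter> K) \<in> sets (quot K \<Lambda>)"
proof -
  have "E \<in> sigma_sets UNIV {S. open S}" using assms by (simp add: borel_def)
  then show ?thesis
  proof induction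
    case (Basic a)
    then have "open (a \<inter> U n)" using open_U by auto
    from openin_right_coset_image[OF K(1) \<Lambda>(1,2) this] show ?case by (rule openin_in_borel_of)
  next
    case Empty then show ?case by simp
  next
    case (Compl a)
    have "right_coset \<Lambda> ` (U n \<inter> K) \<in> sets (quot K \<Lambda>)"
      using openin_right_coset_image[OF K(1) \<Lambda>(1,2) open_U] by (rule openin_in_borel_of)
    moreover have inj: "inj_on (right_coset \<Lambda>) (U n \<inter> K)"
    proof
      fix x y assume xy: "x \<in> U n \<inter> K" "y \<in> U n \<inter> K" "right_coset \<Lambda> x = right_coset \<Lambda> y"
      then have "x - y \<in> \<Lambda>" "(x - y) + y = x" by (auto simp: right_coset_eq_iff[OF \<Lambda>(1)])
      then have "x - y = 0" using small_U[of n] xy unfolding small_def by (metis IntD1)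
      then show "x = y" by simp
    qed
    have "right_coset \<Lambda> ` ((UNIV - a) \<inter> U n \<inter> K) =
        right_coset \<Lambda> ` (U n \<inter> K) - right_coset \<Lambda> ` (a \<inter> U n \<inter> K)"
      by (subst inj_on_image_set_diff[OF inj, symmetric]) (auto intro!: arg_cong[of _ _ "image (right_coset \<Lambda>)"])
    ultimately show ?case using Compl by auto
  next
    case (Union a)
    have "right_coset \<Lambda> ` (\<Union> (range a) \<inter> U n \<inter> K) = (\<Union>i. right_coset \<Lambda> ` (a i \<inter> U n \<inter> K))" by auto
    then show ?case using Union by auto
  qed
qed

text \<open>The preimage of \<open>A\<close> is the projection of \<open>A \<inter> D\<close>, cut
  along the cover into pieces whose projections are Borel.\<close>

lemma s_measurable [measurable]: "s \<in> measurable (quot K \<Lambda>) borel"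
proof (rule measurableI)
  fix A :: "'g set" assume A: "A \<in> sets borel"
  have "s -` A \<inter> space (quot K \<Lambda>) = (\<Union>n. right_coset \<Lambda> ` ((A \<inter> D) \<inter> U n \<inter> K))" (is "?L = ?R")
  proof (intro equalityI subsetI)
    fix y assume y: "y \<in> ?L"
    then have "s y \<in> D" "s y \<in> K" "right_coset \<Lambda> (s y) = y" "s y \<in> A" using s_props by auto
    moreover obtain n where "s y \<in> U n" using UN_U by blast
    ultimately show "y \<in> ?R" by blast
  next
    fix y assume "y \<in> ?R"
    then obtain x where x: "x \<in> A" "x \<in> D" "x \<in> K" "y = right_coset \<Lambda> x" by blast
    have y: "y \<in> coset_space K \<Lambda>" using x by (simp add: right_coset_in_coset_space)
    obtain l where l: "l \<in> \<Lambda>" "s y = l + x" using s_right_coset x by metis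
    then have "l = 0" using D_unique[of x l] x s_props(1)[OF y] by auto
    then show "y \<in> ?L" using x y l by auto
  qed
  also have "\<dots> \<in> sets (quot K \<Lambda>)"
    using right_coset_image_sets[of "A \<inter> D"] A by (intro sets.countable_UN) auto
  finally show "s -` A \<inter> space (quot K \<Lambda>) \<in> sets (quot K \<Lambda>)" .
qed auto

lemma nn_integral_translate:
  fixes f :: "'g \<Rightarrow> ennreal"
  assumes "k \<in> \<Lambda>"
  shows "(\<integral>\<^sup>+l. f (l + (k + x)) \<partial>count_space \<Lambda>) = (\<integral>\<^sup>+l. f (l + x) \<partial>count_space \<Lambda>)"
proof -
  have "bij_betw (\<lambda>l. l + k) \<Lambda> \<Lambda>"
    using assms \<Lambda>(1) by (intro bij_betw_byWitness[of _ "\<lambda>l. l - k"]) (auto intro!: add_subgroupD)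
  from nn_integral_bij_count_space[OF this, of "\<lambda>l. f (l + x)"] show ?thesis
    by (simp add: add.assoc)
qed

text \<open>Trades the arbitrary representative of a coset for the Borel section, after which the
  orbit sum is measurable in \<open>y\<close>.\<close>

lemma nn_integral_coset_rep:
  fixes f :: "'g \<Rightarrow> ennreal"
  assumes "y \<in> coset_space K \<Lambda>"
  shows "(\<integral>\<^sup>+l. f (l + coset_rep y) \<partial>count_space \<Lambda>) = (\<integral>\<^sup>+l. f (l + s y) \<partial>count_space \<Lambda>)"
proof -
  obtain k where "k \<in> \<Lambda>" "coset_rep y = k + s y"
    using coset_rep_obtain[OF \<Lambda>(1), of "s y"] s_props(3)[OF assms] by metis
  then show ?thesis using nn_integral_translate by simp
qed

lemma sum_D: "(\<integral>\<^sup>+l. indicator D (l + x) \<partial>count_space \<Lambda>) = 1"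
proof -
  obtain k where k: "k \<in> \<Lambda>" "k + x \<in> D" using D_ex by blast
  have "(\<integral>\<^sup>+l. indicator D (l + x) \<partial>count_space \<Lambda>) = (\<integral>\<^sup>+l. indicator D (l + (k + x)) \<partial>count_space \<Lambda>)"
    by (rule nn_integral_translate[OF k(1), symmetric])
  also have "\<dots> = (\<Sum>l\<in>{0}. indicator D (l + (k + x)))"
    using D_unique[OF k(2)] \<Lambda>(1) by (intro nn_integral_count_space') (auto simp: indicator_def add_subgroupD)
  finally show ?thesis using k by simp
qed

lemma sum_small_le_1:
  assumes "A \<subseteq> U n"
  shows "(\<integral>\<^sup>+l. indicator A (l + x) \<partial>count_space \<Lambda>) \<le> 1"
proof (cases "\<exists>k\<in>\<Lambda>. k + x \<in> A")
  case True
  then obtain k where k: "k \<in> \<Lambda>" "k + x \<in> A" by blast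
  have "(\<integral>\<^sup>+l. indicator A (l + x) \<partial>count_space \<Lambda>) = (\<integral>\<^sup>+l. indicator A (l + (k + x)) \<partial>count_space \<Lambda>)"
    by (rule nn_integral_translate[OF k(1), symmetric])
  also have "\<dots> = (\<Sum>l\<in>{0}. indicator A (l + (k + x)))"
  proof (rule nn_integral_count_space')
    fix l assume "l \<in> \<Lambda>" "l \<notin> {0}"
    then have "l + (k + x) \<notin> A" using small_U[of n] k assms unfolding small_def by blast
    then show "indicator A (l + (k + x)) = (0 :: ennreal)" by simp
  qed (use \<Lambda>(1) in \<open>auto simp: add_subgroupD\<close>)
  finally show ?thesis using k by simp
next
  case False
  then have "(\<integral>\<^sup>+l. indicator A (l + x) \<partial>count_space \<Lambda>) = (\<integral>\<^sup>+l. 0 \<partial>count_space \<Lambda>)"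
    by (intro nn_integral_cong) (auto simp: indicator_def)
  then show ?thesis by simp
qed

lemma measurable_sum_\<Lambda> [measurable (raw)]:
  fixes F :: "'g \<Rightarrow> 'x \<Rightarrow> ennreal"
  assumes "\<And>l. l \<in> \<Lambda> \<Longrightarrow> F l \<in> borel_measurable M"
  shows "(\<lambda>x. \<integral>\<^sup>+l. F l x \<partial>count_space \<Lambda>) \<in> borel_measurable M"
proof -
  interpret C: sigma_finite_measure "count_space \<Lambda>"
    by (rule sigma_finite_measure_count_space_countable[OF countable_\<Lambda>])
  have "(\<lambda>p. F (snd p) (fst p)) \<in> borel_measurable (M \<Otimes>\<^sub>M count_space \<Lambda>)"
    by (rule measurable_compose_countable'[where f = "\<lambda>l p. F l (fst p)", OF _ measurable_snd countable_\<Lambda>])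
      (intro measurable_compose[OF measurable_fst] assms)
  then show ?thesis
    by (intro C.borel_measurable_nn_integral) (simp add: case_prod_unfold)
qed

end

section \<open>Unfolding integrals along a discrete subgroup\<close>

context discrete_subgroup
begin

text \<open>Inside a small set nothing diverges: the set has finite measure and the orbit sums are
  at most 1. The real-valued lattice formula, with its default value 0, can therefore be read as an
  identity in [0, \<infinity>].\<close>

lemma lattice_constant_small:
  assumes m: "sets m = sets (restrict_space borel K)"
    and fin: "\<And>C. compact C \<Longrightarrow> C \<subseteq> K \<Longrightarrow> emeasure m C < \<infinity>"
    and \<nu>: "sets \<nu> = sets (quot K \<Lambda>)" "finite_measure \<nu>"
    and c: "lattice_constant K \<Lambda> m \<nu> c"
    and A: "A \<in> sets m" "A \<subseteq> U n"
  shows "emeasure m A =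
    ennreal (inverse c) * (\<integral>\<^sup>+y. (\<integral>\<^sup>+l. indicator A (l + s y) \<partial>count_space \<Lambda>) \<partial>\<nu>)"
proof -
  interpret \<nu>: finite_measure \<nu> by fact
  have space_m: "space m = K" and space_\<nu>: "space \<nu> = coset_space K \<Lambda>"
    using sets_eq_imp_space_eq[OF m] sets_eq_imp_space_eq[OF \<nu>(1)] by (simp_all add: space_restrict_space)
  have A': "A \<in> sets borel" "A \<subseteq> K"
    using A(1) K(2) unfolding m by (auto simp: sets_restrict_space)
  obtain C where C: "compact C" "U n \<subseteq> C" using small_U[of n] by (auto simp: small_def)
  have CK: "compact (C \<inter> K)" using C K by (simp add: compact_Int_closed)
  define G where "G y = (\<integral>\<^sup>+l. indicator A (l + s y) \<partial>count_space \<Lambda>)" for y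
  have s_meas: "s \<in> measurable \<nu> borel" using s_measurable \<nu>(1) by (simp cong: measurable_cong_sets)
  have G_meas [measurable]: "G \<in> borel_measurable \<nu>"
    unfolding G_def[abs_def]
    by (intro measurable_sum_\<Lambda> measurable_compose[OF _ borel_measurable_indicator[OF A'(1)]]
        borel_measurable_add s_meas) simp
  have G1: "G y \<le> 1" for y unfolding G_def by (rule sum_small_le_1[OF A(2)])
  have "emeasure m A \<le> emeasure m (C \<inter> K)"
    using A A' C CK by (intro emeasure_mono) (auto simp: m sets_restrict_space compact_imp_closed intro!: image_eqI[of _ _ C])
  also have "\<dots> < \<infinity>" using fin CK by simp
  finally have mA: "emeasure m A = ennreal (measure m A)"
    by (intro emeasure_eq_ennreal_measure) auto
  have "measure m A = (\<integral>x. indicator A x \<partial>m)" using A' space_m by (simp add: Int_absorb2)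
  also have "\<dots> = inverse c * (\<integral>y. (\<Sum>\<^sub>\<infinity>l\<in>\<Lambda>. indicator A (l + coset_rep y)) \<partial>\<nu>)"
  proof -
    have "indicator A \<in> borel_measurable (restrict_space borel K)" 
      using A'(1) by (intro measurable_restrict_space1) simp
    moreover have "bounded ((indicator A :: _ \<Rightarrow> real) ` K)"
      by (intro boundedI[of _ 1]) (auto simp: indicator_def)
    moreover have "\<forall>x\<in>K - C \<inter> K. indicator A x = (0::real)" using A C by (auto simp: indicator_def)
    ultimately show ?thesis using c CK unfolding lattice_constant_def by (metis Int_lower2)
  qed
  also have "(\<integral>y. (\<Sum>\<^sub>\<infinity>l\<in>\<Lambda>. indicator A (l + coset_rep y)) \<partial>\<nu>) = (\<integral>y. enn2real (G y) \<partial>\<nu>)"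
    using nn_integral_coset_rep[of _ "indicator A"] space_\<nu>
    by (intro Bochner_Integration.integral_cong refl)
       (simp add: infsum_eq_enn2real_nn_integral G_def ennreal_indicator)
  also have "\<dots> = enn2real (\<integral>\<^sup>+y. ennreal (enn2real (G y)) \<partial>\<nu>)"
    by (intro integral_eq_nn_integral) auto
  also have "(\<integral>\<^sup>+y. ennreal (enn2real (G y)) \<partial>\<nu>) = (\<integral>\<^sup>+y. G y \<partial>\<nu>)"
    using G1 by (intro nn_integral_cong ennreal_enn2real) (metis ennreal_one_less_top order_le_less_trans)
  finally have eq: "measure m A = inverse c * enn2real (\<integral>\<^sup>+y. G y \<partial>\<nu>)" .
  have "(\<integral>\<^sup>+y. G y \<partial>\<nu>) \<le> (\<integral>\<^sup>+y. 1 \<partial>\<nu>)" by (intro nn_integral_mono G1)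
  also have "\<dots> < top" using \<nu>.emeasure_finite[of "space \<nu>"] by (simp add: less_top[symmetric])
  finally have "ennreal (enn2real (\<integral>\<^sup>+y. G y \<partial>\<nu>)) = (\<integral>\<^sup>+y. G y \<partial>\<nu>)" by simp
  then show ?thesis
    using c by (simp add: mA eq ennreal_mult lattice_constant_def G_def[symmetric])
qed

text \<open>The right-hand side is the integral against an explicit measure \<open>N\<close>, the
  scaled image of \<nu> times counting measure under adding \<open>l\<close> to \<open>s y\<close>.
  It suffices to compare \<open>m\<close> and \<open>N\<close> on sets, and cutting a set along the
  disjointed cover reduces this to the small case.\<close>

lemma nn_integral_unfold:
  fixes f :: "'g \<Rightarrow> ennreal"
  assumes m: "sets m = sets (restrict_space borel K)"
    and fin: "\<And>C. compact C \<Longrightarrow> C \<subseteq> K \<Longrightarrow> emeasure m C < \<infinity>"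
    and \<nu>: "sets \<nu> = sets (quot K \<Lambda>)" "finite_measure \<nu>"
    and c: "lattice_constant K \<Lambda> m \<nu> c"
    and f: "f \<in> borel_measurable m"
  shows "(\<integral>\<^sup>+x. f x \<partial>m) =
    ennreal (inverse c) * (\<integral>\<^sup>+y. (\<integral>\<^sup>+l. f (l + s y) \<partial>count_space \<Lambda>) \<partial>\<nu>)"
proof -
  interpret C: sigma_finite_measure "count_space \<Lambda>"
    by (rule sigma_finite_measure_count_space_countable[OF countable_\<Lambda>])
  have space_m: "space m = K" and space_\<nu>: "space \<nu> = coset_space K \<Lambda>"
    using sets_eq_imp_space_eq[OF m] sets_eq_imp_space_eq[OF \<nu>(1)] by (simp_all add: space_restrict_space)
  have s_meas [measurable]: "s \<in> measurable \<nu> borel" using s_measurable \<nu>(1) by (simp cong: measurable_cong_sets)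
  have "(\<lambda>l. l) \<in> measurable (count_space \<Lambda>) borel" by simp
  then have "(\<lambda>p. snd p + s (fst p)) \<in> measurable (\<nu> \<Otimes>\<^sub>M count_space \<Lambda>) borel" by measurable
  moreover have "(\<lambda>p. snd p + s (fst p)) \<in> space (\<nu> \<Otimes>\<^sub>M count_space \<Lambda>) \<rightarrow> K"
    using s_props(2) \<Lambda>(2) K(1) by (auto simp: space_pair_measure space_\<nu> intro!: add_subgroupD)
  ultimately have "(\<lambda>p. snd p + s (fst p)) \<in> measurable (\<nu> \<Otimes>\<^sub>M count_space \<Lambda>) (restrict_space borel K)"
    by (rule measurable_restrict_space2[rotated])
  then have \<phi>: "(\<lambda>p. snd p + s (fst p)) \<in> measurable (\<nu> \<Otimes>\<^sub>M count_space \<Lambda>) m"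
    using m by (simp cong: measurable_cong_sets)
  define N where "N = scale_measure (ennreal (inverse c)) (distr (\<nu> \<Otimes>\<^sub>M count_space \<Lambda>) m (\<lambda>p. snd p + s (fst p)))"
  have N: "(\<integral>\<^sup>+x. f x \<partial>N) =
    ennreal (inverse c) * (\<integral>\<^sup>+y. (\<integral>\<^sup>+l. f (l + s y) \<partial>count_space \<Lambda>) \<partial>\<nu>)" if "f \<in> borel_measurable m" for f
  proof -
    have "(\<lambda>p. f (snd p + s (fst p))) \<in> borel_measurable (\<nu> \<Otimes>\<^sub>M count_space \<Lambda>)"
      using \<phi> that by (rule measurable_compose)
    then show ?thesis using that \<phi>
      by (simp add: N_def nn_integral_scale_measure nn_integral_distr C.nn_integral_fst[symmetric])
  qed
  have setsN: "sets N = sets m" by (simp add: N_def)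
  have "m = N"
  proof (rule measure_eqI)
    fix A assume A: "A \<in> sets m"
    define V where "V i = A \<inter> disjointed U i" for i
    have V: "V i \<in> sets m" for i
      using A sets.range_disjointed_sets[of U borel] open_U K(2) unfolding V_def m
      by (auto simp: sets_restrict_space image_subset_iff)
    have "disjointed U i \<subseteq> U i" for i by (rule disjointed_subset)
    then have VU: "V i \<subseteq> U i" for i by (auto simp: V_def)
    have "disjoint_family V" using disjoint_family_disjointed[of U] by (auto simp: V_def disjoint_family_on_def)
    moreover have "(\<Union>i. V i) = A" using UN_disjointed_eq[of U] UN_U by (auto simp: V_def)
    ultimately have "emeasure M A = (\<Sum>i. emeasure M (V i))" if "sets M = sets m" for M
      using suminf_emeasure[of V M] V that by (simp add: image_subset_iff)
    moreover have "emeasure m (V i) = emeasure N (V i)" for i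
    proof -
      have "emeasure N (V i) = (\<integral>\<^sup>+x. indicator (V i) x \<partial>N)" using V setsN by simp
      also have "\<dots> = emeasure m (V i)"
        using N[of "indicator (V i)"] V[of i] lattice_constant_small[OF m fin \<nu> c V VU] by simp
      finally show ?thesis by simp
    qed
    ultimately show "emeasure m A = emeasure N A" using setsN by simp
  qed (simp add: setsN)
  then show ?thesis using N[OF f] by simp
qed

end

section \<open>Haar measures\<close>

locale haar_subgroup =
  fixes H :: "'g::{topological_group_add,second_countable_topology,t2_space} set" and m :: "'g measure"
  assumes lc: "locally_compact_space (euclidean :: 'g topology)"
    and H: "add_subgroup H" "closed H" "unimodular_on H"
    and haar: "left_haar_measure_on H m"
begin

lemma sets_m: "sets m = sets (restrict_space borel H)"
  and m_compact: "compact C \<Longrightarrow> C \<subseteq> H \<Longrightarrow> emeasure m C < \<infinity>"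
  and m_H: "emeasure m H \<noteq> 0"
  and left_inv: "h \<in> H \<Longrightarrow> distr m m (\<lambda>x. h + x) = m"
  and right_inv: "h \<in> H \<Longrightarrow> distr m m (\<lambda>x. x + h) = m"
  using haar H(3) unfolding left_haar_measure_on_def unimodular_on_def by auto

lemma space_m: "space m = H"
  using sets_eq_imp_space_eq[OF sets_m] by (simp add: space_restrict_space)

lemma borel_H [measurable]: "H \<in> sets borel"
  using H(2) by simp

lemma Int_in_sets: "A \<in> sets borel \<Longrightarrow> A \<inter> H \<in> sets m"
  by (auto simp: sets_m sets_restrict_space)

lemma id_measurable: "(\<lambda>x. x) \<in> measurable m borel"
  by (simp cong: measurable_cong_sets add: sets_m measurable_restrict_space1)

lemma measurable_from_borel: "f \<in> measurable borel M \<Longrightarrow> f \<in> measurable m M"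
  by (rule measurable_compose[OF id_measurable])

lemma into_m: "f \<in> measurable M borel \<Longrightarrow> (\<And>x. x \<in> space M \<Longrightarrow> f x \<in> H) \<Longrightarrow> f \<in> measurable M m"
  using measurable_restrict_space2[of f M H borel] by (simp cong: measurable_cong_sets add: sets_m)

lemma translate_measurable:
  assumes "h \<in> H"
  shows "(\<lambda>x. h + x) \<in> measurable m m" "(\<lambda>x. x + h) \<in> measurable m m"
  using assms H(1) id_measurable
  by (auto intro!: into_m add_subgroupD simp: space_m)

lemma nn_integral_right:
  assumes "h \<in> H" "f \<in> borel_measurable m"
  shows "(\<integral>\<^sup>+x. f (x + h) \<partial>m) = (\<integral>\<^sup>+x. f x \<partial>m)"
  using nn_integral_distr[OF translate_measurable(2)[OF assms(1)], of f] assms right_inv by simp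

lemma compact_cover:
  "\<exists>U :: nat \<Rightarrow> 'g set. (\<forall>n. open (U n)) \<and> (\<forall>n. \<exists>C. compact C \<and> U n \<subseteq> C) \<and> UNIV \<subseteq> (\<Union>n. U n)"
proof (rule lc_countable_cover)
  show "\<exists>U. open U \<and> x \<in> U \<and> (\<exists>C. compact C \<and> U \<subseteq> C)" for x :: 'g
    using lc_compact_nhd[OF lc open_UNIV UNIV_I[of x]] by auto
qed auto

lemma emeasure_bounded: "compact C \<Longrightarrow> emeasure m (C \<inter> H) < \<infinity>"
  using H(2) by (intro m_compact) (auto simp: compact_Int_closed)

lemma sigma_finite_m: "sigma_finite_measure m"
proof -
  obtain U :: "nat \<Rightarrow> 'g set"
    where U: "\<And>n. open (U n)" "\<And>n. \<exists>C. compact C \<and> U n \<subseteq> C" "UNIV \<subseteq> (\<Union>n. U n)"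
    using compact_cover by blast
  from U(2) obtain C where C: "\<And>n. compact (C n)" "\<And>n. U n \<subseteq> C n" by metis
  have "emeasure m (C n \<inter> H) < \<infinity>" for n by (intro emeasure_bounded C)
  moreover have "C n \<inter> H \<in> sets m" for n
    by (intro Int_in_sets borel_closed compact_imp_closed C)
  moreover have "(\<Union>n. C n \<inter> H) = H" using U(3) C(2) by blast
  ultimately show ?thesis
    by (intro sigma_finite_measure.intro exI[of _ "range (\<lambda>n. C n \<inter> H)"] conjI)
       (auto simp: space_m less_top[symmetric])
qed

text \<open>Countably many translates of \<open>E\<close> by elements of \<open>H\<close> cover
  \<open>H\<close>, so a null \<open>E \<inter> H\<close> would make all of \<open>H\<close>
  null.\<close>

lemma open_pos:
  assumes "open E" "e \<in> E" "e \<in> H"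
  shows "emeasure m (E \<inter> H) \<noteq> 0"
proof
  assume 0: "emeasure m (E \<inter> H) = 0"
  have "\<exists>U :: nat \<Rightarrow> 'g set. (\<forall>n. open (U n)) \<and> (\<forall>n. U n = {} \<or> (\<exists>h\<in>H. U n = (+) h ` E)) \<and> H \<subseteq> (\<Union>n. U n)"
  proof (rule lc_countable_cover)
    fix x assume x: "x \<in> H"
    have "x = (x - e) + e" by simp
    then have "x \<in> (+) (x - e) ` E" using assms(2) by (rule image_eqI)
    moreover have "x - e \<in> H" using x assms(3) H(1) by (auto intro: add_subgroupD)
    ultimately show "\<exists>U. open U \<and> x \<in> U \<and> (U = {} \<or> (\<exists>h\<in>H. U = (+) h ` E))"
      using open_add_left_image[OF assms(1)] by blast
  qed auto
  then obtain U :: "nat \<Rightarrow> 'g set" where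
    U: "\<And>n. open (U n)" "\<And>n. U n = {} \<or> (\<exists>h\<in>H. U n = (+) h ` E)" "H \<subseteq> (\<Union>n. U n)" by auto
  have "U n \<inter> H \<in> null_sets m" for n
  proof (cases "U n = {}")
    case False
    then obtain h where h: "h \<in> H" "U n = (+) h ` E" using U(2) by blast
    have mh: "- h \<in> H" using h(1) H(1) by (simp add: add_subgroupD)
    have "U n \<inter> H = (\<lambda>x. - h + x) -` (E \<inter> H) \<inter> space m"
    proof (intro equalityI subsetI)
      fix x assume "x \<in> U n \<inter> H"
      then obtain z where "z \<in> E" "x = h + z" "x \<in> H" using h by auto
      moreover have "- h + x \<in> H" using mh \<open>x \<in> H\<close> by (rule add_subgroupD(2)[OF H(1)])
      ultimately show "x \<in> (\<lambda>x. - h + x) -` (E \<inter> H) \<inter> space m"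
        by (simp add: add.assoc[symmetric] space_m)
    next
      fix x assume x: "x \<in> (\<lambda>x. - h + x) -` (E \<inter> H) \<inter> space m"
      have "x = h + (- h + x)" by (simp add: add.assoc[symmetric])
      then have "x \<in> (+) h ` E" using x by (intro image_eqI[of _ _ "- h + x"]) auto
      with x show "x \<in> U n \<inter> H" by (simp add: h(2) space_m)
    qed
    then have "emeasure m (U n \<inter> H) = emeasure (distr m m (\<lambda>x. - h + x)) (E \<inter> H)"
      using assms(1) by (subst emeasure_distr[OF translate_measurable(1)[OF mh]]) (auto intro: Int_in_sets)
    also have "\<dots> = 0" using left_inv[OF mh] 0 by simp
    finally show ?thesis using U(1) by (auto intro!: null_setsI Int_in_sets)
  qed simp
  then have "(\<Union>n. U n \<inter> H) \<in> null_sets m" by (intro null_sets_UN)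
  moreover have "(\<Union>n. U n \<inter> H) = H" using U(3) by auto
  ultimately show False using m_H by auto
qed

lemma borel_measurable_fibre:
  fixes f :: "'g \<Rightarrow> ennreal"
  assumes "f \<in> borel_measurable borel"
  shows "(\<lambda>g. \<integral>\<^sup>+h. f (h + g) \<partial>m) \<in> borel_measurable borel"
proof -
  interpret sigma_finite_measure m by (rule sigma_finite_m)
  have "(\<lambda>p. f (snd p + fst p)) \<in> borel_measurable (borel \<Otimes>\<^sub>M m)"
    by (intro measurable_compose[OF _ assms] borel_measurable_add measurable_fst
        measurable_compose[OF measurable_snd id_measurable])
  then show ?thesis
    by (intro borel_measurable_nn_integral) (simp add: case_prod_unfold)
qed

text \<open>Moving \<open>g\<close> within its coset shifts the integration variable on the right,
  so right invariance of \<open>m\<close> is used, which unimodularity of \<open>H\<close>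
  supplies.\<close>

lemma fibre_invariant:
  fixes f :: "'g \<Rightarrow> ennreal"
  assumes "f \<in> borel_measurable borel" "k \<in> H"
  shows "(\<integral>\<^sup>+h. f (h + (k + g)) \<partial>m) = (\<integral>\<^sup>+h. f (h + g) \<partial>m)"
proof -
  have "(\<lambda>h. f (h + g)) \<in> borel_measurable m"
    by (intro measurable_from_borel measurable_compose[OF _ assms(1)]) simp
  from nn_integral_right[OF assms(2) this] show ?thesis by (simp add: add.assoc)
qed

text \<open>On each coset take the first relatively compact open set of the cover whose fibre over
  that coset has positive measure, and normalise its indicator. Such a set exists by
  \<open>open_pos\<close>, and its fibre measure is finite by compactness. The index
  \<open>N\<close> and the mass \<open>I\<close> depend only on the coset, so both are constant
  under the fibre integral.\<close>

lemma weight: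
  obtains w :: "'g \<Rightarrow> ennreal" where "w \<in> borel_measurable borel" "\<And>g. w g < \<infinity>"
    "\<And>g. (\<integral>\<^sup>+h. w (h + g) \<partial>m) = 1"
proof -
  obtain U :: "nat \<Rightarrow> 'g set"
    where U: "\<And>n. open (U n)" "\<And>n. \<exists>C. compact C \<and> U n \<subseteq> C" "UNIV \<subseteq> (\<Union>n. U n)"
    using compact_cover by blast
  have [measurable]: "U n \<in> sets borel" for n using U(1) by simp
  define I where "I n g = (\<integral>\<^sup>+h. indicator (U n) (h + g) \<partial>m)" for n g
  have I_eq: "I n g = emeasure m ((\<lambda>x. x - g) ` U n \<inter> H)" for n g
  proof -
    have "(\<lambda>x. x + g) -` U n \<in> sets borel" by (intro borel_open open_vimage U continuous_intros)
    moreover have "(\<lambda>x. x - g) ` U n = (\<lambda>x. x + g) -` U n" by (force simp: image_iff)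
    ultimately have "(\<lambda>x. x - g) ` U n \<inter> H \<in> sets m"
      by (intro Int_in_sets) simp
    then have "emeasure m ((\<lambda>x. x - g) ` U n \<inter> H) = (\<integral>\<^sup>+h. indicator ((\<lambda>x. x - g) ` U n \<inter> H) h \<partial>m)" by simp
    also have "\<dots> = I n g"
      unfolding I_def by (intro nn_integral_cong) (force simp: indicator_def space_m image_iff)
    finally show ?thesis by simp
  qed
  have I_fin: "I n g < \<infinity>" for n g
  proof -
    obtain C where C: "compact C" "U n \<subseteq> C" using U(2) by blast
    have cc: "compact ((\<lambda>x. x - g) ` C)" using C by (intro compact_continuous_image continuous_intros)
    have "I n g \<le> emeasure m ((\<lambda>x. x - g) ` C \<inter> H)"
      unfolding I_eq using C cc by (intro emeasure_mono Int_in_sets) (auto simp: compact_imp_closed)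
    also have "\<dots> < \<infinity>" by (rule emeasure_bounded[OF cc])
    finally show ?thesis .
  qed
  have I_meas [measurable]: "I n \<in> borel_measurable borel" for n
    unfolding I_def[abs_def] by (intro borel_measurable_fibre) simp
  define N where "N g = (LEAST n. I n g \<noteq> 0)" for g
  have N_meas: "N \<in> measurable borel (count_space UNIV)" unfolding N_def[abs_def] by measurable
  have N: "I (N g) g \<noteq> 0" for g
  proof -
    obtain n where n: "g \<in> U n" using U(3) by auto
    have "open ((\<lambda>x. x + g) -` U n)" by (intro open_vimage U continuous_intros)
    moreover have "(\<lambda>x. x - g) ` U n = (\<lambda>x. x + g) -` U n" by (force simp: image_iff)
    ultimately have "I n g \<noteq> 0"
      unfolding I_eq using n by (intro open_pos[of _ 0]) (auto simp: add_subgroupD[OF H(1)])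
    then show ?thesis unfolding N_def by (rule LeastI)
  qed
  have I_inv: "I n (k + g) = I n g" if "k \<in> H" for n k g
    unfolding I_def using that by (intro fibre_invariant) auto
  then have N_inv: "N (k + g) = N g" if "k \<in> H" for k g using that by (simp add: N_def)
  define w where "w g = indicator (U (N g)) g / I (N g) g" for g
  show thesis
  proof
    show "w \<in> borel_measurable borel"
      unfolding w_def[abs_def] by (rule measurable_compose_countable[OF _ N_meas]) measurable
    show "w g < \<infinity>" for g
      unfolding w_def using N by (auto simp: indicator_def less_top[symmetric] ennreal_divide_eq_top_iff)
    fix g
    have meas: "(\<lambda>h. indicator (U (N g)) (h + g) :: ennreal) \<in> borel_measurable m"
      by (intro measurable_from_borel) measurable
    have "(\<integral>\<^sup>+h. w (h + g) \<partial>m) = (\<integral>\<^sup>+h. indicator (U (N g)) (h + g) / I (N g) g \<partial>m)"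
      using I_inv N_inv by (intro nn_integral_cong) (simp add: w_def space_m)
    also have "\<dots> = I (N g) g / I (N g) g"
      using meas by (simp add: nn_integral_divide I_def)
    also have "\<dots> = 1" using N I_fin[of "N g" g] by (intro ennreal_divide_self) auto
    finally show "(\<integral>\<^sup>+h. w (h + g) \<partial>m) = 1" .
  qed
qed

end

text \<open>
  The measure \<open>\<nu>\<close> on the group replaces the measure on the coset space: functions of a coset become
  \<open>H\<close>-invariant functions on the group, and no Borel section of the coset projection is needed.
\<close>

lemma haar_disintegration:
  assumes G: "haar_subgroup UNIV mG" and Hm: "haar_subgroup H mH"
    and compat: "compatible_measures H mG mH mQ"
  obtains \<nu> where "sets \<nu> = sets borel" "sigma_finite_measure \<nu>"
    "\<And>f :: 'g::{topological_group_add,second_countable_topology,t2_space} \<Rightarrow> ennreal.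
       f \<in> borel_measurable borel \<Longrightarrow> (\<integral>\<^sup>+g. f g \<partial>mG) = (\<integral>\<^sup>+g. (\<integral>\<^sup>+h. f (h + g) \<partial>mH) \<partial>\<nu>)"
    "\<And>f :: 'g \<Rightarrow> ennreal. f \<in> borel_measurable borel \<Longrightarrow> (\<And>h g. h \<in> H \<Longrightarrow> f (h + g) = f g) \<Longrightarrow>
       (\<integral>\<^sup>+q. f (coset_rep q) \<partial>mQ) = (\<integral>\<^sup>+g. f g \<partial>\<nu>)"
proof -
  interpret G: haar_subgroup UNIV mG by fact
  interpret H: haar_subgroup H mH by fact
  have sets_G: "sets mG = sets borel" using G.sets_m by (simp add: sets_restrict_UNIV)
  obtain w :: "'g \<Rightarrow> ennreal" where w: "w \<in> borel_measurable borel" "\<And>g. w g < \<infinity>"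
    "\<And>g. (\<integral>\<^sup>+h. w (h + g) \<partial>mH) = 1" by (rule H.weight) blast
  note [measurable] = w(1)
  \<comment> \<open>The fibre integrals of \<open>w\<close> are 1, so weighting Haar measure by
    \<open>w\<close> integrates \<open>H\<close>-invariant functions exactly as the quotient measure
    does.\<close>
  define \<nu> where "\<nu> = density mG w"
  have wG [measurable]: "w \<in> borel_measurable mG" using w(1) by (rule G.measurable_from_borel)
  have comp: "(\<integral>\<^sup>+g. f g \<partial>mG) = (\<integral>\<^sup>+q. (\<integral>\<^sup>+h. f (h + coset_rep q) \<partial>mH) \<partial>mQ)"
    if "f \<in> borel_measurable borel" for f using compat that unfolding compatible_measures_def by blast
  have inv: "(\<integral>\<^sup>+q. f (coset_rep q) \<partial>mQ) = (\<integral>\<^sup>+g. f g \<partial>\<nu>)"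
    if [measurable]: "f \<in> borel_measurable borel" and inv: "\<And>h g. h \<in> H \<Longrightarrow> f (h + g) = f g" for f
  proof -
    have "(\<integral>\<^sup>+g. f g \<partial>\<nu>) = (\<integral>\<^sup>+g. w g * f g \<partial>mG)"
      unfolding \<nu>_def by (intro nn_integral_density wG G.measurable_from_borel that(1))
    also have "\<dots> = (\<integral>\<^sup>+q. (\<integral>\<^sup>+h. w (h + coset_rep q) * f (h + coset_rep q) \<partial>mH) \<partial>mQ)"
      by (rule comp) measurable
    also have "\<dots> = (\<integral>\<^sup>+q. f (coset_rep q) \<partial>mQ)"
    proof (rule nn_integral_cong)
      fix q
      have "(\<integral>\<^sup>+h. w (h + coset_rep q) * f (h + coset_rep q) \<partial>mH) =
          (\<integral>\<^sup>+h. w (h + coset_rep q) * f (coset_rep q) \<partial>mH)"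
        using inv by (intro nn_integral_cong) (simp add: H.space_m)
      also have "\<dots> = (\<integral>\<^sup>+h. w (h + coset_rep q) \<partial>mH) * f (coset_rep q)"
        by (intro nn_integral_multc H.measurable_from_borel) measurable
      finally show "(\<integral>\<^sup>+h. w (h + coset_rep q) * f (h + coset_rep q) \<partial>mH) = f (coset_rep q)"
        using w(3) by simp
    qed
    finally show ?thesis by simp
  qed
  show thesis
  proof (rule that[of \<nu>])
    show "sets \<nu> = sets borel" by (simp add: \<nu>_def sets_G)
    interpret S: sigma_finite_measure mG by (rule G.sigma_finite_m)
    \<comment> \<open>Finiteness of \<open>w\<close> at every point keeps the density sigma-finite,
      as the exchanges of integrals below require.\<close>
    show "sigma_finite_measure \<nu>"
      unfolding \<nu>_def using w(2) by (subst S.sigma_finite_iff_density_finite) (auto simp: less_top)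
    fix f :: "'g \<Rightarrow> ennreal" assume f: "f \<in> borel_measurable borel"
    show "(\<integral>\<^sup>+g. f g \<partial>mG) = (\<integral>\<^sup>+g. (\<integral>\<^sup>+h. f (h + g) \<partial>mH) \<partial>\<nu>)"
      unfolding comp[OF f]
      using inv[OF H.borel_measurable_fibre[OF f]] H.fibre_invariant[OF f] by simp
  qed (rule inv)
qed

section \<open>Topology of coset spaces\<close>

lemma continuous_map_right_coset:
  "continuous_map euclidean (coset_topology UNIV L) (right_coset L)"
  by (auto simp: continuous_map_def topspace_coset_topology coset_space_def openin_coset_topology)

lemma compactin_right_coset_image:
  "compact C \<Longrightarrow> compactin (coset_topology UNIV L) (right_coset L ` C)"
  using image_compactin[OF _ continuous_map_right_coset] by (metis compactin_euclidean_iff)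

lemma borel_measurable_continuous_map:
  assumes "continuous_map T euclideanreal f"
  shows "f \<in> borel_measurable (borel_of T)"
proof (rule borel_measurableI)
  fix S :: "real set" assume "open S"
  then have "openin T {x \<in> topspace T. f x \<in> S}"
    using openin_continuous_map_preimage[OF assms] by simp
  then have "{x \<in> topspace T. f x \<in> S} \<in> sets (borel_of T)" by (rule openin_in_borel_of)
  moreover have "f -` S \<inter> space (borel_of T) = {x \<in> topspace T. f x \<in> S}"
    by (auto simp: space_borel_of)
  ultimately show "f -` S \<inter> space (borel_of T) \<in> sets (borel_of T)" by simp
qed

text \<open>The representative is arbitrary, so measurability must come from \<open>f\<close>: an
  invariant continuous function descends to a continuous function on the quotient. This is applied
  to cosets of \<open>H2\<close>, which is not assumed discrete.\<close>

lemma borel_measurable_coset_rep: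
  fixes f :: "'g::{topological_group_add,second_countable_topology} \<Rightarrow> real"
  assumes L: "add_subgroup L" and f: "continuous_on UNIV f" "\<And>l g. l \<in> L \<Longrightarrow> f (l + g) = f g"
  shows "(\<lambda>q. f (coset_rep q)) \<in> borel_measurable (quot UNIV L)"
proof -
  have rep: "f (coset_rep (right_coset L g)) = f g" for g
    using coset_rep_obtain[OF L, of g] f(2) by metis
  have "continuous_map (coset_topology UNIV L) euclideanreal (\<lambda>q. f (coset_rep q))"
    using f(1) by (auto simp: continuous_map_def topspace_coset_topology openin_coset_topology rep
        right_coset_in_coset_space open_vimage vimage_def[symmetric])
  then show ?thesis by (rule borel_measurable_continuous_map)
qed

text \<open>The indicator of an open set is the pointwise limit of Urysohn functions that are 1 on
  the compact sets \<open>S n\<close> and vanish off finitely many \<open>E i\<close>, hence off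
  \<open>S (k n)\<close>. Dominated convergence gives equality on open sets, which generate the
  Borel sets and are stable under intersection. Test functions with values in [0, 1] suffice, which
  later allows nonnegative integrals throughout.\<close>

lemma finite_borel_measure_eqI_compactly_supported:
  assumes T: "locally_compact_space T" "Hausdorff_space T"
    and sigma_compact: "\<And>U. openin T U \<Longrightarrow> \<exists>E Q :: nat \<Rightarrow> 'x set. U = (\<Union>n. E n) \<and>
      (\<forall>n. openin T (E n) \<and> compactin T (Q n) \<and> E n \<subseteq> Q n \<and> Q n \<subseteq> U)"
    and M: "sets M = sets (borel_of T)" "finite_measure M"
    and N: "sets N = sets (borel_of T)" "finite_measure N"
    and eq: "\<And>f. compactly_supported_continuous T f \<Longrightarrow> (\<And>x. x \<in> topspace T \<Longrightarrow> 0 \<le> f x \<and> f x \<le> 1) \<Longrightarrow>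
      (\<integral>x. f x \<partial>M) = (\<integral>x. f x \<partial>N)"
  shows "M = N"
proof -
  interpret M: finite_measure M by fact
  interpret N: finite_measure N by fact
  have space_M: "space M = topspace T" and space_N: "space N = topspace T"
    using sets_eq_imp_space_eq[OF M(1)] sets_eq_imp_space_eq[OF N(1)] by (simp_all add: space_borel_of)
  have creg: "completely_regular_space T"
    using T locally_compact_regular_imp_completely_regular_space by blast
  have open_eq: "emeasure M U = emeasure N U" if U: "openin T U" for U
  proof -
    obtain E Q :: "nat \<Rightarrow> 'x set" where UE: "U = (\<Union>n. E n)"
      and EQ: "\<And>n. openin T (E n)" "\<And>n. compactin T (Q n)" "\<And>n. E n \<subseteq> Q n" "\<And>n. Q n \<subseteq> U"
      using sigma_compact[OF U] by metis
    define S where "S n = (\<Union>i\<le>n. Q i)" for n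
    have S: "compactin T (S n)" for n unfolding S_def by (intro compactin_Union) (use EQ in auto)
    have "\<exists>k. S n \<subseteq> (\<Union>i\<le>k. E i)" for n
    proof -
      have "S n \<subseteq> \<Union>(range E)" unfolding S_def UE[symmetric] using EQ(4) by (intro UN_least)
      then obtain F where F: "finite F" "F \<subseteq> range E" "S n \<subseteq> \<Union>F"
        using S[of n] EQ(1) unfolding compactin_def by (metis (no_types, lifting) imageE)
      obtain I where I: "finite I" "F = E ` I" using finite_subset_image[OF F(1,2)] by auto
      \<comment> \<open>The inserted 0 keeps \<open>Max\<close> meaningful when \<open>I\<close> is
        empty.\<close>
      have "S n \<subseteq> (\<Union>i\<le>Max (insert 0 I). E i)" using F(3) I by (fastforce intro: Max_ge)
      then show ?thesis ..
    qed
    then obtain k where k: "\<And>n. S n \<subseteq> (\<Union>i\<le>k n. E i)" by metis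
    have "\<exists>f. continuous_map T (top_of_set {0..1::real}) f \<and>
        f ` (topspace T - (\<Union>i\<le>k n. E i)) \<subseteq> {0} \<and> f ` S n \<subseteq> {1}" for n
    proof -
      have "closedin T (topspace T - (\<Union>i\<le>k n. E i))" using EQ(1) by blast
      moreover have "disjnt (S n) (topspace T - (\<Union>i\<le>k n. E i))" using k[of n] by (auto simp: disjnt_def)
      ultimately show ?thesis
        using Urysohn_completely_regular_compact_closed[of 0 1 T "S n", OF _ creg S] by (metis zero_le_one)
    qed
    then obtain f where f: "\<And>n. continuous_map T (top_of_set {0..1::real}) (f n)"
      "\<And>n. f n ` (topspace T - (\<Union>i\<le>k n. E i)) \<subseteq> {0}" "\<And>n. f n ` S n \<subseteq> {1}" by metis
    have f_cont: "continuous_map T euclideanreal (f n)" for n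
      using f(1) by (simp add: continuous_map_in_subtopology)
    have f01: "0 \<le> f n x \<and> f n x \<le> 1" if "x \<in> topspace T" for n x
      using f(1)[of n] that by (auto simp: continuous_map_in_subtopology)
    have fS: "f n x = 1" if "x \<in> S n" for n x using f(3) that by blast
    have f0: "f n x = 0" if "x \<in> topspace T" "x \<notin> (\<Union>i\<le>k n. E i)" for n x using f(2) that by blast
    have f_Cc: "compactly_supported_continuous T (f n)" for n
      unfolding compactly_supported_continuous_def
    proof (intro conjI exI[of _ "S (k n)"] f_cont S ballI)
      fix x assume "x \<in> topspace T - S (k n)"
      then show "f n x = 0" using EQ(3) by (intro f0) (auto simp: S_def)
    qed
    have lim: "(\<lambda>n. f n x) \<longlonglongrightarrow> indicator U x" if x: "x \<in> topspace T" for x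
    proof (cases "x \<in> U")
      case True
      then obtain i where "x \<in> Q i" using UE EQ(3) by blast
      then have "\<forall>n\<ge>i. f n x = indicator U x" using True by (auto simp: S_def intro!: fS)
      then show ?thesis by (intro tendsto_eventually) (auto simp: eventually_sequentially)
    next
      case False
      then have "f n x = indicator U x" for n using x UE by (auto intro!: f0)
      then show ?thesis by simp
    qed
    have conv: "(\<lambda>n. \<integral>x. f n x \<partial>L) \<longlonglongrightarrow> measure L U"
      if L: "sets L = sets (borel_of T)" "finite_measure L" for L
    proof -
      interpret L: finite_measure L by fact
      have sp: "space L = topspace T" using sets_eq_imp_space_eq[OF L(1)] by (simp add: space_borel_of)
      have UL: "U \<in> sets L" using U L by (simp add: openin_in_borel_of)
      have "(\<lambda>n. \<integral>x. f n x \<partial>L) \<longlonglongrightarrow> (\<integral>x. indicator U x \<partial>L)"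
      proof (rule integral_dominated_convergence[where w = "\<lambda>_. 1"])
        show "f n \<in> borel_measurable L" for n
          using borel_measurable_continuous_map[OF f_cont] L by (simp cong: measurable_cong_sets)
        show "AE x in L. (\<lambda>n. f n x) \<longlonglongrightarrow> indicator U x"
          using lim by (intro AE_I2) (simp add: sp)
        show "AE x in L. norm (f n x) \<le> 1" for n
          using f01 by (intro AE_I2) (simp add: sp)
      qed (use UL in auto)
      moreover have "(\<integral>x. indicator U x \<partial>L) = measure L U"
        using UL by (simp add: sets.Int_space_eq2)
      ultimately show ?thesis by simp
    qed
    have "(\<lambda>n. \<integral>x. f n x \<partial>M) = (\<lambda>n. \<integral>x. f n x \<partial>N)" using eq[OF f_Cc f01] by auto
    then have "measure M U = measure N U"
      using conv[OF M] conv[OF N] LIMSEQ_unique by metis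
    then show ?thesis by (simp add: M.emeasure_eq_measure N.emeasure_eq_measure)
  qed
  show ?thesis
  proof (rule measure_eqI_generator_eq[where E = "{U. openin T U}" and \<Omega> = "topspace T" and A = "\<lambda>_. topspace T"])
    show "Int_stable {U. openin T U}" by (auto simp: Int_stable_def)
    show "{U. openin T U} \<subseteq> Pow (topspace T)" by (auto dest: openin_subset)
    show "sets M = sigma_sets (topspace T) {U. openin T U}" "sets N = sigma_sets (topspace T) {U. openin T U}"
      using M N by (simp_all add: sets_borel_of)
  qed (use open_eq M.emeasure_finite in auto)
qed

text \<open>Two cosets are distinct exactly when \<open>a - b\<close> avoids \<open>L\<close>, an
  open condition on the pair as \<open>L\<close> is closed. A box around \<open>(a, b)\<close>
  satisfying it projects to disjoint open sets.\<close>

lemma Hausdorff_coset_topology: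
  fixes L :: "'g::topological_group_add set"
  assumes L: "add_subgroup L" "closed L"
  shows "Hausdorff_space (coset_topology UNIV L)"
  unfolding Hausdorff_space_def topspace_coset_topology
proof (intro allI impI)
  have op: "openin (coset_topology UNIV L) (right_coset L ` E)" if "open E" for E
    using openin_right_coset_image[of UNIV L E] L that by (simp add: add_subgroup_def)
  have op2: "open ((\<lambda>(a, b). a - b) -` (- L) :: ('g \<times> 'g) set)"
    using L(2) by (intro open_vimage) (auto simp: case_prod_unfold intro!: continuous_intros)
  fix y z assume "y \<in> coset_space UNIV L \<and> z \<in> coset_space UNIV L \<and> y \<noteq> z"
  then obtain a b where ab: "y = right_coset L a" "z = right_coset L b" "right_coset L a \<noteq> right_coset L b"
    by (auto simp: coset_space_def)
  then have "(a, b) \<in> (\<lambda>(a, b). a - b) -` (- L)" by (simp add: right_coset_eq_iff[OF L(1)])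
  with op2 obtain A B where AB: "open A" "open B" "(a, b) \<in> A \<times> B" "A \<times> B \<subseteq> (\<lambda>(a, b). a - b) -` (- L)"
    by (rule open_prod_elim)
  have "right_coset L a' \<noteq> right_coset L b'" if "a' \<in> A" "b' \<in> B" for a' b'
    using subsetD[OF AB(4), of "(a', b')"] that by (simp add: right_coset_eq_iff[OF L(1)])
  then have "disjnt (right_coset L ` A) (right_coset L ` B)" by (auto simp: disjnt_def)
  then show "\<exists>U V. openin (coset_topology UNIV L) U \<and> openin (coset_topology UNIV L) V \<and>
      y \<in> U \<and> z \<in> V \<and> disjnt U V"
    using op[OF AB(1)] op[OF AB(2)] AB(3) ab(1,2)
    by (intro exI[of _ "right_coset L ` A"] exI[of _ "right_coset L ` B"]) auto
qed

lemma (in discrete_subgroup) quotient_topology: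
  assumes KU: "K = UNIV"
  shows "Hausdorff_space (coset_topology UNIV \<Lambda>)" "locally_compact_space (coset_topology UNIV \<Lambda>)"
    "openin (coset_topology UNIV \<Lambda>) T \<Longrightarrow> \<exists>E Q :: nat \<Rightarrow> 'g set set. T = (\<Union>n. E n) \<and>
      (\<forall>n. openin (coset_topology UNIV \<Lambda>) (E n) \<and> compactin (coset_topology UNIV \<Lambda>) (Q n) \<and> E n \<subseteq> Q n \<and> Q n \<subseteq> T)"
proof -
  have op: "openin (coset_topology UNIV \<Lambda>) (right_coset \<Lambda> ` E)" if "open E" for E
    using openin_right_coset_image[OF K(1) \<Lambda>(1,2) that] KU by simp
  \<comment> \<open>A discrete subgroup is closed: each \<open>U n\<close> contains at most one of
    its elements, and removing that element leaves an open set.\<close>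
  have "open (- \<Lambda>)"
  proof (rule Topological_Spaces.openI)
    fix x assume x: "x \<in> - \<Lambda>"
    obtain n where n: "x \<in> U n" using UN_U by blast
    have uniq: "a = b" if "a \<in> U n \<inter> \<Lambda>" "b \<in> U n \<inter> \<Lambda>" for a b
    proof -
      have "a - b \<in> \<Lambda>" "a - b + b \<in> U n" using that \<Lambda>(1) by (auto simp: add_subgroupD)
      then have "a - b = 0" using small_U[of n] that unfolding small_def by blast
      then show ?thesis by simp
    qed
    have "finite (U n \<inter> \<Lambda>)"
    proof (cases "U n \<inter> \<Lambda> = {}")
      case False
      then obtain a where "a \<in> U n \<inter> \<Lambda>" by auto
      then have "U n \<inter> \<Lambda> \<subseteq> {a}" using uniq by (intro subsetI) simp
      then show ?thesis by (rule finite_subset) simp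
    qed simp
    then have "open (U n - U n \<inter> \<Lambda>)" using open_U by (intro open_Diff finite_imp_closed) auto
    then show "\<exists>T. open T \<and> x \<in> T \<and> T \<subseteq> - \<Lambda>" using n x by (intro exI[of _ "U n - U n \<inter> \<Lambda>"]) auto
  qed
  then show "Hausdorff_space (coset_topology UNIV \<Lambda>)"
    using \<Lambda>(1) by (intro Hausdorff_coset_topology) (auto simp: closed_def)
  show "locally_compact_space (coset_topology UNIV \<Lambda>)"
    unfolding locally_compact_space_def topspace_coset_topology
  proof
    fix y assume "y \<in> coset_space UNIV \<Lambda>"
    then obtain a where a: "y = right_coset \<Lambda> a" by (auto simp: coset_space_def)
    obtain V C where "open V" "a \<in> V" "V \<subseteq> C" "compact C"
      using lc_compact_nhd[OF lc open_UNIV UNIV_I[of a]] by auto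
    then show "\<exists>U K. openin (coset_topology UNIV \<Lambda>) U \<and> compactin (coset_topology UNIV \<Lambda>) K \<and> y \<in> U \<and> U \<subseteq> K"
      using op[of V] compactin_right_coset_image[of C \<Lambda>] a
      by (intro exI[of _ "right_coset \<Lambda> ` V"] exI[of _ "right_coset \<Lambda> ` C"]) auto
  qed
  assume T: "openin (coset_topology UNIV \<Lambda>) T"
  define P where "P = right_coset \<Lambda> -` T"
  have P: "open P" using T by (simp add: P_def openin_coset_topology vimage_def)
  have TP: "T = right_coset \<Lambda> ` P"
    using openin_subset[OF T] by (auto simp: P_def topspace_coset_topology coset_space_def)
  \<comment> \<open>With the Hausdorff property, local compactness yields a base of compact
    neighbourhoods, so the compact sets can be chosen inside \<open>P\<close> and their projections
    inside \<open>T\<close>.\<close>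
  have "Hausdorff_space (euclidean :: 'g topology)"
    unfolding Hausdorff_space_def
  proof (intro allI impI)
    fix x y :: 'g assume "x \<in> topspace euclidean \<and> y \<in> topspace euclidean \<and> x \<noteq> y"
    then show "\<exists>U V. openin euclidean U \<and> openin euclidean V \<and> x \<in> U \<and> y \<in> V \<and> disjnt U V"
      using hausdorff[of x y] by (simp add: disjnt_def)
  qed
  then have "neighbourhood_base_of (compactin (euclidean :: 'g topology)) euclidean"
    using lc locally_compact_space_neighbourhood_base[of "euclidean :: 'g topology"] by blast
  then have nb: "\<forall>W x :: 'g. open W \<and> x \<in> W \<longrightarrow> (\<exists>U V. open U \<and> compact V \<and> x \<in> U \<and> U \<subseteq> V \<and> V \<subseteq> W)"
    by (simp add: neighbourhood_base_of)
  have "\<exists>E :: nat \<Rightarrow> 'g set. (\<forall>n. open (E n)) \<and> (\<forall>n. \<exists>C. compact C \<and> E n \<subseteq> C \<and> C \<subseteq> P) \<and> P \<subseteq> (\<Union>n. E n)"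
  proof (rule lc_countable_cover)
    fix x assume "x \<in> P"
    then obtain U V where "open U" "compact V" "x \<in> U" "U \<subseteq> V" "V \<subseteq> P"
      using nb P by meson
    then show "\<exists>U. open U \<and> x \<in> U \<and> (\<exists>C. compact C \<and> U \<subseteq> C \<and> C \<subseteq> P)" by auto
  qed auto
  then obtain E :: "nat \<Rightarrow> 'g set" where E: "\<And>n. open (E n)" "\<And>n. \<exists>C. compact C \<and> E n \<subseteq> C \<and> C \<subseteq> P"
    "P \<subseteq> (\<Union>n. E n)" by auto
  from E(2) obtain C where C: "\<And>n. compact (C n)" "\<And>n. E n \<subseteq> C n" "\<And>n. C n \<subseteq> P" by metis
  have "P = (\<Union>n. E n)" using E(3) order_trans[OF C(2,3)] by (intro equalityI UN_least)
  then have 1: "T = (\<Union>n. right_coset \<Lambda> ` E n)" unfolding TP by (simp add: image_UN)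
  have 2: "openin (coset_topology UNIV \<Lambda>) (right_coset \<Lambda> ` E n)"
    "compactin (coset_topology UNIV \<Lambda>) (right_coset \<Lambda> ` C n)"
    "right_coset \<Lambda> ` E n \<subseteq> right_coset \<Lambda> ` C n" "right_coset \<Lambda> ` C n \<subseteq> T" for n
    unfolding TP by (intro op E(1) compactin_right_coset_image C image_mono)+
  show "\<exists>E Q :: nat \<Rightarrow> 'g set set. T = (\<Union>n. E n) \<and>
      (\<forall>n. openin (coset_topology UNIV \<Lambda>) (E n) \<and> compactin (coset_topology UNIV \<Lambda>) (Q n) \<and> E n \<subseteq> Q n \<and> Q n \<subseteq> T)"
    by (rule exI[of _ "\<lambda>n. right_coset \<Lambda> ` E n"], rule exI[of _ "\<lambda>n. right_coset \<Lambda> ` C n"])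
       (intro conjI allI 1 2)
qed

text \<open>The product Haar measure lives on a product of subspaces, while unfolding along \<Delta>
  is set up on the subspace \<open>H1 \<times> H2\<close> of the product. The identity map is
  measurable in both directions.\<close>

lemma sets_pair_restrict_space:
  assumes "A \<inter> space M \<in> sets M" "B \<inter> space N \<in> sets N"
  shows "sets (restrict_space M A \<Otimes>\<^sub>M restrict_space N B) = sets (restrict_space (M \<Otimes>\<^sub>M N) (A \<times> B))"
    (is "sets ?L = sets ?R")
proof (rule antisym)
  have sp: "space ?L = space ?R" by (auto simp: space_pair_measure space_restrict_space)
  have "(\<lambda>x. (fst x, snd x)) \<in> measurable ?R ?L"
    by (intro measurable_Pair measurable_restrict_space2 measurable_restrict_space1)
      (auto simp: space_restrict_space space_pair_measure)
  then have "(\<lambda>x. x) \<in> measurable ?R ?L" by simp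
  then show "sets ?L \<subseteq> sets ?R"
    using measurable_sets[of "\<lambda>x. x" ?R ?L] sets.sets_into_space sp by (metis Int_absorb2 subsetI vimage_ident)
  have "(\<lambda>x. (fst x, snd x)) \<in> measurable ?L (M \<Otimes>\<^sub>M N)"
    by (intro measurable_Pair measurable_compose[OF measurable_fst] measurable_compose[OF measurable_snd]
        measurable_restrict_space1 measurable_ident_sets refl)
  then have "(\<lambda>x. x) \<in> measurable ?L ?R"
    by (intro measurable_restrict_space2) (auto simp: space_pair_measure space_restrict_space)
  then show "sets ?R \<subseteq> sets ?L"
    using measurable_sets[of "\<lambda>x. x" ?L ?R] sets.sets_into_space sp by (metis Int_absorb2 subsetI vimage_ident)
qed

lemma measurable_Pair_borel:
  fixes f :: "'a::second_countable_topology \<times> 'b::second_countable_topology \<Rightarrow> ennreal"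
  assumes f: "f \<in> borel_measurable borel" and [measurable]: "f1 \<in> borel_measurable N" "f2 \<in> borel_measurable N"
  shows "(\<lambda>p. f (f1 p, f2 p)) \<in> borel_measurable N"
  using f by (rule measurable_compose[rotated]) (simp add: borel_prod[symmetric])

section \<open>Subgroup Haar measures on the ambient group, and test sets\<close>

context haar_subgroup
begin

text \<open>The Haar measure of \<open>H\<close> as a measure on the whole group, so that
  measurability of parametric integrals can be checked against \<open>borel\<close> rather than
  against a subspace.\<close>

definition mb :: "'g measure" where "mb = distr m borel (\<lambda>x. x)"

lemma sets_mb [measurable_cong]: "sets mb = sets borel"
  by (simp add: mb_def)

lemma nn_integral_mb: "f \<in> borel_measurable borel \<Longrightarrow> (\<integral>\<^sup>+x. f x \<partial>mb) = (\<integral>\<^sup>+x. f x \<partial>m)"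
  by (simp add: mb_def nn_integral_distr id_measurable)

lemma emeasure_mb: "A \<in> sets borel \<Longrightarrow> emeasure mb A = emeasure m (A \<inter> H)"
  by (simp add: mb_def emeasure_distr id_measurable space_m)

lemma nn_integral_mb_right:
  assumes f: "f \<in> borel_measurable borel" and "h \<in> H"
  shows "(\<integral>\<^sup>+x. f (x + h) \<partial>mb) = (\<integral>\<^sup>+x. f x \<partial>mb)"
proof -
  have "(\<lambda>x. f (x + h)) \<in> borel_measurable borel"
    by (intro measurable_compose[OF _ f]) simp
  then show ?thesis
    using nn_integral_right[OF assms(2) measurable_from_borel[OF f]] f by (simp add: nn_integral_mb)
qed

lemma sigma_finite_mb: "sigma_finite_measure mb"
proof -
  obtain U :: "nat \<Rightarrow> 'g set"
    where U: "\<And>n. open (U n)" "\<And>n. \<exists>C. compact C \<and> U n \<subseteq> C" "UNIV \<subseteq> (\<Union>n. U n)"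
    using compact_cover by blast
  from U(2) obtain C where C: "\<And>n. compact (C n)" "\<And>n. U n \<subseteq> C n" by metis
  have meas: "C n \<in> sets borel" for n by (intro borel_closed compact_imp_closed C)
  have "emeasure mb (C n) < \<infinity>" for n using emeasure_bounded[OF C(1)] meas by (simp add: emeasure_mb)
  moreover have "(\<Union>n. C n) = UNIV" using U(3) C(2) by blast
  ultimately show ?thesis using meas
    by (intro sigma_finite_measure.intro exI[of _ "range C"] conjI)
       (auto simp: mb_def less_top[symmetric])
qed

text \<open>The transverse formula evaluates its test function at inverses; a symmetric
  \<open>L\<close> turns \<open>indicator L (- g)\<close> into \<open>indicator L g\<close>.
  Positive finite measure allows division by it at the end.\<close>

lemma exists_symmetric_compact:
  obtains L where "compact L" "\<And>x. - x \<in> L \<longleftrightarrow> x \<in> L" "emeasure m (L \<inter> H) \<noteq> 0" "emeasure m (L \<inter> H) < \<infinity>"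
proof -
  obtain U C where U: "open U" "(0::'g) \<in> U" "U \<subseteq> C" "compact C"
    using lc_compact_nhd[OF lc open_UNIV UNIV_I[of 0]] by auto
  have L: "compact (C \<union> uminus ` C)"
    using U(4) by (intro compact_Un compact_continuous_image continuous_intros)
  have "emeasure m (U \<inter> H) \<noteq> 0" using U H(1) by (intro open_pos[of _ 0]) (auto simp: add_subgroupD)
  moreover have "emeasure m (U \<inter> H) \<le> emeasure m ((C \<union> uminus ` C) \<inter> H)"
    using U L by (intro emeasure_mono Int_in_sets borel_closed compact_imp_closed) auto
  ultimately have "emeasure m ((C \<union> uminus ` C) \<inter> H) \<noteq> 0" by auto
  moreover have "- x \<in> C \<union> uminus ` C \<longleftrightarrow> x \<in> C \<union> uminus ` C" for x
    by (force simp: image_iff)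
  ultimately show thesis using that[OF L _ _ emeasure_bounded[OF L]] by blast
qed

end

section \<open>Cut-and-project systems\<close>

text \<open>\<nu>1 and \<nu>2 stand for the measures obtained from
  \<open>haar_disintegration\<close>. The extra clause for \<nu>2 ties it to \<open>mQ2\<close>, in
  terms of which \<eta> and the Siegel constant are expressed.\<close>

locale cut_and_project =
  G1: haar_subgroup UNIV mG1 + G2: haar_subgroup UNIV mG2 +
  A: haar_subgroup H1 mH1 + B: haar_subgroup H2 mH2 +
  X: discrete_subgroup UNIV \<Gamma> + O: discrete_subgroup "H1 \<times> H2" \<Delta>
  for H1 :: "'a::{topological_group_add, second_countable_topology, t2_space} set"
    and H2 :: "'b::{topological_group_add, second_countable_topology, t2_space} set"
    and \<Gamma> \<Delta> :: "('a \<times> 'b) set"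
    and mG1 mH1 :: "'a measure" and mG2 mH2 :: "'b measure" +
  fixes mQ2 :: "'b set measure"
    and \<mu> \<sigma>o :: "('a \<times> 'b) set measure"
    and c :: real
    and \<nu>1 :: "'a measure" and \<nu>2 :: "'b measure"
  assumes \<Delta>: "\<Delta> = \<Gamma> \<inter> (H1 \<times> H2)"
    and dense_\<Delta>: "closure (snd ` \<Delta>) = H2"
    and L3: "(\<gamma>1, \<gamma>2) \<in> \<Gamma> \<Longrightarrow> \<gamma>1 \<in> H1 \<Longrightarrow> \<gamma>2 \<in> H2"
    and \<mu>: "sets \<mu> = sets (quot UNIV \<Gamma>)" "prob_space \<mu>"
    and covol: "lattice_constant UNIV \<Gamma> (mG1 \<Otimes>\<^sub>M mG2) \<mu> 1"
    and \<sigma>o: "invariant_prob_measure (H1 \<times> H2) \<Delta> \<sigma>o"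
    and c: "lattice_constant (H1 \<times> H2) \<Delta> (mH1 \<Otimes>\<^sub>M mH2) \<sigma>o c"
    and \<nu>1: "sets \<nu>1 = sets borel" "sigma_finite_measure \<nu>1"
      "\<And>f. f \<in> borel_measurable borel \<Longrightarrow> (\<integral>\<^sup>+g. f g \<partial>mG1) = (\<integral>\<^sup>+g. (\<integral>\<^sup>+h. f (h + g) \<partial>mH1) \<partial>\<nu>1)"
    and \<nu>2: "sets \<nu>2 = sets borel" "sigma_finite_measure \<nu>2"
      "\<And>f. f \<in> borel_measurable borel \<Longrightarrow> (\<integral>\<^sup>+g. f g \<partial>mG2) = (\<integral>\<^sup>+g. (\<integral>\<^sup>+h. f (h + g) \<partial>mH2) \<partial>\<nu>2)"
      "\<And>f :: 'b \<Rightarrow> ennreal. f \<in> borel_measurable borel \<Longrightarrow> (\<And>h g. h \<in> H2 \<Longrightarrow> f (h + g) = f g) \<Longrightarrow>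
       (\<integral>\<^sup>+q. f (coset_rep q) \<partial>mQ2) = (\<integral>\<^sup>+g. f g \<partial>\<nu>2)"
begin

sublocale \<nu>1: sigma_finite_measure \<nu>1 by (rule \<nu>1)
sublocale \<nu>2: sigma_finite_measure \<nu>2 by (rule \<nu>2)
sublocale b1: sigma_finite_measure A.mb by (rule A.sigma_finite_mb)
sublocale b2: sigma_finite_measure B.mb by (rule B.sigma_finite_mb)
sublocale g2: sigma_finite_measure mG2 by (rule G2.sigma_finite_m)
sublocale o: prob_space \<sigma>o using \<sigma>o by (simp add: invariant_prob_measure_def)

lemma sets_\<sigma>o: "sets \<sigma>o = sets (quot (H1 \<times> H2) \<Delta>)"
  using \<sigma>o by (simp add: invariant_prob_measure_def invariant_borel_measure_def)

lemma space_\<sigma>o: "space \<sigma>o = coset_space (H1 \<times> H2) \<Delta>"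
  using sets_eq_imp_space_eq[OF sets_\<sigma>o] by simp

lemma space_\<mu>: "space \<mu> = coset_space UNIV \<Gamma>"
  using sets_eq_imp_space_eq[OF \<mu>(1)] by simp

lemma c_pos: "c > 0"
  using c by (simp add: lattice_constant_def)

lemmas sets_cong [measurable_cong] = \<nu>1(1) \<nu>2(1)

lemma sets_G [measurable_cong]: "sets mG1 = sets borel" "sets mG2 = sets borel"
  using G1.sets_m G2.sets_m by (simp_all add: sets_restrict_UNIV)

lemma O_s [measurable]: "O.s \<in> borel_measurable \<sigma>o"
  using O.s_measurable sets_\<sigma>o by (simp cong: measurable_cong_sets)

lemma X_s [measurable]: "X.s \<in> borel_measurable \<mu>"
  using X.s_measurable \<mu> by (simp cong: measurable_cong_sets)

text \<open>A compact set lies in the rectangle of its two projections. The sets \<open>S\<close>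
  and \<open>T\<close> let one proof cover the full groups and the subgroups, whose measures see
  only subsets of \<open>H1\<close> and \<open>H2\<close>.\<close>

lemma compact_finite_pair:
  assumes "compact C" and "\<And>C. compact C \<Longrightarrow> emeasure M (C \<inter> S) < \<infinity>" "\<And>C. compact C \<Longrightarrow> emeasure N (C \<inter> T) < \<infinity>"
    and "\<And>C. compact C \<Longrightarrow> C \<inter> S \<in> sets M" "\<And>C. compact C \<Longrightarrow> C \<inter> T \<in> sets N"
    and "sigma_finite_measure N" "C \<subseteq> S \<times> T"
  shows "emeasure (M \<Otimes>\<^sub>M N) C < \<infinity>"
proof -
  interpret N: sigma_finite_measure N by fact
  have cf: "compact (fst ` C)" "compact (snd ` C)"
    using assms(1) by (auto intro!: compact_continuous_image continuous_intros)
  have "C \<subseteq> (fst ` C \<inter> S) \<times> (snd ` C \<inter> T)" using assms(7) by force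
  then have "emeasure (M \<Otimes>\<^sub>M N) C \<le> emeasure (M \<Otimes>\<^sub>M N) ((fst ` C \<inter> S) \<times> (snd ` C \<inter> T))"
    using assms(4)[OF cf(1)] assms(5)[OF cf(2)] by (intro emeasure_mono) auto
  also have "\<dots> = emeasure M (fst ` C \<inter> S) * emeasure N (snd ` C \<inter> T)"
    using assms(4)[OF cf(1)] assms(5)[OF cf(2)] by (rule N.emeasure_pair_measure_Times)
  also have "\<dots> < \<infinity>"
    using assms(2)[OF cf(1)] assms(3)[OF cf(2)] by (simp add: ennreal_mult_less_top)
  finally show ?thesis .
qed

section \<open>Unfolding along the two lattices\<close>

lemma unfold_\<Gamma>:
  fixes f :: "'a \<times> 'b \<Rightarrow> ennreal"
  assumes f [measurable]: "f \<in> borel_measurable borel"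
  shows "(\<integral>\<^sup>+x. (\<integral>\<^sup>+\<gamma>. f (\<gamma> + X.s x) \<partial>count_space \<Gamma>) \<partial>\<mu>) = (\<integral>\<^sup>+x1. (\<integral>\<^sup>+x2. f (x1, x2) \<partial>mG2) \<partial>mG1)"
proof -
  interpret \<mu>: prob_space \<mu> by (rule \<mu>)
  have sets: "sets (mG1 \<Otimes>\<^sub>M mG2) = sets borel"
    using sets_pair_measure_cong[OF sets_G] unfolding borel_prod .
  have "(\<integral>\<^sup>+x. f x \<partial>(mG1 \<Otimes>\<^sub>M mG2)) =
      ennreal (inverse 1) * (\<integral>\<^sup>+x. (\<integral>\<^sup>+\<gamma>. f (\<gamma> + X.s x) \<partial>count_space \<Gamma>) \<partial>\<mu>)"
  proof (rule X.nn_integral_unfold[OF _ _ \<mu>(1) \<mu>.finite_measure_axioms covol])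
    show "emeasure (mG1 \<Otimes>\<^sub>M mG2) C < \<infinity>" if "compact C" for C
      using that G1.emeasure_bounded G2.emeasure_bounded
      by (intro compact_finite_pair[of C _ UNIV _ UNIV])
         (auto simp: sets_G compact_imp_closed intro: G2.sigma_finite_m)
  qed (simp_all add: sets sets_restrict_UNIV cong: measurable_cong_sets)
  moreover have "f \<in> borel_measurable (mG1 \<Otimes>\<^sub>M mG2)"
    using f sets by (simp cong: measurable_cong_sets)
  ultimately show ?thesis by (simp add: g2.nn_integral_fst)
qed

lemma unfold_\<Delta>:
  fixes f :: "'a \<times> 'b \<Rightarrow> ennreal"
  assumes f [measurable]: "f \<in> borel_measurable borel"
  shows "(\<integral>\<^sup>+h1. (\<integral>\<^sup>+h2. f (h1, h2) \<partial>B.mb) \<partial>A.mb) =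
    ennreal (inverse c) * (\<integral>\<^sup>+y. (\<integral>\<^sup>+\<delta>. f (\<delta> + O.s y) \<partial>count_space \<Delta>) \<partial>\<sigma>o)"
proof -
  interpret h2: sigma_finite_measure mH2 by (rule B.sigma_finite_m)
  have sets: "sets (mH1 \<Otimes>\<^sub>M mH2) = sets (restrict_space borel (H1 \<times> H2))"
    using sets_pair_measure_cong[OF A.sets_m B.sets_m]
      sets_pair_restrict_space[of H1 "borel :: 'a measure" H2 "borel :: 'b measure"]
    by (simp add: borel_prod)
  have f': "f \<in> borel_measurable (mH1 \<Otimes>\<^sub>M mH2)"
    using measurable_restrict_space1[OF f] sets by (simp cong: measurable_cong_sets)
  have "(\<integral>\<^sup>+x. f x \<partial>(mH1 \<Otimes>\<^sub>M mH2)) =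
      ennreal (inverse c) * (\<integral>\<^sup>+y. (\<integral>\<^sup>+\<delta>. f (\<delta> + O.s y) \<partial>count_space \<Delta>) \<partial>\<sigma>o)"
  proof (rule O.nn_integral_unfold[OF sets _ sets_\<sigma>o o.finite_measure_axioms c f'])
    show "emeasure (mH1 \<Otimes>\<^sub>M mH2) C < \<infinity>" if "compact C" "C \<subseteq> H1 \<times> H2" for C
      using that A.emeasure_bounded B.emeasure_bounded
      by (intro compact_finite_pair[of C _ H1 _ H2])
         (auto intro!: A.Int_in_sets B.Int_in_sets borel_closed compact_imp_closed B.sigma_finite_m)
  qed
  moreover have "(\<integral>\<^sup>+x. f x \<partial>(mH1 \<Otimes>\<^sub>M mH2)) = (\<integral>\<^sup>+h1. (\<integral>\<^sup>+h2. f (h1, h2) \<partial>mH2) \<partial>mH1)"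
    using f' by (simp add: h2.nn_integral_fst)
  moreover have "\<dots> = (\<integral>\<^sup>+h1. (\<integral>\<^sup>+h2. f (h1, h2) \<partial>B.mb) \<partial>mH1)"
    by (simp add: B.nn_integral_mb measurable_Pair_borel[OF f])
  moreover have "\<dots> = (\<integral>\<^sup>+h1. (\<integral>\<^sup>+h2. f (h1, h2) \<partial>B.mb) \<partial>A.mb)"
  proof (rule A.nn_integral_mb[symmetric])
    note [measurable (raw)] = measurable_Pair_borel[OF f]
    show "(\<lambda>h1. \<integral>\<^sup>+h2. f (h1, h2) \<partial>B.mb) \<in> borel_measurable borel" by measurable
  qed
  ultimately show ?thesis by simp
qed

text \<open>Invariance takes \<phi> out of the sum over \<Delta>, and the remaining orbit sum of the
  indicator of \<open>O.D\<close> is 1. The shift \<open>x\<close> may be any point because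
  \<open>O.D\<close> is a domain in the whole group.\<close>

lemma unfold_domain:
  fixes \<phi> :: "'a \<times> 'b \<Rightarrow> ennreal"
  assumes \<phi> [measurable]: "\<phi> \<in> borel_measurable borel" and inv: "\<And>\<delta> x. \<delta> \<in> \<Delta> \<Longrightarrow> \<phi> (\<delta> + x) = \<phi> x"
  shows "(\<integral>\<^sup>+h1. (\<integral>\<^sup>+h2. indicator O.D ((h1, h2) + x) * \<phi> ((h1, h2) + x) \<partial>B.mb) \<partial>A.mb) =
    ennreal (inverse c) * (\<integral>\<^sup>+y. \<phi> (O.s y + x) \<partial>\<sigma>o)"
proof -
  have "(\<integral>\<^sup>+\<delta>. indicator O.D (\<delta> + O.s y + x) * \<phi> (\<delta> + O.s y + x) \<partial>count_space \<Delta>) = \<phi> (O.s y + x)" for y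
  proof -
    have "(\<integral>\<^sup>+\<delta>. indicator O.D (\<delta> + O.s y + x) * \<phi> (\<delta> + O.s y + x) \<partial>count_space \<Delta>) =
        (\<integral>\<^sup>+\<delta>. indicator O.D (\<delta> + (O.s y + x)) * \<phi> (O.s y + x) \<partial>count_space \<Delta>)"
      by (intro nn_integral_cong) (simp add: add.assoc inv)
    also have "\<dots> = \<phi> (O.s y + x)" by (simp add: nn_integral_multc O.sum_D)
    finally show ?thesis .
  qed
  then show ?thesis
    by (subst unfold_\<Delta>[where f = "\<lambda>z. indicator O.D (z + x) * \<phi> (z + x)"]) simp_all
qed

text \<open>Unfolding along \<Gamma> gives the Haar integral of \<phi> over \<open>O.D\<close>.
  After both factors are disintegrated, each fibre integral over \<open>H1 \<times> H2\<close> folds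
  back along \<Delta>, which produces \<open>inverse c\<close>.\<close>

lemma unfold_transverse:
  fixes \<phi> :: "'a \<times> 'b \<Rightarrow> ennreal"
  assumes \<phi> [measurable]: "\<phi> \<in> borel_measurable borel" and inv: "\<And>\<delta> x. \<delta> \<in> \<Delta> \<Longrightarrow> \<phi> (\<delta> + x) = \<phi> x"
  shows "(\<integral>\<^sup>+x. (\<integral>\<^sup>+\<gamma>. indicator O.D (\<gamma> + X.s x) * \<phi> (\<gamma> + X.s x) \<partial>count_space \<Gamma>) \<partial>\<mu>) =
    ennreal (inverse c) * (\<integral>\<^sup>+g1. (\<integral>\<^sup>+g2. (\<integral>\<^sup>+y. \<phi> (O.s y + (g1, g2)) \<partial>\<sigma>o) \<partial>\<nu>2) \<partial>\<nu>1)"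
proof -
  interpret P: pair_sigma_finite A.mb \<nu>2 ..
  define F where "F z = indicator O.D z * \<phi> z" for z
  have F [measurable]: "F \<in> borel_measurable borel" unfolding F_def by measurable
  note [measurable (raw)] = measurable_Pair_borel[OF F]
  have "(\<integral>\<^sup>+x. (\<integral>\<^sup>+\<gamma>. F (\<gamma> + X.s x) \<partial>count_space \<Gamma>) \<partial>\<mu>) = (\<integral>\<^sup>+x1. (\<integral>\<^sup>+x2. F (x1, x2) \<partial>mG2) \<partial>mG1)"
    by (rule unfold_\<Gamma>[OF F])
  also have "\<dots> = (\<integral>\<^sup>+x1. (\<integral>\<^sup>+g2. (\<integral>\<^sup>+h2. F (x1, h2 + g2) \<partial>B.mb) \<partial>\<nu>2) \<partial>mG1)"
    by (simp add: \<nu>2(3) B.nn_integral_mb)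
  also have "\<dots> = (\<integral>\<^sup>+g1. (\<integral>\<^sup>+h1. (\<integral>\<^sup>+g2. (\<integral>\<^sup>+h2. F (h1 + g1, h2 + g2) \<partial>B.mb) \<partial>\<nu>2) \<partial>A.mb) \<partial>\<nu>1)"
    by (subst \<nu>1(3)) (simp_all add: A.nn_integral_mb)
  \<comment> \<open>The exchange brings the two fibre variables together, the form that
    \<open>unfold_domain\<close> needs.\<close>
  also have "\<dots> = (\<integral>\<^sup>+g1. (\<integral>\<^sup>+g2. (\<integral>\<^sup>+h1. (\<integral>\<^sup>+h2. F (h1 + g1, h2 + g2) \<partial>B.mb) \<partial>A.mb) \<partial>\<nu>2) \<partial>\<nu>1)"
    by (intro nn_integral_cong P.Fubini'[symmetric]) measurable
  also have "\<dots> = (\<integral>\<^sup>+g1. (\<integral>\<^sup>+g2. ennreal (inverse c) * (\<integral>\<^sup>+y. \<phi> (O.s y + (g1, g2)) \<partial>\<sigma>o) \<partial>\<nu>2) \<partial>\<nu>1)"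
    by (intro nn_integral_cong, subst unfold_domain[OF \<phi> inv, symmetric]) (simp_all add: F_def)
  also have "\<dots> = ennreal (inverse c) * (\<integral>\<^sup>+g1. (\<integral>\<^sup>+g2. (\<integral>\<^sup>+y. \<phi> (O.s y + (g1, g2)) \<partial>\<sigma>o) \<partial>\<nu>2) \<partial>\<nu>1)"
    by (simp add: nn_integral_cmult borel_prod[symmetric])
  finally show ?thesis by (simp add: F_def)
qed

end

lemma borel_measurable_fst_snd [measurable]:
  "(fst :: 'a::second_countable_topology \<times> 'b::second_countable_topology \<Rightarrow> 'a) \<in> borel_measurable borel"
  "(snd :: 'a \<times> 'b \<Rightarrow> 'b) \<in> borel_measurable borel"
  by (intro borel_measurable_continuous_onI continuous_intros)+

section \<open>Translates of the orbit measure and the hitting sums\<close>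

context cut_and_project
begin

lemma \<Delta>_sub: "\<Delta> \<subseteq> \<Gamma>" "\<Delta> \<subseteq> H1 \<times> H2"
  by (auto simp: \<Delta>)

text \<open>The translate of \<sigma>o by the inverse of \<open>(0, g)\<close>, as a measure on the
  big quotient. Writing it with the section \<open>O.s\<close> makes measurability in
  \<open>g\<close> immediate; agreement with the translate in the theorem is
  \<open>distr_coset_incl\<close>.\<close>

definition \<kappa> :: "'b \<Rightarrow> ('a \<times> 'b) set measure" where
  "\<kappa> g = distr \<sigma>o (quot UNIV \<Gamma>) (\<lambda>y. right_coset \<Gamma> (O.s y + (0, g)))"

lemma sets_\<kappa> [measurable_cong]: "sets (\<kappa> g) = sets (quot UNIV \<Gamma>)"
  by (simp add: \<kappa>_def)

lemma nn_integral_\<kappa>: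
  assumes [measurable]: "f \<in> borel_measurable (quot UNIV \<Gamma>)"
  shows "(\<integral>\<^sup>+x. f x \<partial>\<kappa> g) = (\<integral>\<^sup>+y. f (right_coset \<Gamma> (O.s y + (0, g))) \<partial>\<sigma>o)"
  unfolding \<kappa>_def by (rule nn_integral_distr) measurable

lemma emeasure_\<kappa>:
  assumes B [measurable]: "B \<in> sets (quot UNIV \<Gamma>)"
  shows "emeasure (\<kappa> g) B = (\<integral>\<^sup>+y. indicator B (right_coset \<Gamma> (O.s y + (0, g))) \<partial>\<sigma>o)"
  using nn_integral_\<kappa>[of "indicator B" g] B by (simp add: sets_\<kappa>)

lemma prob_space_\<kappa>: "prob_space (\<kappa> g)"
  unfolding \<kappa>_def by (rule o.prob_space_distr) measurable

text \<open>Invariance of \<sigma>o read through the section: the section at the translated coset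
  and \<open>O.s y + k\<close> differ by an element of \<Delta>, which \<phi> does not see.\<close>

lemma nn_integral_\<sigma>o_translate:
  fixes \<phi> :: "'a \<times> 'b \<Rightarrow> ennreal"
  assumes \<phi> [measurable]: "\<phi> \<in> borel_measurable borel" and inv: "\<And>\<delta> x. \<delta> \<in> \<Delta> \<Longrightarrow> \<phi> (\<delta> + x) = \<phi> x"
    and k: "k \<in> H1 \<times> H2"
  shows "(\<integral>\<^sup>+y. \<phi> (O.s y + k) \<partial>\<sigma>o) = (\<integral>\<^sup>+y. \<phi> (O.s y) \<partial>\<sigma>o)"
proof -
  have act: "coset_act (- k) y = right_coset \<Delta> (O.s y + k)" if "y \<in> space \<sigma>o" for y
    using coset_act_right_coset[of "- k" \<Delta> "O.s y"] O.s_props(3)[of y] that by (simp add: space_\<sigma>o)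
  have sK: "O.s y + k \<in> H1 \<times> H2" if "y \<in> space \<sigma>o" for y
    using O.s_props(2)[of y] that k by (intro add_subgroupD(2)[OF O.K(1)]) (auto simp: space_\<sigma>o)
  have "(\<lambda>y. O.s y + k) \<in> measurable \<sigma>o (restrict_space borel (H1 \<times> H2))"
    using sK by (intro measurable_restrict_space2) auto
  from measurable_compose[OF this measurable_right_coset]
  have "(\<lambda>y. right_coset \<Delta> (O.s y + k)) \<in> measurable \<sigma>o \<sigma>o"
    using sets_\<sigma>o by (simp cong: measurable_cong_sets)
  then have act_meas: "coset_act (- k) \<in> measurable \<sigma>o \<sigma>o"
    using act by (simp cong: measurable_cong)
  have "- k \<in> H1 \<times> H2" using k by (rule add_subgroupD(3)[OF O.K(1)])
  moreover have "\<forall>k\<in>H1 \<times> H2. distr \<sigma>o \<sigma>o (coset_act k) = \<sigma>o"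
    using \<sigma>o unfolding invariant_prob_measure_def invariant_borel_measure_def by (elim conjE)
  ultimately have "distr \<sigma>o \<sigma>o (coset_act (- k)) = \<sigma>o" by (rule bspec[rotated])
  then have "(\<integral>\<^sup>+y. \<phi> (O.s y) \<partial>\<sigma>o) = (\<integral>\<^sup>+y. \<phi> (O.s y) \<partial>distr \<sigma>o \<sigma>o (coset_act (- k)))" by simp
  also have "\<dots> = (\<integral>\<^sup>+y. \<phi> (O.s (coset_act (- k) y)) \<partial>\<sigma>o)"
    by (rule nn_integral_distr[OF act_meas]) measurable
  also have "\<dots> = (\<integral>\<^sup>+y. \<phi> (O.s y + k) \<partial>\<sigma>o)"
  proof (rule nn_integral_cong)
    fix y assume y: "y \<in> space \<sigma>o"
    obtain l where "l \<in> \<Delta>" "O.s (right_coset \<Delta> (O.s y + k)) = l + (O.s y + k)"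
      using O.s_right_coset[OF sK[OF y]] .
    then show "\<phi> (O.s (coset_act (- k) y)) = \<phi> (O.s y + k)" using act[OF y] inv by simp
  qed
  finally show ?thesis by simp
qed

text \<open>The element \<open>(0, h)\<close> lies in \<open>H1 \<times> H2\<close> and is absorbed
  by \<sigma>o. Consequently \<kappa> at \<open>coset_rep q\<close> does not depend on the chosen
  representative.\<close>

lemma \<kappa>_invariant:
  assumes "h \<in> H2"
  shows "\<kappa> (h + g) = \<kappa> g"
proof (rule measure_eqI)
  fix B assume "B \<in> sets (\<kappa> (h + g))"
  then have B [measurable]: "B \<in> sets (quot UNIV \<Gamma>)" by (simp add: sets_\<kappa>)
  have "(0, h) \<in> H1 \<times> H2" using assms A.H(1) by (simp add: add_subgroupD)
  moreover have "right_coset \<Gamma> (\<delta> + x + (0, g)) = right_coset \<Gamma> (x + (0, g))" if "\<delta> \<in> \<Delta>" for \<delta> x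
    using right_coset_add_left[OF X.\<Lambda>(1), of \<delta> "x + (0, g)"] that \<Delta>_sub by (auto simp: add.assoc)
  ultimately have "(\<integral>\<^sup>+y. indicator B (right_coset \<Gamma> (O.s y + (0, h) + (0, g))) \<partial>\<sigma>o) =
      (\<integral>\<^sup>+y. indicator B (right_coset \<Gamma> (O.s y + (0, g))) \<partial>\<sigma>o)"
    by (intro nn_integral_\<sigma>o_translate[where \<phi> = "\<lambda>x. indicator B (right_coset \<Gamma> (x + (0, g)))"]) auto
  then show "emeasure (\<kappa> (h + g)) B = emeasure (\<kappa> g) B"
    by (simp add: emeasure_\<kappa> add.assoc)
qed (simp add: sets_\<kappa>)

lemma measurable_\<kappa> [measurable]:
  assumes [measurable]: "B \<in> sets (quot UNIV \<Gamma>)"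
  shows "(\<lambda>g. emeasure (\<kappa> g) B) \<in> borel_measurable borel"
  unfolding emeasure_\<kappa>[OF assms] by measurable

text \<open>The inner integral of the transverse formula for the product of the indicators of
  \<open>L\<close> and \<open>B\<close>, along the coset of \<open>fst x\<close>. Acting by
  \<open>h + fst x\<close> on the coset of \<open>x\<close> cancels the first coordinate and leaves
  \<open>(- h, snd x)\<close>.\<close>

definition \<Phi> :: "'a set \<Rightarrow> ('a \<times> 'b) set set \<Rightarrow> 'a \<times> 'b \<Rightarrow> ennreal" where
  "\<Phi> L B x = (\<integral>\<^sup>+h. indicator L (- (h + fst x)) * indicator B (right_coset \<Gamma> (- h, snd x)) \<partial>A.mb)"

lemma \<Phi>_measurable [measurable]:
  assumes [measurable]: "L \<in> sets borel" "B \<in> sets (quot UNIV \<Gamma>)"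
  shows "\<Phi> L B \<in> borel_measurable borel"
  unfolding \<Phi>_def[abs_def] by measurable

lemma \<Phi>_shift:
  assumes [measurable]: "L \<in> sets borel" "B \<in> sets (quot UNIV \<Gamma>)" and a: "a \<in> H1"
  shows "\<Phi> L B (a + x1, x2) =
    (\<integral>\<^sup>+h. indicator L (- (h + x1)) * indicator B (right_coset \<Gamma> (a - h, x2)) \<partial>A.mb)"
proof -
  have "(\<lambda>h. indicator L (- (h + x1)) * indicator B (right_coset \<Gamma> (a - h, x2)) :: ennreal) \<in> borel_measurable borel"
    by measurable
  from A.nn_integral_mb_right[OF this a] show ?thesis
    by (simp add: \<Phi>_def add.assoc diff_add_eq_diff_diff_swap)
qed

text \<open>After \<open>\<Phi>_shift\<close>, the element \<delta> stands on the left inside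
  \<open>right_coset \<Gamma>\<close>, where \<Gamma> absorbs it.\<close>

lemma \<Phi>_invariant:
  assumes [measurable]: "L \<in> sets borel" "B \<in> sets (quot UNIV \<Gamma>)" and \<delta>: "\<delta> \<in> \<Delta>"
  shows "\<Phi> L B (\<delta> + x) = \<Phi> L B x"
proof -
  obtain \<delta>1 \<delta>2 x1 x2 where eq: "\<delta> = (\<delta>1, \<delta>2)" "x = (x1, x2)" by fastforce
  have "right_coset \<Gamma> (\<delta>1 - h, \<delta>2 + x2) = right_coset \<Gamma> (- h, x2)" for h
    using right_coset_add_left[OF X.\<Lambda>(1), of \<delta> "(- h, x2)"] \<delta> \<Delta>_sub by (auto simp: eq)
  then show ?thesis
    using \<Phi>_shift[OF assms(1,2), of \<delta>1 x1 "\<delta>2 + x2"] \<delta> \<Delta>_sub by (auto simp: eq \<Phi>_def)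
qed

text \<open>Averaging over \<sigma>o decouples the two indicators: once the integrals are exchanged,
  the shift by \<open>(- h, 0)\<close> lies in \<open>H1 \<times> H2\<close> and disappears by
  invariance.\<close>

lemma \<Phi>_average:
  assumes [measurable]: "L \<in> sets borel" "B \<in> sets (quot UNIV \<Gamma>)"
  shows "(\<integral>\<^sup>+y. \<Phi> L B (O.s y + (g1, g2)) \<partial>\<sigma>o) =
    (\<integral>\<^sup>+h. indicator L (- (h + g1)) \<partial>A.mb) * emeasure (\<kappa> g2) B"
proof -
  interpret P: pair_sigma_finite \<sigma>o A.mb ..
  have "(\<integral>\<^sup>+y. \<Phi> L B (O.s y + (g1, g2)) \<partial>\<sigma>o) =
    (\<integral>\<^sup>+y. (\<integral>\<^sup>+h. indicator L (- (h + g1)) * indicator B (right_coset \<Gamma> (O.s y + (- h, g2))) \<partial>A.mb) \<partial>\<sigma>o)"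
  proof (rule nn_integral_cong)
    fix y assume "y \<in> space \<sigma>o"
    then have "O.s y \<in> H1 \<times> H2" using O.s_props(2) by (simp add: space_\<sigma>o)
    then obtain a b where ab: "O.s y = (a, b)" "a \<in> H1" by auto
    show "\<Phi> L B (O.s y + (g1, g2)) =
      (\<integral>\<^sup>+h. indicator L (- (h + g1)) * indicator B (right_coset \<Gamma> (O.s y + (- h, g2))) \<partial>A.mb)"
      using \<Phi>_shift[OF assms ab(2)] by (simp add: ab)
  qed
  also have "\<dots> = (\<integral>\<^sup>+h. (\<integral>\<^sup>+y. indicator L (- (h + g1)) * indicator B (right_coset \<Gamma> (O.s y + (- h, g2))) \<partial>\<sigma>o) \<partial>A.mb)"
    by (rule P.Fubini'[symmetric]) measurable
  also have "\<dots> = (\<integral>\<^sup>+h. indicator L (- (h + g1)) * (\<integral>\<^sup>+y. indicator B (right_coset \<Gamma> (O.s y + (- h, g2))) \<partial>\<sigma>o) \<partial>A.mb)"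
    by (simp add: nn_integral_cmult)
  \<comment> \<open>Next the integral is moved to \<open>mH1\<close>, whose space is
    \<open>H1\<close>: the invariance argument needs \<open>h \<in> H1\<close> at every
    point.\<close>
  also have "\<dots> = (\<integral>\<^sup>+h. indicator L (- (h + g1)) * (\<integral>\<^sup>+y. indicator B (right_coset \<Gamma> (O.s y + (- h, g2))) \<partial>\<sigma>o) \<partial>mH1)"
    by (rule A.nn_integral_mb) measurable
  also have "\<dots> = (\<integral>\<^sup>+h. indicator L (- (h + g1)) * emeasure (\<kappa> g2) B \<partial>mH1)"
  proof (rule nn_integral_cong)
    fix h assume "h \<in> space mH1"
    then have k: "(- h, 0) \<in> H1 \<times> H2" using A.H(1) B.H(1) by (simp add: A.space_m add_subgroupD)
    have inv: "right_coset \<Gamma> (\<delta> + x + (0, g2)) = right_coset \<Gamma> (x + (0, g2))" if "\<delta> \<in> \<Delta>" for \<delta> x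
      using right_coset_add_left[OF X.\<Lambda>(1), of \<delta> "x + (0, g2)"] that \<Delta>_sub by (auto simp: add.assoc)
    have "(\<integral>\<^sup>+y. indicator B (right_coset \<Gamma> (O.s y + (- h, 0) + (0, g2))) \<partial>\<sigma>o) = emeasure (\<kappa> g2) B"
      unfolding emeasure_\<kappa>[OF assms(2)] using inv k
      by (intro nn_integral_\<sigma>o_translate[where \<phi> = "\<lambda>x. indicator B (right_coset \<Gamma> (x + (0, g2)))"]) auto
    then show "indicator L (- (h + g1)) * (\<integral>\<^sup>+y. indicator B (right_coset \<Gamma> (O.s y + (- h, g2))) \<partial>\<sigma>o) =
        indicator L (- (h + g1)) * emeasure (\<kappa> g2) B"
      by (simp add: add.assoc)
  qed
  also have "\<dots> = (\<integral>\<^sup>+h. indicator L (- (h + g1)) * emeasure (\<kappa> g2) B \<partial>A.mb)"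
    by (rule A.nn_integral_mb[symmetric]) measurable
  also have "\<dots> = (\<integral>\<^sup>+h. indicator L (- (h + g1)) \<partial>A.mb) * emeasure (\<kappa> g2) B"
    by (rule nn_integral_multc) measurable
  finally show ?thesis .
qed

lemma transverse_total:
  assumes [measurable]: "L \<in> sets borel" "B \<in> sets (quot UNIV \<Gamma>)" and L: "\<And>x. - x \<in> L \<longleftrightarrow> x \<in> L"
  shows "(\<integral>\<^sup>+x. (\<integral>\<^sup>+\<gamma>. indicator O.D (\<gamma> + X.s x) * \<Phi> L B (\<gamma> + X.s x) \<partial>count_space \<Gamma>) \<partial>\<mu>) =
    emeasure mG1 L * (ennreal (inverse c) * (\<integral>\<^sup>+g. emeasure (\<kappa> g) B \<partial>\<nu>2))"
proof -
  have "emeasure mG1 L = (\<integral>\<^sup>+g. indicator L (- g) \<partial>mG1)"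
    using L by (simp add: indicator_def cong: if_cong flip: nn_integral_indicator)
  also have "\<dots> = (\<integral>\<^sup>+g1. (\<integral>\<^sup>+h. indicator L (- (h + g1)) \<partial>mH1) \<partial>\<nu>1)"
    by (rule \<nu>1(3)) measurable
  also have "\<dots> = (\<integral>\<^sup>+g1. (\<integral>\<^sup>+h. indicator L (- (h + g1)) \<partial>A.mb) \<partial>\<nu>1)"
    by (intro nn_integral_cong A.nn_integral_mb[symmetric]) measurable
  finally have L_eq: "(\<integral>\<^sup>+g1. (\<integral>\<^sup>+h. indicator L (- (h + g1)) \<partial>A.mb) \<partial>\<nu>1) = emeasure mG1 L" by simp
  have "(\<integral>\<^sup>+x. (\<integral>\<^sup>+\<gamma>. indicator O.D (\<gamma> + X.s x) * \<Phi> L B (\<gamma> + X.s x) \<partial>count_space \<Gamma>) \<partial>\<mu>) =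
      ennreal (inverse c) * (\<integral>\<^sup>+g1. (\<integral>\<^sup>+g2. (\<integral>\<^sup>+y. \<Phi> L B (O.s y + (g1, g2)) \<partial>\<sigma>o) \<partial>\<nu>2) \<partial>\<nu>1)"
    using \<Phi>_invariant[OF assms(1,2)] by (intro unfold_transverse) simp_all
  also have "\<dots> = ennreal (inverse c) *
      (\<integral>\<^sup>+g1. (\<integral>\<^sup>+h. indicator L (- (h + g1)) \<partial>A.mb) * (\<integral>\<^sup>+g2. emeasure (\<kappa> g2) B \<partial>\<nu>2) \<partial>\<nu>1)"
    by (simp add: \<Phi>_average nn_integral_cmult)
  also have "\<dots> = ennreal (inverse c) * (emeasure mG1 L * (\<integral>\<^sup>+g2. emeasure (\<kappa> g2) B \<partial>\<nu>2))"
    by (simp add: nn_integral_multc L_eq)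
  finally show ?thesis by (simp add: mult_ac)
qed

text \<open>
  The hitting set \<open>Y\<^sub>x\<close> is indexed by the points \<open>\<gamma> + X.s x\<close> in the fundamental domain of \<open>\<Delta>\<close>:
  by (L3), two elements of \<open>\<Gamma>\<close> give the same coset of \<open>H\<^sub>1\<close> only if they differ by an element of \<open>\<Delta>\<close>.
\<close>

lemma transverse_sum:
  assumes L: "compact L" "\<And>x. - x \<in> L \<longleftrightarrow> x \<in> L"
    and B [measurable]: "B \<in> sets (quot UNIV \<Gamma>)" and BY: "B \<subseteq> Y" and Y: "Y = right_coset \<Gamma> ` (H1 \<times> W)"
    and x: "x \<in> coset_space UNIV \<Gamma>"
  shows "(\<Sum>\<^sub>\<infinity>q\<in>return_set H1 Y x.
      (\<integral>h. indicator L (- (h + coset_rep q)) * indicator B (coset_act (h + coset_rep q, 0) x) \<partial>mH1)) =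
    enn2real (\<integral>\<^sup>+\<gamma>. indicator O.D (\<gamma> + X.s x) * \<Phi> L B (\<gamma> + X.s x) \<partial>count_space \<Gamma>)"
proof -
  have [measurable]: "L \<in> sets borel" using L(1) by (simp add: compact_imp_closed)
  obtain x1 x2 where z: "X.s x = (x1, x2)" by fastforce
  have x_eq: "x = right_coset \<Gamma> (x1, x2)" using X.s_props(3)[OF x] z by simp
  have act: "coset_act (g, 0) x = right_coset \<Gamma> (x1 - g, x2)" for g
    by (simp add: x_eq coset_act_right_coset)
  define T :: "'a set \<Rightarrow> real" where "T q = (\<integral>h. indicator L (- (h + coset_rep q)) * indicator B (coset_act (h + coset_rep q, 0) x) \<partial>mH1)" for q
  define I where "I = {\<gamma> \<in> \<Gamma>. \<gamma> + (x1, x2) \<in> O.D}"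
  define q where "q \<gamma> = right_coset H1 (fst \<gamma> + x1)" for \<gamma> :: "'a \<times> 'b"
  have act_\<gamma>: "coset_act (h + (fst \<gamma> + x1), 0) x = right_coset \<Gamma> (- h, snd \<gamma> + x2)" if "\<gamma> \<in> \<Gamma>" for h \<gamma>
  proof -
    have "right_coset \<Gamma> (\<gamma> + (x1 - (h + (fst \<gamma> + x1)), x2)) = right_coset \<Gamma> (x1 - (h + (fst \<gamma> + x1)), x2)"
      by (rule right_coset_add_left[OF X.\<Lambda>(1) that])
    moreover have "\<gamma> + (x1 - (h + (fst \<gamma> + x1)), x2) = (- h, snd \<gamma> + x2)"
      by (cases \<gamma>) (simp add: diff_add_eq_diff_diff_swap add_diff_eq)
    ultimately show ?thesis by (simp add: act)
  qed
  have T_q: "T (q \<gamma>) = enn2real (\<Phi> L B (\<gamma> + (x1, x2)))" if \<gamma>: "\<gamma> \<in> \<Gamma>" for \<gamma>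
  proof -
    \<comment> \<open>The chosen representative is known only up to this \<open>k\<close>, which
      right translation on \<open>mH1\<close> removes.\<close>
    obtain k where k: "k \<in> H1" "coset_rep (q \<gamma>) = k + (fst \<gamma> + x1)"
      using coset_rep_obtain[OF A.H(1)] unfolding q_def by metis
    have int: "indicator L (- (h + coset_rep (q \<gamma>))) * indicator B (coset_act (h + coset_rep (q \<gamma>), 0) x) =
      (indicator L (- ((h + k) + (fst \<gamma> + x1))) * indicator B (right_coset \<Gamma> (- (h + k), snd \<gamma> + x2)) :: real)" for h
      using act_\<gamma>[OF \<gamma>, of "h + k"] by (simp add: k add.assoc)
    have [measurable]: "(\<lambda>h. indicator L (- (h + g)) * indicator B (right_coset \<Gamma> (- h, g')) :: real) \<in> borel_measurable borel" for g g'
      by measurable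
    have "T (q \<gamma>) = (\<integral>h. indicator L (- ((h + k) + (fst \<gamma> + x1))) * indicator B (right_coset \<Gamma> (- (h + k), snd \<gamma> + x2)) \<partial>mH1)"
      unfolding T_def int ..
    also have "\<dots> = enn2real (\<integral>\<^sup>+h. ennreal (indicator L (- ((h + k) + (fst \<gamma> + x1))) * indicator B (right_coset \<Gamma> (- (h + k), snd \<gamma> + x2))) \<partial>mH1)"
      by (intro integral_eq_nn_integral A.measurable_from_borel AE_I2) measurable
    also have "(\<integral>\<^sup>+h. ennreal (indicator L (- ((h + k) + (fst \<gamma> + x1))) * indicator B (right_coset \<Gamma> (- (h + k), snd \<gamma> + x2))) \<partial>mH1) =
        (\<integral>\<^sup>+h. ennreal (indicator L (- (h + (fst \<gamma> + x1))) * indicator B (right_coset \<Gamma> (- h, snd \<gamma> + x2))) \<partial>mH1)"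
      by (intro A.nn_integral_right[OF k(1)] A.measurable_from_borel) measurable
    also have "\<dots> = (\<integral>\<^sup>+h. ennreal (indicator L (- (h + (fst \<gamma> + x1))) * indicator B (right_coset \<Gamma> (- h, snd \<gamma> + x2))) \<partial>A.mb)"
      by (intro A.nn_integral_mb[symmetric]) measurable
    also have "\<dots> = \<Phi> L B (\<gamma> + (x1, x2))"
      unfolding \<Phi>_def by (cases \<gamma>) (simp add: ennreal_mult ennreal_indicator)
    finally show ?thesis .
  qed
  \<comment> \<open>Finiteness of each term makes the passage through \<open>enn2real\<close>
    harmless. Only \<open>h\<close> in a translate of the compact symmetric set \<open>L\<close>
    contribute.\<close>
  have \<Phi>_fin: "\<Phi> L B w < \<infinity>" for w
  proof -
    have cpt: "compact ((\<lambda>z. z - fst w) ` L)" using L(1) by (intro compact_continuous_image continuous_intros)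
    have "\<Phi> L B w \<le> (\<integral>\<^sup>+h. indicator ((\<lambda>z. z - fst w) ` L) h \<partial>A.mb)"
      unfolding \<Phi>_def
    proof (intro nn_integral_mono)
      fix h
      show "indicator L (- (h + fst w)) * indicator B (right_coset \<Gamma> (- h, snd w)) \<le> (indicator ((\<lambda>z. z - fst w) ` L) h :: ennreal)"
        using L(2)[of "h + fst w"] by (auto simp: indicator_def intro!: image_eqI[of _ _ "h + fst w"])
    qed
    also have "\<dots> = emeasure mH1 ((\<lambda>z. z - fst w) ` L \<inter> H1)"
      using cpt by (simp add: A.emeasure_mb A.sets_mb compact_imp_closed)
    also have "\<dots> < \<infinity>" by (rule A.emeasure_bounded[OF cpt])
    finally show ?thesis .
  qed
  have inj: "inj_on q I"
  proof
    fix \<gamma> \<gamma>' assume I: "\<gamma> \<in> I" "\<gamma>' \<in> I" and "q \<gamma> = q \<gamma>'"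
    then have "(fst \<gamma> + x1) - (fst \<gamma>' + x1) \<in> H1" unfolding q_def by (simp add: right_coset_eq_iff[OF A.H(1)])
    then have "fst (\<gamma> - \<gamma>') \<in> H1" by (simp add: diff_add_eq_diff_diff_swap add_diff_eq)
    moreover have "\<gamma> - \<gamma>' \<in> \<Gamma>" using I by (auto simp: I_def intro: add_subgroupD[OF X.\<Lambda>(1)])
    moreover obtain d1 d2 where "\<gamma> - \<gamma>' = (d1, d2)" by fastforce
    ultimately have "\<gamma> - \<gamma>' \<in> \<Delta>" using L3[of d1 d2] by (simp add: \<Delta>)
    moreover have "(\<gamma> - \<gamma>') + (\<gamma>' + (x1, x2)) = \<gamma> + (x1, x2)" by (simp add: add.assoc[symmetric])
    ultimately have "\<gamma> - \<gamma>' = 0" using O.D_unique[of "\<gamma>' + (x1, x2)" "\<gamma> - \<gamma>'"] I by (auto simp: I_def)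
    then show "\<gamma> = \<gamma>'" by simp
  qed
  have sub: "return_set H1 Y x \<subseteq> q ` I"
  proof
    fix c' assume "c' \<in> return_set H1 Y x"
    then obtain g where g: "c' = right_coset H1 g" "coset_act (g, 0) x \<in> Y" by (auto simp: return_set_def)
    then obtain h w where hw: "h \<in> H1" "right_coset \<Gamma> (x1 - g, x2) = right_coset \<Gamma> (h, w)"
      by (auto simp: act Y)
    then have "(h, w) - (x1 - g, x2) \<in> \<Gamma>" by (metis right_coset_eq_iff[OF X.\<Lambda>(1)])
    moreover define \<gamma> where "\<gamma> = (h, w) - (x1 - g, x2)"
    ultimately have \<gamma>: "\<gamma> \<in> \<Gamma>" by simp
    have f\<gamma>: "fst \<gamma> + x1 = h + g" by (simp add: \<gamma>_def algebra_simps)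
    \<comment> \<open>Moving \<gamma> into the domain changes \<open>fst \<gamma> + x1\<close> by an
      element of \<open>H1\<close> on the left, so the coset stays the same.\<close>
    obtain \<delta> where \<delta>: "\<delta> \<in> \<Delta>" "\<delta> + (\<gamma> + (x1, x2)) \<in> O.D" using O.D_ex by blast
    have "\<delta> + \<gamma> \<in> I" using \<delta> \<gamma> \<Delta>_sub by (auto simp: I_def add.assoc intro!: add_subgroupD(2)[OF X.\<Lambda>(1)])
    moreover have "q (\<delta> + \<gamma>) = right_coset H1 (fst \<delta> + (h + g))" by (simp add: q_def add.assoc f\<gamma>)
    then have "q (\<delta> + \<gamma>) = c'"
      using \<delta>(1) \<Delta>_sub hw(1) g(1) right_coset_add_left[OF A.H(1)] by auto
    ultimately show "c' \<in> q ` I" by blast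
  qed
  \<comment> \<open>The index set \<open>I\<close> may also yield cosets outside the return set;
    along these the orbit misses \<open>Y\<close>, hence \<open>B\<close>.\<close>
  have zero: "\<Phi> L B (\<gamma> + (x1, x2)) = 0" if \<gamma>: "\<gamma> \<in> I" "q \<gamma> \<notin> return_set H1 Y x" for \<gamma>
  proof -
    have "right_coset \<Gamma> (- h, snd \<gamma> + x2) \<notin> B" if h: "h \<in> H1" for h
    proof
      assume "right_coset \<Gamma> (- h, snd \<gamma> + x2) \<in> B"
      then have "coset_act (h + (fst \<gamma> + x1), 0) x \<in> Y" using BY act_\<gamma>[of \<gamma> h] \<gamma>(1) by (auto simp: I_def)
      then have "right_coset H1 (h + (fst \<gamma> + x1)) \<in> return_set H1 Y x" unfolding return_set_def by blast
      then show False using \<gamma>(2) right_coset_add_left[OF A.H(1) h] by (simp add: q_def)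
    qed
    then have "(\<integral>\<^sup>+h. indicator L (- (h + fst (\<gamma> + (x1, x2)))) * indicator B (right_coset \<Gamma> (- h, snd (\<gamma> + (x1, x2)))) \<partial>mH1) = (\<integral>\<^sup>+h. 0 \<partial>mH1)"
      by (intro nn_integral_cong) (simp add: A.space_m)
    then show ?thesis unfolding \<Phi>_def by (subst A.nn_integral_mb) simp_all
  qed
  have "(\<Sum>\<^sub>\<infinity>c'\<in>return_set H1 Y x. T c') = (\<Sum>\<^sub>\<infinity>c'\<in>q ` I. T c')"
    using sub zero T_q by (intro infsum_cong_neutral) (auto simp: I_def)
  also have "\<dots> = (\<Sum>\<^sub>\<infinity>\<gamma>\<in>I. T (q \<gamma>))"
    using infsum_reindex[OF inj, of T] by (simp add: o_def)
  also have "\<dots> = (\<Sum>\<^sub>\<infinity>\<gamma>\<in>\<Gamma>. enn2real (indicator O.D (\<gamma> + (x1, x2)) * \<Phi> L B (\<gamma> + (x1, x2))))"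
    by (intro infsum_cong_neutral) (auto simp: I_def T_q indicator_def)
  also have "\<dots> = enn2real (\<integral>\<^sup>+\<gamma>. ennreal (enn2real (indicator O.D (\<gamma> + (x1, x2)) * \<Phi> L B (\<gamma> + (x1, x2)))) \<partial>count_space \<Gamma>)"
    by (intro infsum_eq_enn2real_nn_integral) simp
  also have "(\<integral>\<^sup>+\<gamma>. ennreal (enn2real (indicator O.D (\<gamma> + (x1, x2)) * \<Phi> L B (\<gamma> + (x1, x2)))) \<partial>count_space \<Gamma>) =
      (\<integral>\<^sup>+\<gamma>. indicator O.D (\<gamma> + (x1, x2)) * \<Phi> L B (\<gamma> + (x1, x2)) \<partial>count_space \<Gamma>)"
    using \<Phi>_fin by (intro nn_integral_cong ennreal_enn2real) (simp add: indicator_def)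
  finally show ?thesis unfolding T_def z .
qed

end

lemma right_coset_coset_rep:
  fixes L :: "'g::group_add set"
  assumes "add_subgroup L" "q \<in> coset_space K L"
  shows "right_coset L (coset_rep q) = q"
proof -
  obtain k where "q = right_coset L k" using assms(2) by (auto simp: coset_space_def)
  then show ?thesis using coset_rep_diff[OF assms(1), of k] by (simp add: right_coset_eq_iff[OF assms(1)])
qed

section \<open>The transverse measure in terms of translates, and their position relative to
  \<open>Y\<close>\<close>

context cut_and_project
begin

text \<open>Both sides of the transverse formula acquire the factor \<open>measure mG1 L\<close>,
  which is positive and finite and cancels. The assumption \<open>fin\<close> ensures that no
  real-valued integral falls back to its default value.\<close>

lemma transverse_measure_formula:
  assumes Y: "Y = right_coset \<Gamma> ` (H1 \<times> W)" "Y \<in> sets (quot UNIV \<Gamma>)"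
    and \<sigma>: "transverse_measure \<Gamma> H1 mG1 mH1 \<mu> Y \<sigma>"
    and B [measurable]: "B \<in> sets (quot UNIV \<Gamma>)" and BY: "B \<subseteq> Y"
    and fin: "(\<integral>\<^sup>+g. emeasure (\<kappa> g) B \<partial>\<nu>2) < \<infinity>"
  shows "emeasure \<sigma> B = ennreal (inverse c) * (\<integral>\<^sup>+g. emeasure (\<kappa> g) B \<partial>\<nu>2)"
proof -
  obtain L where L: "compact L" "\<And>x. - x \<in> L \<longleftrightarrow> x \<in> L" and mL: "emeasure mG1 L \<noteq> 0" "emeasure mG1 L < \<infinity>"
    using G1.exists_symmetric_compact by simp metis
  have Lb [measurable]: "L \<in> sets borel" using L(1) by (simp add: compact_imp_closed)
  have sets_\<sigma>: "sets \<sigma> = sets (restrict_space (quot UNIV \<Gamma>) Y)" and "finite_measure \<sigma>"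
    using \<sigma> by (simp_all add: transverse_measure_def)
  interpret \<sigma>: finite_measure \<sigma> by fact
  have space_\<sigma>: "space \<sigma> = Y"
    using sets_eq_imp_space_eq[OF sets_\<sigma>] sets.sets_into_space[OF Y(2)] by (auto simp: space_restrict_space)
  have B\<sigma>: "B \<in> sets \<sigma>" using B BY by (auto simp: sets_\<sigma> sets_restrict_space)
  define R where "R = ennreal (inverse c) * (\<integral>\<^sup>+g. emeasure (\<kappa> g) B \<partial>\<nu>2)"
  have R: "R < \<infinity>" using fin by (simp add: R_def ennreal_mult_less_top)
  define F :: "'a \<times> ('a \<times> 'b) set \<Rightarrow> real" where "F p = indicator L (fst p) * indicator B (snd p)" for p
  have "F \<in> borel_measurable (borel \<Otimes>\<^sub>M restrict_space (quot UNIV \<Gamma>) Y)"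
    unfolding F_def[abs_def]
    by (intro borel_measurable_times measurable_compose[OF measurable_fst] measurable_compose[OF measurable_snd]
        borel_measurable_indicator Lb measurable_restrict_space1 B)
  moreover have "bounded (F ` (UNIV \<times> Y))"
    by (intro boundedI[of _ 1]) (auto simp: F_def indicator_def)
  moreover have "\<exists>L. compact L \<and> (\<forall>g y. g \<notin> L \<and> y \<in> Y \<longrightarrow> F (g, y) = 0)"
    using L(1) by (intro exI[of _ L]) (simp add: F_def)
  ultimately have eq: "(\<integral>x. (\<Sum>\<^sub>\<infinity>q\<in>return_set H1 Y x.
            (\<integral>h. F (- (h + coset_rep q), coset_act (h + coset_rep q, 0) x) \<partial>mH1)) \<partial>\<mu>)
        = (\<integral>g. (\<integral>y. F (g, y) \<partial>\<sigma>) \<partial>mG1)"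
    using \<sigma> unfolding transverse_measure_def by (elim conjE) simp
  define \<Psi> where "\<Psi> x = (\<integral>\<^sup>+\<gamma>. indicator O.D (\<gamma> + X.s x) * \<Phi> L B (\<gamma> + X.s x) \<partial>count_space \<Gamma>)" for x
  have \<Psi> [measurable]: "\<Psi> \<in> borel_measurable \<mu>" unfolding \<Psi>_def[abs_def] by measurable
  have total: "(\<integral>\<^sup>+x. \<Psi> x \<partial>\<mu>) = emeasure mG1 L * R"
    unfolding \<Psi>_def R_def by (rule transverse_total[OF Lb B L(2)])
  \<comment> \<open>Where \<Psi> is infinite, the sum in the formula counts as 0; a finite total
    confines this to a null set.\<close>
  have "(\<integral>\<^sup>+x. \<Psi> x \<partial>\<mu>) \<noteq> \<infinity>" using total mL R by (simp add: ennreal_mult_eq_top_iff less_top)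
  then have "AE x in \<mu>. \<Psi> x \<noteq> \<infinity>" by (rule nn_integral_PInf_AE[OF \<Psi>])
  then have ae: "AE x in \<mu>. ennreal (enn2real (\<Psi> x)) = \<Psi> x"
    by eventually_elim (simp add: less_top)
  have "(\<integral>g. (\<integral>y. F (g, y) \<partial>\<sigma>) \<partial>mG1) = (\<integral>g. indicator L g * measure \<sigma> B \<partial>mG1)"
    using B\<sigma> by (simp add: F_def sets.Int_space_eq2)
  also have "\<dots> = measure mG1 L * measure \<sigma> B"
    using sets.sets_into_space[of L mG1] by (simp add: G1.space_m sets_G)
  finally have rhs: "(\<integral>g. (\<integral>y. F (g, y) \<partial>\<sigma>) \<partial>mG1) = measure mG1 L * measure \<sigma> B" .
  have "(\<integral>g. (\<integral>y. F (g, y) \<partial>\<sigma>) \<partial>mG1) = (\<integral>x. enn2real (\<Psi> x) \<partial>\<mu>)"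
    unfolding eq[symmetric] using transverse_sum[OF L B BY Y(1)]
    by (intro Bochner_Integration.integral_cong refl) (simp add: F_def \<Psi>_def space_\<mu>)
  also have "\<dots> = enn2real (\<integral>\<^sup>+x. ennreal (enn2real (\<Psi> x)) \<partial>\<mu>)"
    by (intro integral_eq_nn_integral) auto
  also have "\<dots> = enn2real (emeasure mG1 L * R)"
    using nn_integral_cong_AE[OF ae] total by simp
  also have "\<dots> = measure mG1 L * enn2real R"
    by (simp add: enn2real_mult measure_def)
  finally have "measure mG1 L * measure \<sigma> B = measure mG1 L * enn2real R" unfolding rhs .
  moreover have "measure mG1 L \<noteq> 0"
    using mL by (simp add: measure_def enn2real_eq_0_iff)
  ultimately have "measure \<sigma> B = enn2real R" by simp
  then show ?thesis using R by (simp add: \<sigma>.emeasure_eq_measure R_def)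
qed

text \<open>A point of the translate lying in \<open>B\<close> is also the coset of some
  \<open>(h, w)\<close>. The lattice element relating the two representatives has first coordinate
  in \<open>H1\<close>, so (L3) puts the second in \<open>H2\<close>, and \<open>w\<close> lies in
  the coset of \<open>g\<close>.\<close>

lemma \<kappa>_outside:
  assumes Y: "Y = right_coset \<Gamma> ` (H1 \<times> W)" and B: "B \<in> sets (quot UNIV \<Gamma>)" "B \<subseteq> Y"
    and g: "right_coset H2 g \<notin> right_coset H2 ` W"
  shows "emeasure (\<kappa> g) B = 0"
proof -
  have "right_coset \<Gamma> (O.s y + (0, g)) \<notin> B" if y: "y \<in> space \<sigma>o" for y
  proof
    assume "right_coset \<Gamma> (O.s y + (0, g)) \<in> B"
    moreover obtain a b where ab: "O.s y = (a, b)" "a \<in> H1" "b \<in> H2"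
      using O.s_props(2)[of y] y by (auto simp: space_\<sigma>o)
    ultimately obtain h w where hw: "h \<in> H1" "w \<in> W" "right_coset \<Gamma> (h, w) = right_coset \<Gamma> (a, b + g)"
      using B(2) Y by force
    then have "(h - a, w - (b + g)) \<in> \<Gamma>" by (simp add: right_coset_eq_iff[OF X.\<Lambda>(1)])
    moreover have "h - a \<in> H1" using hw ab by (intro add_subgroupD[OF A.H(1)])
    ultimately have "w - (b + g) \<in> H2" by (rule L3)
    from add_subgroupD(2)[OF B.H(1) this ab(3)] have "w - g \<in> H2"
      by (simp add: diff_add_eq_diff_diff_swap)
    then have "right_coset H2 g = right_coset H2 w" by (metis right_coset_eq_iff[OF B.H(1)])
    then show False using g hw by blast
  qed
  then have "(\<integral>\<^sup>+y. indicator B (right_coset \<Gamma> (O.s y + (0, g))) \<partial>\<sigma>o) = (\<integral>\<^sup>+y. 0 \<partial>\<sigma>o)"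
    by (intro nn_integral_cong) simp
  then show ?thesis by (simp add: emeasure_\<kappa>[OF B(1)])
qed

text \<open>Density of the projection of \<open>\<Delta>\<close> moves any point of the coset \<open>H\<^sub>2 g\<close> into the open set \<open>interior W\<close>.\<close>

lemma \<kappa>_inside:
  assumes Y: "Y = right_coset \<Gamma> ` (H1 \<times> W)" "Y \<in> sets (quot UNIV \<Gamma>)"
    and g: "right_coset H2 g \<in> right_coset H2 ` interior W"
  shows "emeasure (\<kappa> g) (coset_space UNIV \<Gamma> - Y) = 0"
proof -
  obtain v where v: "v \<in> interior W" "g - v \<in> H2"
    using g by (auto simp: right_coset_eq_iff[OF B.H(1)])
  have "right_coset \<Gamma> (O.s y + (0, g)) \<in> Y" if y: "y \<in> space \<sigma>o" for y
  proof -
    obtain a b where ab: "O.s y = (a, b)" "a \<in> H1" "b \<in> H2"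
      using O.s_props(2)[of y] y by (auto simp: space_\<sigma>o)
    \<comment> \<open>The second coordinate is \<open>b + g = k + v\<close> with
      \<open>k \<in> H2\<close>. An element of \<Delta> whose second coordinate is near
      \<open>- k\<close> brings it near the interior point \<open>v\<close>.\<close>
    define k where "k = b + (g - v)"
    have "k \<in> H2" unfolding k_def using ab(3) v(2) by (rule add_subgroupD(2)[OF B.H(1)])
    then have "- k \<in> closure (snd ` \<Delta>)" using dense_\<Delta> B.H(1) by (simp add: add_subgroupD)
    moreover have "open ((\<lambda>z. z + (k + v)) -` interior W)"
      by (intro open_vimage continuous_intros) simp
    moreover have "- k \<in> (\<lambda>z. z + (k + v)) -` interior W" using v(1) by (simp add: add.assoc[symmetric])
    ultimately obtain z where "z \<in> snd ` \<Delta>" "z + (k + v) \<in> interior W"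
      unfolding closure_iff_nhds_not_empty by blast
    then obtain \<delta> where \<delta>: "\<delta> \<in> \<Delta>" "snd \<delta> + (k + v) \<in> W" using interior_subset by auto
    have "k + v = b + g" by (simp add: k_def add.assoc)
    then have "\<delta> + (O.s y + (0, g)) = (fst \<delta> + a, snd \<delta> + (k + v))" by (cases \<delta>) (simp add: ab)
    moreover have "fst \<delta> + a \<in> H1" using \<delta>(1) \<Delta>_sub ab(2) by (intro add_subgroupD[OF A.H(1)]) auto
    moreover have "right_coset \<Gamma> (\<delta> + (O.s y + (0, g))) = right_coset \<Gamma> (O.s y + (0, g))"
      using \<delta>(1) \<Delta>_sub by (intro right_coset_add_left[OF X.\<Lambda>(1)]) auto
    ultimately show ?thesis using \<delta>(2) unfolding Y(1) by (metis SigmaI imageI)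
  qed
  then have "(\<integral>\<^sup>+y. indicator (coset_space UNIV \<Gamma> - Y) (right_coset \<Gamma> (O.s y + (0, g))) \<partial>\<sigma>o) = (\<integral>\<^sup>+y. 0 \<partial>\<sigma>o)"
    by (intro nn_integral_cong) simp
  moreover have "coset_space UNIV \<Gamma> - Y \<in> sets (quot UNIV \<Gamma>)"
    using sets.compl_sets[OF Y(2)] by simp
  ultimately show ?thesis by (simp add: emeasure_\<kappa>)
qed

section \<open>The explicit measure attached to the window\<close>

definition saturated_interior :: "'b set \<Rightarrow> 'b set" where
  "saturated_interior W = {g. right_coset H2 g \<in> right_coset H2 ` interior W}"

lemma saturated_interior_borel [measurable]: "saturated_interior W \<in> sets borel"
proof -
  have "openin (coset_topology UNIV H2) (right_coset H2 ` interior W)"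
    using openin_right_coset_image[of UNIV H2 "interior W"] B.H(1) G2.H(1) by simp
  from measurable_sets[OF measurable_right_coset_UNIV openin_in_borel_of[OF this]]
  show ?thesis by (simp add: saturated_interior_def vimage_def)
qed

lemma saturated_interior_invariant: "h \<in> H2 \<Longrightarrow> h + g \<in> saturated_interior W \<longleftrightarrow> g \<in> saturated_interior W"
  by (simp add: saturated_interior_def right_coset_add_left[OF B.H(1)])

text \<open>\<eta> is given through functions of compact support; this is the corresponding average
  of the \<kappa> as an image measure, which can be evaluated on sets. The saturated interior serves
  as window because it is Borel in the group.\<close>

definition limit_measure :: "'b set \<Rightarrow> ('a \<times> 'b) set measure" where
  "limit_measure W = scale_measure (ennreal (inverse c))
     (distr (density \<nu>2 (indicator (saturated_interior W)) \<Otimes>\<^sub>M \<sigma>o) (quot UNIV \<Gamma>) (\<lambda>p. right_coset \<Gamma> (O.s (snd p) + (0, fst p))))"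

lemma sets_limit: "sets (limit_measure W) = sets (quot UNIV \<Gamma>)"
  by (simp add: limit_measure_def)

lemma nn_integral_limit:
  assumes [measurable]: "f \<in> borel_measurable (quot UNIV \<Gamma>)"
  shows "(\<integral>\<^sup>+x. f x \<partial>limit_measure W) =
    ennreal (inverse c) * (\<integral>\<^sup>+g. indicator (saturated_interior W) g * (\<integral>\<^sup>+x. f x \<partial>\<kappa> g) \<partial>\<nu>2)"
proof -
  let ?N = "density \<nu>2 (indicator (saturated_interior W))"
  have map: "(\<lambda>p. right_coset \<Gamma> (O.s (snd p) + (0, fst p))) \<in> measurable (?N \<Otimes>\<^sub>M \<sigma>o) (quot UNIV \<Gamma>)"
    by measurable
  have "(\<integral>\<^sup>+x. f x \<partial>limit_measure W) =
      ennreal (inverse c) * (\<integral>\<^sup>+p. f (right_coset \<Gamma> (O.s (snd p) + (0, fst p))) \<partial>(?N \<Otimes>\<^sub>M \<sigma>o))"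
    using map by (simp add: limit_measure_def nn_integral_scale_measure nn_integral_distr)
  also have "(\<integral>\<^sup>+p. f (right_coset \<Gamma> (O.s (snd p) + (0, fst p))) \<partial>(?N \<Otimes>\<^sub>M \<sigma>o)) =
      (\<integral>\<^sup>+g. (\<integral>\<^sup>+y. f (right_coset \<Gamma> (O.s y + (0, g))) \<partial>\<sigma>o) \<partial>?N)"
    by (subst o.nn_integral_fst[symmetric]) (use measurable_compose[OF map assms] in simp_all)
  also have "\<dots> = (\<integral>\<^sup>+g. indicator (saturated_interior W) g * (\<integral>\<^sup>+y. f (right_coset \<Gamma> (O.s y + (0, g))) \<partial>\<sigma>o) \<partial>\<nu>2)"
    by (rule nn_integral_density) measurable
  finally show ?thesis by (simp add: nn_integral_\<kappa>)
qed

lemma emeasure_limit: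
  assumes B: "B \<in> sets (quot UNIV \<Gamma>)"
  shows "emeasure (limit_measure W) B = ennreal (inverse c) * (\<integral>\<^sup>+g. indicator (saturated_interior W) g * emeasure (\<kappa> g) B \<partial>\<nu>2)"
  using nn_integral_limit[of "indicator B" W] B by (simp add: sets_limit sets_\<kappa>)

text \<open>\<open>mQ2\<close> is the image of \<nu>2: the indicator of a set of cosets pulls back
  to an \<open>H2\<close>-invariant function on the group.\<close>

lemma nn_integral_\<nu>2_quotient:
  assumes mQ2: "sets mQ2 = sets (quot UNIV H2)" and A: "A \<in> sets mQ2"
  shows "(\<integral>\<^sup>+g. indicator A (right_coset H2 g) \<partial>\<nu>2) = emeasure mQ2 A"
proof -
  have A': "A \<in> sets (quot UNIV H2)" using A mQ2 by simp
  have "(\<integral>\<^sup>+g. indicator A (right_coset H2 g) \<partial>\<nu>2) = (\<integral>\<^sup>+q. indicator A (right_coset H2 (coset_rep q)) \<partial>mQ2)"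
    using A' right_coset_add_left[OF B.H(1)]
    by (intro \<nu>2(4)[symmetric]) (auto intro!: measurable_compose[OF measurable_right_coset_UNIV])
  also have "\<dots> = (\<integral>\<^sup>+q. indicator A q \<partial>mQ2)"
    using sets_eq_imp_space_eq[OF mQ2] right_coset_coset_rep[OF B.H(1)] by (intro nn_integral_cong) simp
  finally show ?thesis using A by simp
qed

text \<open>A null set of the completion is covered by a null set \<open>N\<close> of
  \<open>mQ2\<close> itself, and the preimage of \<open>N\<close> in the group is
  \<nu>2-null.\<close>

lemma AE_window:
  assumes mQ2: "sets mQ2 = sets (quot UNIV H2)" and W: "essentially_open_projection H2 mQ2 W"
  shows "AE g in \<nu>2. right_coset H2 g \<in> right_coset H2 ` W \<longrightarrow> g \<in> saturated_interior W"
proof -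
  obtain N where N: "N \<in> null_sets mQ2" "right_coset H2 ` W - right_coset H2 ` interior W \<subseteq> N"
    using W unfolding essentially_open_projection_def null_sets_completion_iff2 by blast
  have [measurable]: "N \<in> sets (quot UNIV H2)" using N(1) mQ2 by auto
  have "(\<integral>\<^sup>+g. indicator N (right_coset H2 g) \<partial>\<nu>2) = 0"
    using nn_integral_\<nu>2_quotient[OF mQ2, of N] N(1) by (auto simp: null_sets_def)
  moreover have "(\<lambda>g. indicator N (right_coset H2 g) :: ennreal) \<in> borel_measurable \<nu>2" by measurable
  ultimately have "AE g in \<nu>2. indicator N (right_coset H2 g) = (0 :: ennreal)"
    using nn_integral_0_iff_AE by blast
  then show ?thesis by eventually_elim (use N(2) in \<open>auto simp: saturated_interior_def indicator_def split: if_splits\<close>)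
qed

text \<open>A coset off the saturated interior either misses \<open>W\<close>, where
  \<open>\<kappa>_outside\<close> gives 0, or belongs to the null set of \<open>AE_window\<close>.
  Hence the cutoff does not change the integral.\<close>

lemma emeasure_limit_subset:
  assumes mQ2: "sets mQ2 = sets (quot UNIV H2)" and W: "essentially_open_projection H2 mQ2 W"
    and Y: "Y = right_coset \<Gamma> ` (H1 \<times> W)" and B: "B \<in> sets (quot UNIV \<Gamma>)" "B \<subseteq> Y"
  shows "emeasure (limit_measure W) B = ennreal (inverse c) * (\<integral>\<^sup>+g. emeasure (\<kappa> g) B \<partial>\<nu>2)"
proof -
  have "AE g in \<nu>2. indicator (saturated_interior W) g * emeasure (\<kappa> g) B = emeasure (\<kappa> g) B"
    using AE_window[OF mQ2 W] by eventually_elim (use \<kappa>_outside[OF Y B] in \<open>auto simp: indicator_def\<close>)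
  from nn_integral_cong_AE[OF this] show ?thesis by (simp add: emeasure_limit[OF B(1)])
qed

lemma emeasure_limit_complement:
  assumes Y: "Y = right_coset \<Gamma> ` (H1 \<times> W)" "Y \<in> sets (quot UNIV \<Gamma>)"
  shows "emeasure (limit_measure W) (coset_space UNIV \<Gamma> - Y) = 0"
proof -
  have "(\<integral>\<^sup>+g. indicator (saturated_interior W) g * emeasure (\<kappa> g) (coset_space UNIV \<Gamma> - Y) \<partial>\<nu>2) = (\<integral>\<^sup>+g. 0 \<partial>\<nu>2)"
    using \<kappa>_inside[OF Y] by (intro nn_integral_cong) (simp add: saturated_interior_def indicator_def)
  moreover have "coset_space UNIV \<Gamma> - Y \<in> sets (quot UNIV \<Gamma>)"
    using sets.compl_sets[OF Y(2)] by simp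
  ultimately show ?thesis by (simp add: emeasure_limit)
qed

lemma emeasure_limit_space:
  assumes mQ2: "sets mQ2 = sets (quot UNIV H2)"
  shows "emeasure (limit_measure W) (coset_space UNIV \<Gamma>) =
    ennreal (inverse c) * emeasure mQ2 (right_coset H2 ` interior W)"
proof -
  have "openin (coset_topology UNIV H2) (right_coset H2 ` interior W)"
    using openin_right_coset_image[of UNIV H2 "interior W"] B.H(1) G2.H(1) by simp
  then have "right_coset H2 ` interior W \<in> sets mQ2" using mQ2 openin_in_borel_of by auto
  from nn_integral_\<nu>2_quotient[OF mQ2 this]
  have "(\<integral>\<^sup>+g. indicator (saturated_interior W) g \<partial>\<nu>2) = emeasure mQ2 (right_coset H2 ` interior W)"
    by (simp add: saturated_interior_def indicator_def)
  moreover have "emeasure (\<kappa> g) (coset_space UNIV \<Gamma>) = 1" for g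
    using prob_space.emeasure_space_1[OF prob_space_\<kappa>, of g] by (simp add: \<kappa>_def)
  moreover have "coset_space UNIV \<Gamma> \<in> sets (quot UNIV \<Gamma>)"
    using sets.top[of "quot UNIV \<Gamma>"] by simp
  ultimately show ?thesis by (simp add: emeasure_limit)
qed

lemma finite_limit:
  assumes mQ2: "sets mQ2 = sets (quot UNIV H2)"
    and fin: "\<And>C. compactin (coset_topology UNIV H2) C \<Longrightarrow> emeasure mQ2 C < \<infinity>"
    and W: "compact (closure W)"
  shows "emeasure mQ2 (right_coset H2 ` interior W) < \<infinity>" "finite_measure (limit_measure W)"
proof -
  have cpt: "compactin (coset_topology UNIV H2) (right_coset H2 ` closure W)"
    by (rule compactin_right_coset_image[OF W])
  \<comment> \<open>Compact sets in the Hausdorff quotient are closed, hence Borel, and monotonicity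
    of \<open>emeasure\<close> needs the larger set to be measurable.\<close>
  then have "closedin (coset_topology UNIV H2) (right_coset H2 ` closure W)"
    using Hausdorff_coset_topology[OF B.H(1,2)] by (intro compactin_imp_closedin)
  then have "coset_space UNIV H2 - (coset_space UNIV H2 - right_coset H2 ` closure W) \<in> sets (quot UNIV H2)"
    using sets.compl_sets[OF openin_in_borel_of] by (fastforce simp: closedin_def topspace_coset_topology)
  moreover have "right_coset H2 ` closure W \<subseteq> coset_space UNIV H2" by (auto simp: coset_space_def)
  ultimately have "right_coset H2 ` closure W \<in> sets mQ2" using mQ2 by (simp add: double_diff)
  then have "emeasure mQ2 (right_coset H2 ` interior W) \<le> emeasure mQ2 (right_coset H2 ` closure W)"
    using interior_subset closure_subset by (intro emeasure_mono image_mono) auto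
  also have "\<dots> < \<infinity>" by (rule fin[OF cpt])
  finally show fin': "emeasure mQ2 (right_coset H2 ` interior W) < \<infinity>" .
  show "finite_measure (limit_measure W)"
  proof
    have "space (limit_measure W) = coset_space UNIV \<Gamma>"
      using sets_eq_imp_space_eq[OF sets_limit] by simp
    then show "emeasure (limit_measure W) (space (limit_measure W)) \<noteq> \<infinity>"
      using fin' by (simp add: emeasure_limit_space[OF mQ2] ennreal_mult_eq_top_iff less_top)
  qed
qed

section \<open>Identification of \<eta> with the explicit measure\<close>

lemma continuous_integral_\<kappa>:
  assumes f: "continuous_map (coset_topology UNIV \<Gamma>) euclideanreal f"
    and f01: "\<And>x. x \<in> coset_space UNIV \<Gamma> \<Longrightarrow> 0 \<le> f x \<and> f x \<le> 1"
  shows "continuous_on UNIV (\<lambda>g. \<integral>x. f x \<partial>\<kappa> g)"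
proof -
  have f_meas [measurable]: "f \<in> borel_measurable (quot UNIV \<Gamma>)" by (rule borel_measurable_continuous_map[OF f])
  have map: "(\<lambda>y. right_coset \<Gamma> (O.s y + (0, g))) \<in> measurable \<sigma>o (quot UNIV \<Gamma>)" for g by measurable
  have eq: "(\<integral>x. f x \<partial>\<kappa> g) = (\<integral>y. f (right_coset \<Gamma> (O.s y + (0, g))) \<partial>\<sigma>o)" for g
    unfolding \<kappa>_def by (rule integral_distr[OF map f_meas])
  have "continuous_map euclidean euclideanreal (f \<circ> right_coset \<Gamma>)"
    by (rule continuous_map_compose[OF continuous_map_right_coset f])
  then have fc: "continuous_on UNIV (\<lambda>z. f (right_coset \<Gamma> z))" by (simp add: o_def)
  have "isCont (\<lambda>g. \<integral>y. f (right_coset \<Gamma> (O.s y + (0, g))) \<partial>\<sigma>o) g" for g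
  \<comment> \<open>Sequences suffice in a second countable group, and along a sequence the bound 1
    on \<open>f\<close> permits dominated convergence.\<close>
  proof (rule continuous_at_sequentiallyI)
    fix u assume u: "u \<longlonglongrightarrow> g"
    show "(\<lambda>n. \<integral>y. f (right_coset \<Gamma> (O.s y + (0, u n))) \<partial>\<sigma>o) \<longlonglongrightarrow> (\<integral>y. f (right_coset \<Gamma> (O.s y + (0, g))) \<partial>\<sigma>o)"
    proof (rule integral_dominated_convergence[where w = "\<lambda>_. 1"])
      show "AE y in \<sigma>o. (\<lambda>n. f (right_coset \<Gamma> (O.s y + (0, u n)))) \<longlonglongrightarrow> f (right_coset \<Gamma> (O.s y + (0, g)))"
      proof (rule AE_I2)
        fix y
        have "(\<lambda>n. O.s y + (0, u n)) \<longlonglongrightarrow> O.s y + (0, g)" by (intro tendsto_intros u)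
        from continuous_on_tendsto_compose[OF fc this]
        show "(\<lambda>n. f (right_coset \<Gamma> (O.s y + (0, u n)))) \<longlonglongrightarrow> f (right_coset \<Gamma> (O.s y + (0, g)))" by simp
      qed
      show "AE y in \<sigma>o. norm (f (right_coset \<Gamma> (O.s y + (0, u n)))) \<le> 1" for n
        using f01 by (intro AE_I2) (simp add: right_coset_in_coset_space)
    qed (auto intro: measurable_compose[OF map f_meas])
  qed
  then show ?thesis by (simp add: eq continuous_on_eq_continuous_at)
qed

text \<open>For test functions with values in [0, 1], the integral against \<kappa> is continuous
  and \<open>H2\<close>-invariant in \<open>g\<close>, hence descends to a Borel function of the
  coset. The clause linking \<nu>2 and \<open>mQ2\<close> then carries the coset integral to the
  group.\<close>

lemma limit_measure_unique:
  assumes mQ2: "sets mQ2 = sets (quot UNIV H2)"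
    and fin: "\<And>C. compactin (coset_topology UNIV H2) C \<Longrightarrow> emeasure mQ2 C < \<infinity>"
    and W: "compact (closure W)" "essentially_open_projection H2 mQ2 W"
    and \<eta>: "sets \<eta> = sets (quot UNIV \<Gamma>)" "finite_measure \<eta>"
    and \<eta>_int: "\<And>f. compactly_supported_continuous (coset_topology UNIV \<Gamma>) f \<Longrightarrow>
      (\<integral>x. f x \<partial>\<eta>) = 1 / c * (LINT q:right_coset H2 ` W|completion mQ2. (\<integral>x. f x \<partial>\<kappa> (coset_rep q)))"
  shows "\<eta> = limit_measure W"
proof (rule finite_borel_measure_eqI_compactly_supported[OF X.quotient_topology(2,1)[OF refl]
      X.quotient_topology(3)[OF refl] \<eta> sets_limit finite_limit(2)[OF mQ2 fin W(1)]])
  fix f assume f: "compactly_supported_continuous (coset_topology UNIV \<Gamma>) f"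
    and "\<And>x. x \<in> topspace (coset_topology UNIV \<Gamma>) \<Longrightarrow> 0 \<le> f x \<and> f x \<le> 1"
  then have f01: "\<And>x. x \<in> coset_space UNIV \<Gamma> \<Longrightarrow> 0 \<le> f x \<and> f x \<le> 1" by (simp add: topspace_coset_topology)
  have fc: "continuous_map (coset_topology UNIV \<Gamma>) euclideanreal f"
    using f by (simp add: compactly_supported_continuous_def)
  have f_meas [measurable]: "f \<in> borel_measurable (quot UNIV \<Gamma>)" by (rule borel_measurable_continuous_map[OF fc])
  define S where "S g = (\<integral>x. f x \<partial>\<kappa> g)" for g
  have space_\<kappa>: "space (\<kappa> g) = coset_space UNIV \<Gamma>" for g by (simp add: \<kappa>_def)
  have S0: "0 \<le> S g" for g unfolding S_def using f01 by (intro integral_nonneg_AE AE_I2) (simp add: space_\<kappa>)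
  have S_cont: "continuous_on UNIV S" unfolding S_def[abs_def] by (rule continuous_integral_\<kappa>[OF fc f01])
  then have S_meas [measurable]: "S \<in> borel_measurable borel" by (rule borel_measurable_continuous_onI)
  have S_inv: "S (h + g) = S g" if "h \<in> H2" for h g using \<kappa>_invariant[OF that] by (simp add: S_def)
  have Sq_meas: "(\<lambda>q. S (coset_rep q)) \<in> borel_measurable mQ2"
    using borel_measurable_coset_rep[OF B.H(1) S_cont S_inv] mQ2 by (simp cong: measurable_cong_sets)
  have nn_S: "(\<integral>\<^sup>+x. ennreal (f x) \<partial>\<kappa> g) = ennreal (S g)" for g
  proof -
    interpret K: prob_space "\<kappa> g" by (rule prob_space_\<kappa>)
    have "integrable (\<kappa> g) f"
      using f01 by (intro K.integrable_const_bound[of _ 1] AE_I2) (auto simp: space_\<kappa> cong: measurable_cong_sets[OF sets_\<kappa> refl])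
    then show ?thesis unfolding S_def using f01 by (intro nn_integral_eq_integral AE_I2) (simp_all add: space_\<kappa>)
  qed
  have "openin (coset_topology UNIV H2) (right_coset H2 ` interior W)"
    using openin_right_coset_image[of UNIV H2 "interior W"] B.H(1) G2.H(1) by simp
  then have V: "right_coset H2 ` interior W \<in> sets mQ2" using mQ2 openin_in_borel_of by auto
  have null: "right_coset H2 ` W - right_coset H2 ` interior W \<in> null_sets (completion mQ2)"
    using W(2) by (simp add: essentially_open_projection_def)
  have W_eq: "right_coset H2 ` W = right_coset H2 ` interior W \<union> (right_coset H2 ` W - right_coset H2 ` interior W)"
    using interior_subset[of W] by auto
  have W_meas: "right_coset H2 ` W \<in> sets (completion mQ2)"
    using sets.Un[OF sets_completionI_sets[OF V] null_setsD2[OF null]] by (simp only: W_eq[symmetric])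
  have Sq_meas': "(\<lambda>q. S (coset_rep q)) \<in> borel_measurable (completion mQ2)"
    using Sq_meas by (rule measurable_completion)
  have "(\<integral>x. f x \<partial>\<eta>) = 1 / c * (\<integral>q. indicator (right_coset H2 ` W) q * S (coset_rep q) \<partial>completion mQ2)"
    using \<eta>_int[OF f] by (simp add: set_lebesgue_integral_def S_def)
  also have "(\<integral>q. indicator (right_coset H2 ` W) q * S (coset_rep q) \<partial>completion mQ2) =
      (\<integral>q. indicator (right_coset H2 ` interior W) q * S (coset_rep q) \<partial>completion mQ2)"
  proof (rule integral_cong_AE)
    show "AE q in completion mQ2. indicator (right_coset H2 ` W) q * S (coset_rep q) =
        indicator (right_coset H2 ` interior W) q * S (coset_rep q)"
      using AE_not_in[OF null] by eventually_elim (use interior_subset[of W] in \<open>auto simp: indicator_def\<close>)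
  qed (use V W_meas Sq_meas' in \<open>auto intro!: borel_measurable_times borel_measurable_indicator\<close>)
  also have "\<dots> = (\<integral>q. indicator (right_coset H2 ` interior W) q * S (coset_rep q) \<partial>mQ2)"
    using V Sq_meas by (intro integral_completion borel_measurable_times borel_measurable_indicator)
  also have "\<dots> = enn2real (\<integral>\<^sup>+q. ennreal (indicator (right_coset H2 ` interior W) q * S (coset_rep q)) \<partial>mQ2)"
    using V Sq_meas S0
    by (intro integral_eq_nn_integral borel_measurable_times borel_measurable_indicator AE_I2) simp_all
  also have "(\<integral>\<^sup>+q. ennreal (indicator (right_coset H2 ` interior W) q * S (coset_rep q)) \<partial>mQ2) =
      (\<integral>\<^sup>+q. ennreal (indicator (saturated_interior W) (coset_rep q) * S (coset_rep q)) \<partial>mQ2)"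
    using sets_eq_imp_space_eq[OF mQ2] right_coset_coset_rep[OF B.H(1)]
    by (intro nn_integral_cong) (simp add: saturated_interior_def indicator_def)
  also have "\<dots> = (\<integral>\<^sup>+g. ennreal (indicator (saturated_interior W) g * S g) \<partial>\<nu>2)"
    by (rule \<nu>2(4)) (simp_all add: S_inv saturated_interior_invariant indicator_def)
  also have "\<dots> = (\<integral>\<^sup>+g. indicator (saturated_interior W) g * (\<integral>\<^sup>+x. ennreal (f x) \<partial>\<kappa> g) \<partial>\<nu>2)"
    using S0 by (intro nn_integral_cong) (simp add: nn_S ennreal_mult ennreal_indicator)
  finally have "(\<integral>x. f x \<partial>\<eta>) = enn2real (\<integral>\<^sup>+x. ennreal (f x) \<partial>limit_measure W)"
    using c_pos by (simp add: nn_integral_limit enn2real_mult divide_inverse)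
  also have "\<dots> = (\<integral>x. f x \<partial>limit_measure W)"
    using f01 sets_eq_imp_space_eq[OF sets_limit, of W]
    by (intro integral_eq_nn_integral[symmetric] AE_I2) (simp_all cong: measurable_cong_sets[OF sets_limit refl])
  finally show "(\<integral>x. f x \<partial>\<eta>) = (\<integral>x. f x \<partial>limit_measure W)" .
qed

text \<open>As \<open>\<Delta> \<subseteq> \<Gamma>\<close>, inclusion sends the class of
  \<open>O.s y\<close> to its \<Gamma>-coset, and acting by the inverse of \<open>(0, g)\<close>
  adds \<open>(0, g)\<close> on the right.\<close>

lemma distr_coset_incl:
  "distr (distr \<sigma>o (quot UNIV \<Gamma>) (coset_incl \<Gamma>)) (quot UNIV \<Gamma>) (coset_act (- (0, g))) = \<kappa> g"
proof -
  have incl: "coset_incl \<Gamma> y = right_coset \<Gamma> (O.s y)" if "y \<in> space \<sigma>o" for y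
    using coset_incl_right_coset[OF X.\<Lambda>(1) O.\<Lambda>(1) \<Delta>_sub(1), of "O.s y"] O.s_props(3)[of y] that
    by (simp add: space_\<sigma>o)
  have "(\<lambda>y. right_coset \<Gamma> (O.s y)) \<in> measurable \<sigma>o (quot UNIV \<Gamma>)"
    by (rule measurable_compose[OF O_s measurable_right_coset_UNIV])
  then have incl_meas: "coset_incl \<Gamma> \<in> measurable \<sigma>o (quot UNIV \<Gamma>)"
    using incl by (simp cong: measurable_cong)
  have k: "coset_act (- (0, g)) (right_coset \<Gamma> z) = right_coset \<Gamma> (z + (0, g))" for z :: "'a \<times> 'b"
    by (cases z) (simp add: coset_act_right_coset)
  \<comment> \<open>Expressed through the Borel section \<open>X.s\<close>, the action is visibly
    measurable.\<close>
  have act: "coset_act (- (0, g)) x = right_coset \<Gamma> (X.s x + (0, g))" if "x \<in> space (quot UNIV \<Gamma>)" for x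
    using k[of "X.s x"] unfolding X.s_props(3)[OF that[unfolded space_quot]] .
  have "(\<lambda>x. right_coset \<Gamma> (X.s x + (0, g))) \<in> measurable (quot UNIV \<Gamma>) (quot UNIV \<Gamma>)" by measurable
  moreover have "coset_act (- (0, g)) \<in> measurable (quot UNIV \<Gamma>) (quot UNIV \<Gamma>) \<longleftrightarrow>
      (\<lambda>x. right_coset \<Gamma> (X.s x + (0, g))) \<in> measurable (quot UNIV \<Gamma>) (quot UNIV \<Gamma>)"
    by (rule measurable_cong) (rule act)
  ultimately have act_meas: "coset_act (- (0, g)) \<in> measurable (quot UNIV \<Gamma>) (quot UNIV \<Gamma>)" by blast
  have "coset_act (- (0, g)) (coset_incl \<Gamma> y) = right_coset \<Gamma> (O.s y + (0, g))" if "y \<in> space \<sigma>o" for y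
    using k[of "O.s y"] unfolding incl[OF that] .
  then show ?thesis
    unfolding distr_distr[OF act_meas incl_meas] \<kappa>_def by (intro distr_cong) auto
qed

end

section \<open>Comparison of \<sigma> with \<eta> and the Siegel constant\<close>

theorem theorem7p18:
  fixes H1 :: "'a::{topological_group_add, second_countable_topology, t2_space} set"
    and H2 :: "'b::{topological_group_add, second_countable_topology, t2_space} set"
    and \<Gamma> \<Delta> :: "('a \<times> 'b) set"
    and W :: "'b set"
    and mG1 mH1 :: "'a measure" and mQ1 :: "'a set measure"
    and mG2 mH2 :: "'b measure" and mQ2 :: "'b set measure"
    and \<mu> \<sigma>o \<sigma>X \<sigma> \<eta> :: "('a \<times> 'b) set measure"
    and Y :: "('a \<times> 'b) set set"
    and c :: real
  assumes lc1: "locally_compact_space (euclidean :: 'a topology)"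
    and lc2: "locally_compact_space (euclidean :: 'b topology)"
    and unimod_G1: "unimodular_on (UNIV :: 'a set)"
    and unimod_G2: "unimodular_on (UNIV :: 'b set)"
    and H1: "add_subgroup H1" "closed H1" "unimodular_on H1"
    and H2: "add_subgroup H2" "closed H2" "unimodular_on H2"
    and haar1: "left_haar_measure_on UNIV mG1" "left_haar_measure_on H1 mH1"
    and haar2: "left_haar_measure_on UNIV mG2" "left_haar_measure_on H2 mH2"
    and compat1: "compatible_measures H1 mG1 mH1 mQ1"
    and compat2: "compatible_measures H2 mG2 mH2 mQ2"
    and lattice: "lattice_in UNIV \<Gamma>"
    and \<Delta>: "\<Delta> = \<Gamma> \<inter> (H1 \<times> H2)"
    and L1: "cocompact_lattice_in (H1 \<times> H2) \<Delta>"
    and L2: "closure (snd ` \<Gamma>) = UNIV" "closure (snd ` \<Delta>) = H2"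
    and L3: "\<forall>\<gamma>1 \<gamma>2. (\<gamma>1, \<gamma>2) \<in> \<Gamma> \<and> \<gamma>1 \<in> H1 \<longrightarrow> \<gamma>2 \<in> H2" "\<Gamma> \<inter> ({0} \<times> UNIV) = {(0, 0)}"
    and W: "compact (closure W)" "frontier W \<in> null_sets mG2" "interior W \<noteq> {}"
    and W_proj: "essentially_open_projection H2 mQ2 W"
    and \<mu>: "invariant_prob_measure UNIV \<Gamma> \<mu>"
    and covol: "lattice_constant UNIV \<Gamma> (mG1 \<Otimes>\<^sub>M mG2) \<mu> 1"
    and Y: "Y = right_coset \<Gamma> ` (H1 \<times> W)"
    and \<sigma>: "integrable_transverse_system \<Gamma> H1 \<mu> Y" "transverse_measure \<Gamma> H1 mG1 mH1 \<mu> Y \<sigma>"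
    and \<sigma>o: "invariant_prob_measure (H1 \<times> H2) \<Delta> \<sigma>o"
    and \<sigma>X: "\<sigma>X = distr \<sigma>o (borel_of (coset_topology UNIV \<Gamma>)) (coset_incl \<Gamma>)"
    and c: "lattice_constant (H1 \<times> H2) \<Delta> (mH1 \<Otimes>\<^sub>M mH2) \<sigma>o c"
    and \<eta>: "sets \<eta> = sets (borel_of (coset_topology UNIV \<Gamma>))" "finite_measure \<eta>"
      "\<forall>h\<in>H1. distr \<eta> \<eta> (coset_act (h, 0)) = \<eta>"
      "\<forall>f. compactly_supported_continuous (coset_topology UNIV \<Gamma>) f \<longrightarrow>
         (\<integral>x. f x \<partial>\<eta>) =
           1 / c * (LINT q:right_coset H2 ` W|completion mQ2.
             (\<integral>x. f x \<partial>(distr \<sigma>X (borel_of (coset_topology UNIV \<Gamma>)) (coset_act (- (0, coset_rep q))))))"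
  shows "emeasure \<eta> (coset_space UNIV \<Gamma> - Y) = 0 \<and>
         \<sigma> = restrict_space \<eta> Y \<and>
         emeasure \<sigma> Y = emeasure (completion mQ2) (right_coset H2 ` W) / ennreal c"
proof -
  have sub: "add_subgroup \<Gamma>" "add_subgroup \<Delta>" "discrete \<Gamma>" "discrete \<Delta>" "\<Delta> \<subseteq> H1 \<times> H2"
    using lattice L1 by (auto simp: cocompact_lattice_in_def lattice_in_def)
  have lc: "locally_compact_space (euclidean :: ('a \<times> 'b) topology)"
    using lc1 lc2 by (metis locally_compact_space_prod_topology euclidean_product_topology prod_topology_euclidean)
  have UNIV_sub: "add_subgroup (UNIV :: 'x::group_add set)" by (simp add: add_subgroup_def)
  have H12: "add_subgroup (H1 \<times> H2)"
    using H1(1) H2(1) by (auto simp: add_subgroup_def zero_prod_def)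
  interpret G1: haar_subgroup UNIV mG1 by unfold_locales (use lc1 unimod_G1 haar1 UNIV_sub in auto)
  interpret G2: haar_subgroup UNIV mG2 by unfold_locales (use lc2 unimod_G2 haar2 UNIV_sub in auto)
  interpret A: haar_subgroup H1 mH1 by unfold_locales (use lc1 H1 haar1 in auto)
  interpret B: haar_subgroup H2 mH2 by unfold_locales (use lc2 H2 haar2 in auto)
  interpret X: discrete_subgroup UNIV \<Gamma> by unfold_locales (use lc sub UNIV_sub in auto)
  interpret O: discrete_subgroup "H1 \<times> H2" \<Delta>
    by unfold_locales (use lc sub H12 H1(2) H2(2) in \<open>auto intro: closed_Times\<close>)
  obtain \<nu>1 where \<nu>1: "sets \<nu>1 = sets borel" "sigma_finite_measure \<nu>1"
    "\<And>f. f \<in> borel_measurable borel \<Longrightarrow> (\<integral>\<^sup>+g. f g \<partial>mG1) = (\<integral>\<^sup>+g. (\<integral>\<^sup>+h. f (h + g) \<partial>mH1) \<partial>\<nu>1)"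
    by (rule haar_disintegration[OF G1.haar_subgroup_axioms A.haar_subgroup_axioms compat1]) blast
  obtain \<nu>2 where \<nu>2: "sets \<nu>2 = sets borel" "sigma_finite_measure \<nu>2"
    "\<And>f. f \<in> borel_measurable borel \<Longrightarrow> (\<integral>\<^sup>+g. f g \<partial>mG2) = (\<integral>\<^sup>+g. (\<integral>\<^sup>+h. f (h + g) \<partial>mH2) \<partial>\<nu>2)"
    "\<And>f :: 'b \<Rightarrow> ennreal. f \<in> borel_measurable borel \<Longrightarrow> (\<And>h g. h \<in> H2 \<Longrightarrow> f (h + g) = f g) \<Longrightarrow>
       (\<integral>\<^sup>+q. f (coset_rep q) \<partial>mQ2) = (\<integral>\<^sup>+g. f g \<partial>\<nu>2)"
    by (rule haar_disintegration[OF G2.haar_subgroup_axioms B.haar_subgroup_axioms compat2]) blast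
  have \<mu>': "sets \<mu> = sets (quot UNIV \<Gamma>)" "prob_space \<mu>"
    using \<mu> by (simp_all add: invariant_prob_measure_def invariant_borel_measure_def)
  have L3': "\<And>\<gamma>1 \<gamma>2. (\<gamma>1, \<gamma>2) \<in> \<Gamma> \<Longrightarrow> \<gamma>1 \<in> H1 \<Longrightarrow> \<gamma>2 \<in> H2" using L3(1) by blast
  interpret cut_and_project H1 H2 \<Gamma> \<Delta> mG1 mH1 mG2 mH2 mQ2 \<mu> \<sigma>o c \<nu>1 \<nu>2
    by (intro cut_and_project.intro cut_and_project_axioms.intro G1.haar_subgroup_axioms G2.haar_subgroup_axioms
        A.haar_subgroup_axioms B.haar_subgroup_axioms X.discrete_subgroup_axioms O.discrete_subgroup_axioms)
      (fact \<Delta> L2(2) L3' \<mu>' covol \<sigma>o c \<nu>1 \<nu>2)+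
  have mQ2: "sets mQ2 = sets (quot UNIV H2)"
    and fin: "\<And>C. compactin (coset_topology UNIV H2) C \<Longrightarrow> emeasure mQ2 C < \<infinity>"
    using compat2 by (simp_all add: compatible_measures_def invariant_borel_measure_def)
  have Y_sets: "Y \<in> sets (quot UNIV \<Gamma>)" using \<sigma>(1) by (simp add: integrable_transverse_system_def)
  have \<eta>_eq: "\<eta> = limit_measure W"
  proof (rule limit_measure_unique[OF mQ2 fin W(1) W_proj \<eta>(1,2)])
    fix f assume "compactly_supported_continuous (coset_topology UNIV \<Gamma>) f"
    then show "(\<integral>x. f x \<partial>\<eta>) = 1 / c * (LINT q:right_coset H2 ` W|completion mQ2. (\<integral>x. f x \<partial>\<kappa> (coset_rep q)))"
      using \<eta>(4) by (simp only: \<sigma>X distr_coset_incl)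
  qed
  have \<eta>_compl: "emeasure \<eta> (coset_space UNIV \<Gamma> - Y) = 0"
    unfolding \<eta>_eq by (rule emeasure_limit_complement[OF Y Y_sets])
  interpret \<eta>: finite_measure \<eta> by (rule \<eta>(2))
  have \<sigma>_sets: "sets \<sigma> = sets (restrict_space (quot UNIV \<Gamma>) Y)"
    using \<sigma>(2) by (simp add: transverse_measure_def)
  have \<sigma>_eq: "emeasure \<sigma> B = emeasure \<eta> B" if B: "B \<in> sets (quot UNIV \<Gamma>)" "B \<subseteq> Y" for B
  proof -
    have lim: "emeasure \<eta> B = ennreal (inverse c) * (\<integral>\<^sup>+g. emeasure (\<kappa> g) B \<partial>\<nu>2)"
      unfolding \<eta>_eq by (rule emeasure_limit_subset[OF mQ2 W_proj Y B])
    \<comment> \<open>The right-hand side is already known to be \<open>emeasure \<eta> B\<close>,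
      so finiteness of \<eta> gives the bound under which the transverse formula determines
      \<open>emeasure \<sigma> B\<close>.\<close>
    have "ennreal (inverse c) * (\<integral>\<^sup>+g. emeasure (\<kappa> g) B \<partial>\<nu>2) \<noteq> \<infinity>"
      using \<eta>.emeasure_finite[of B] lim by simp
    then have "(\<integral>\<^sup>+g. emeasure (\<kappa> g) B \<partial>\<nu>2) < \<infinity>"
      using c_pos by (simp add: ennreal_mult_eq_top_iff less_top)
    then show ?thesis using transverse_measure_formula[OF Y Y_sets \<sigma>(2) B] lim by simp
  qed
  have Y_space: "Y \<inter> space \<eta> \<in> sets \<eta>" using Y_sets \<eta>(1) by auto
  have "\<sigma> = restrict_space \<eta> Y"
  proof (rule measure_eqI)
    show sets: "sets \<sigma> = sets (restrict_space \<eta> Y)"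
      using \<sigma>_sets sets_restrict_space_cong[OF \<eta>(1)] by simp
    fix B assume "B \<in> sets \<sigma>"
    then have B: "B \<in> sets (quot UNIV \<Gamma>)" "B \<subseteq> Y"
      using Y_sets unfolding \<sigma>_sets by (auto simp: sets_restrict_space)
    then show "emeasure \<sigma> B = emeasure (restrict_space \<eta> Y) B"
      by (simp add: \<sigma>_eq emeasure_restrict_space[OF Y_space])
  qed
  moreover have "emeasure \<sigma> Y = emeasure (completion mQ2) (right_coset H2 ` W) / ennreal c"
  proof -
    have Y_sub: "Y \<subseteq> coset_space UNIV \<Gamma>" by (auto simp: Y coset_space_def)
    have V: "right_coset H2 ` interior W \<in> sets mQ2"
      using openin_in_borel_of[OF openin_right_coset_image[of UNIV H2 "interior W"]] H2(1) UNIV_sub mQ2 by simp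
    have null: "right_coset H2 ` W - right_coset H2 ` interior W \<in> null_sets (completion mQ2)"
      using W_proj by (simp add: essentially_open_projection_def)
    have "emeasure (completion mQ2) (right_coset H2 ` interior W \<union> (right_coset H2 ` W - right_coset H2 ` interior W)) =
        emeasure (completion mQ2) (right_coset H2 ` interior W)"
      using V by (intro emeasure_Un_null_set null) auto
    moreover have "right_coset H2 ` interior W \<union> (right_coset H2 ` W - right_coset H2 ` interior W) = right_coset H2 ` W"
      using interior_subset[of W] by auto
    ultimately have compl: "emeasure (completion mQ2) (right_coset H2 ` W) = emeasure mQ2 (right_coset H2 ` interior W)"
      using V by simp
    have "emeasure \<eta> (coset_space UNIV \<Gamma>) = emeasure \<eta> Y + emeasure \<eta> (coset_space UNIV \<Gamma> - Y)"
      using plus_emeasure[of Y \<eta> "coset_space UNIV \<Gamma> - Y"] Y_sets sets.compl_sets[OF Y_sets] Y_sub \<eta>(1)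
      by (simp add: Un_absorb1)
    \<comment> \<open>As the complement of \<open>Y\<close> is null, the Siegel constant is the
      total mass of \<eta>; each \<kappa> being a probability measure, that mass is
      \<open>inverse c\<close> times the measure of the projected interior.\<close>
    then have "emeasure \<sigma> Y = emeasure \<eta> (coset_space UNIV \<Gamma>)"
      using \<eta>_compl \<sigma>_eq[OF Y_sets order_refl] by simp
    also have "\<dots> = ennreal (inverse c) * emeasure mQ2 (right_coset H2 ` interior W)"
      unfolding \<eta>_eq by (rule emeasure_limit_space[OF mQ2])
    finally show ?thesis
      using c_pos by (simp add: compl divide_ennreal_def inverse_ennreal mult.commute)
  qed
  ultimately show ?thesis using \<eta>_compl by simp
qed

end
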